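(* Let $M$ tend to infinity with $R$ in such a way that $M\le R^{1/10-o(1)}$, and let $L>0$ satisfy $M^{1/2+o(1)}\le L\le M$. Then, as $R\to\infty$, the random vector $\big(\mathcal A_R(\lambda_j),\mathcal A_R(\lambda_{j+k})\big)$, where the pair $(j,k)$ is drawn uniformly from $\{1\le j\le K\}\times\{k\in\mathbb Z: M\le k\le M+L\}$, converges in distribution to $(Y_1,Y_2):=(\mathcal A_\infty(r,\theta),\mathcal A_\infty(r',\theta))$, where $(r,\theta,r')$ is uniformly distributed on $[-\tfrac1{\sqrt2},\tfrac1{\sqrt2}]\times[0,2\pi)\times[-\tfrac1{\sqrt2},\tfrac1{\sqrt2}]$.
   Context: For $R>0$: $\Gamma_R=\mathbb Z^2\cap\{z: R-\tfrac1{\sqrt2}<\|z\|<R+\tfrac1{\sqrt2}\}$, $K=\#\Gamma_R$, and $\Gamma_R=\{\lambda_1,\dots,\lambda_K\}$ is ordered by nondecreasing polar argument in $[0,2\pi)$ (ties arbitrary), indices cyclic mod $K$. $S=[-\tfrac12,\tfrac12]^2$, $\mathcal A_R(\lambda)=\operatorname{Area}((\lambda+S)\cap B(R))$ with $B(R)$ the open disc of radius $R$ centred at $0$. $T_\theta$ denotes rotation by $\theta$, $S_{r,\theta}=(r,0)+T_\theta S$, and $\mathcal A_\infty(r,\theta)=\operatorname{Area}\{(x,y)\in S_{r,\theta}:x\le0\}$. *)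

theory Defs
  imports "HOL-Probability.Probability"
begin

text \<open>The plane is identified with the complex numbers; rotation by \<open>\<theta>\<close> is
  multiplication by \<open>cis \<theta>\<close>.\<close>

definition Gam :: "real \<Rightarrow> complex set" where
  "Gam R = {z. Re z \<in> \<int> \<and> Im z \<in> \<int> \<and> R - 1 / sqrt 2 < norm z \<and> norm z < R + 1 / sqrt 2}"

definition K :: "real \<Rightarrow> int" where
  "K R = int (card (Gam R))"

text \<open>Enumerations of \<open>Gam R\<close> by nondecreasing polar argument in \<open>[0, 2\<pi>)\<close>, ties being broken
  arbitrarily, extended to all integer indices with period \<open>K R\<close>.  The origin can lie in
  \<open>Gam R\<close> only if \<open>R < 1 / sqrt 2\<close>; there \<open>Arg2pi 0 = 0\<close> is used.\<close>

definition arg_enum :: "real \<Rightarrow> (int \<Rightarrow> complex) \<Rightarrow> bool" where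
  "arg_enum R l \<longleftrightarrow>
     bij_betw l {1..K R} (Gam R) \<and>
     mono_on {1..K R} (\<lambda>j. Arg2pi (l j)) \<and>
     (\<forall>j. l (j + K R) = l j)"

definition unit_square :: "complex set" where
  "unit_square = {z. Re z \<in> {-1/2..1/2} \<and> Im z \<in> {-1/2..1/2}}"

definition area_R :: "real \<Rightarrow> complex \<Rightarrow> real" where
  "area_R R z = measure lborel ((\<lambda>w. z + w) ` unit_square \<inter> ball 0 R)"

definition rot_square :: "real \<Rightarrow> real \<Rightarrow> complex set" where
  "rot_square r \<theta> = (\<lambda>w. complex_of_real r + cis \<theta> * w) ` unit_square"

definition area_inf :: "real \<Rightarrow> real \<Rightarrow> real" where
  "area_inf r \<theta> = measure lborel {z \<in> rot_square r \<theta>. Re z \<le> 0}"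

text \<open>Weak convergence along a filter, for Borel measures on an arbitrary topological space
  (\<open>weak_conv_m\<close> covers only sequences of measures on the real line).\<close>

definition weak_conv_along ::
    "('i \<Rightarrow> 'a::topological_space measure) \<Rightarrow> 'a measure \<Rightarrow> 'i filter \<Rightarrow> bool" where
  "weak_conv_along \<mu> \<nu> F \<longleftrightarrow>
     (\<forall>f::'a \<Rightarrow> real. continuous_on UNIV f \<longrightarrow> bounded (range f) \<longrightarrow>
        ((\<lambda>i. integral\<^sup>L (\<mu> i) f) \<longlongrightarrow> integral\<^sup>L \<nu> f) F)"

definition pair_law ::
    "real \<Rightarrow> (int \<Rightarrow> complex) \<Rightarrow> real \<Rightarrow> real \<Rightarrow> (real \<times> real) measure" where
  "pair_law R l M L =
     distr (measure_pmf (pmf_of_set ({1..K R} \<times> {k::int. M \<le> of_int k \<and> of_int k \<le> M + L})))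
       borel (\<lambda>(j, k). (area_R R (l j), area_R R (l (j + k))))"

definition limit_law :: "(real \<times> real) measure" where
  "limit_law =
     distr (uniform_measure lborel
              ({-1 / sqrt 2..1 / sqrt 2} \<times> {0..<2 * pi} \<times> {-1 / sqrt 2..1 / sqrt 2}))
       borel (\<lambda>(r, \<theta>, r'). (area_inf r \<theta>, area_inf r' \<theta>))"

end

theory Submission
  imports Defs
begin

text \<open>Near a point of direction \<open>\<theta>\<close> the annulus is, on any bounded scale, a straight strip of
  width \<open>\<surd>2\<close>. If the slope of the strip is not too close to a rational of small denominator,
  Dirichlet's theorem provides an approximation \<open>a / q\<close> with \<open>q\<close> large but bounded, and \<open>q\<close>
  consecutive columns of lattice points then equidistribute across the strip up to \<open>O(1)\<close> points.
  So, outside an arbitrarily small proportion of the annulus, \<open>\<Gamma>\<^sub>R\<close> decomposes into blocks of bounded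
  size on each of which \<open>|z| - R\<close> is nearly uniform. Summing over the blocks shows that
  \<open>(|z| - R, arg z)\<close> equidistributes over \<open>\<Gamma>\<^sub>R\<close>. A window of many consecutive indices consists of whole
  blocks, up to boundedly many points at its ends and exceptional points that are rare on average; so for
  most \<open>j\<close> the values \<open>|\<lambda>\<^bsub>j+k\<^esub>| - R\<close> are nearly uniform as \<open>k\<close> runs through
  \<open>[M, M + L]\<close>, whatever \<open>\<lambda>\<^sub>j\<close> is, while \<open>arg \<lambda>\<^bsub>j+k\<^esub>\<close> stays close to \<open>arg \<lambda>\<^sub>j\<close>.\<close>

text \<open>Slopes close to a rational of small denominator q must be discarded: there the lattice
  points of the strip lie on few lines nearly parallel to it, so |z| - R clusters at about q values.
  A block has \<open>fact Q\<close> columns because this is a multiple of every denominator up to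
  \<open>Q\<close>, so one block length serves all directions. Parameters are fixed in the order:
  tolerance \<open>e\<close>; number \<open>N\<close> of radial slices; bound \<open>q0\<close>
  below all denominators, which makes the counting error per slice small; \<open>Q\<close>, which
  makes bad slopes rare; finally R. Areas enter through the tangent half-plane:
  \<open>halfarea\<close> is Lipschitz in the radial offset and the direction, and curvature costs
  O(1/R). Once the first point of the pair is fixed, the test function for the second area depends
  on \<open>j\<close>; so the statement on windows has to be uniform over all test functions with a
  common bound and modulus of continuity. The growth conditions act through M / R -> 0, which makes
  changes of direction and wrap-around of indices rare, and L -> \<infinity>, which outweighs the
  points at the ends of a window.\<close>

abbreviation window :: "real set" where
  "window \<equiv> {-1 / sqrt 2..1 / sqrt 2}"

section \<open>Areas of cut squares\<close>

lemma measurable_Complex [measurable]: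
  "(\<lambda>p :: real \<times> real. Complex (fst p) (snd p)) \<in> borel_measurable borel"
  by (intro borel_measurable_continuous_onI continuous_intros)

text \<open>Carries Tonelli's theorem over from pairs of reals; the two measures agree on boxes,
  which determine \<open>lborel\<close>.\<close>

lemma lborel_complex_eq:
  "(lborel :: complex measure) = distr lborel borel (\<lambda>p :: real \<times> real. Complex (fst p) (snd p))"
proof (rule lborel_eqI)
  fix l u :: complex
  assume *: "\<And>b. b \<in> Basis \<Longrightarrow> l \<bullet> b \<le> u \<bullet> b"
  have le: "Re l \<le> Re u" "Im l \<le> Im u"
    using *[of 1] *[of \<i>] by (auto simp: Basis_complex_def)
  have "emeasure (distr lborel borel (\<lambda>p :: real \<times> real. Complex (fst p) (snd p))) (box l u)
    = emeasure lborel ((\<lambda>p :: real \<times> real. Complex (fst p) (snd p)) -` box l u)"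
    by (subst emeasure_distr) (auto simp: measurable_Complex)
  also have "(\<lambda>p :: real \<times> real. Complex (fst p) (snd p)) -` box l u = box (Re l, Im l) (Re u, Im u)"
    by (auto simp: box_def Basis_complex_def Basis_prod_def)
  also have "emeasure lborel \<dots> = ennreal (\<Prod>b\<in>Basis. (u - l) \<bullet> b)"
    using le by (subst emeasure_lborel_box)
      (auto simp: Basis_complex_def Basis_prod_def prod.union_disjoint prod.reindex inj_on_def)
  finally show "emeasure (distr lborel borel (\<lambda>p :: real \<times> real. Complex (fst p) (snd p))) (box l u)
    = ennreal (\<Prod>b\<in>Basis. (u - l) \<bullet> b)" .
qed simp

lemma nn_integral_complex:
  assumes f [measurable]: "f \<in> borel_measurable (borel :: complex measure)"
  shows "(\<integral>\<^sup>+z. f z \<partial>lborel) = (\<integral>\<^sup>+y. \<integral>\<^sup>+x. f (Complex x y) \<partial>lborel \<partial>lborel)"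
    "(\<integral>\<^sup>+z. f z \<partial>lborel) = (\<integral>\<^sup>+x. \<integral>\<^sup>+y. f (Complex x y) \<partial>lborel \<partial>lborel)"
proof -
  have m: "(\<lambda>p :: real \<times> real. f (Complex (fst p) (snd p))) \<in> borel_measurable (lborel \<Otimes>\<^sub>M lborel)"
    unfolding lborel_prod by measurable
  have "(\<integral>\<^sup>+z. f z \<partial>lborel) = (\<integral>\<^sup>+p. f (Complex (fst p) (snd p)) \<partial>(lborel \<Otimes>\<^sub>M lborel))"
    by (subst lborel_complex_eq, subst nn_integral_distr) (auto simp: lborel_prod measurable_Complex)
  then show "(\<integral>\<^sup>+z. f z \<partial>lborel) = (\<integral>\<^sup>+y. \<integral>\<^sup>+x. f (Complex x y) \<partial>lborel \<partial>lborel)"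
    "(\<integral>\<^sup>+z. f z \<partial>lborel) = (\<integral>\<^sup>+x. \<integral>\<^sup>+y. f (Complex x y) \<partial>lborel \<partial>lborel)"
    using lborel_pair.nn_integral_snd[OF m] lborel.nn_integral_fst[OF m] by simp_all
qed

lemma borel_eq_distrI:
  assumes g: "g \<in> borel_measurable borel"
    and "\<And>f :: complex \<Rightarrow> ennreal. f \<in> borel_measurable borel \<Longrightarrow>
      (\<integral>\<^sup>+z. f (g z) \<partial>lborel) = (\<integral>\<^sup>+z. f z \<partial>lborel)"
  shows "distr lborel borel g = (lborel :: complex measure)"
proof (rule measure_eqI)
  fix A :: "complex set" assume "A \<in> sets (distr lborel borel g)"
  then have A: "A \<in> sets borel" by simp
  have "emeasure (distr lborel borel g) A = (\<integral>\<^sup>+z. indicator A z \<partial>distr lborel borel g)" using A by simp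
  also have "\<dots> = (\<integral>\<^sup>+z. indicator A (g z) \<partial>lborel)" using A g by (intro nn_integral_distr) auto
  also have "\<dots> = (\<integral>\<^sup>+z. indicator A z \<partial>lborel)" using A by (intro assms(2)) auto
  finally show "emeasure (distr lborel borel g) A = emeasure lborel A" using A by simp
qed simp

lemma nn_integral_shift_real:
  fixes f :: "real \<Rightarrow> ennreal"
  assumes "f \<in> borel_measurable borel"
  shows "(\<integral>\<^sup>+x. f (x + t) \<partial>lborel) = (\<integral>\<^sup>+x. f x \<partial>lborel)"
  using nn_integral_real_affine[OF assms, of 1 t] by (simp add: add.commute)

text \<open>The shear translates each horizontal line by an amount depending on the line only, and
  linear measure is translation invariant; Tonelli does the rest.\<close>

lemma shear_Re_lborel:
  "distr lborel borel (\<lambda>z. Complex (Re z + t * Im z) (Im z)) = lborel"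
proof (rule borel_eq_distrI)
  show m: "(\<lambda>z. Complex (Re z + t * Im z) (Im z)) \<in> borel_measurable borel"
    by (intro borel_measurable_continuous_onI continuous_intros)
  fix f :: "complex \<Rightarrow> ennreal" assume f [measurable]: "f \<in> borel_measurable borel"
  have c: "(\<lambda>x. f (Complex x y)) \<in> borel_measurable borel" for y
    by (rule measurable_compose[OF _ f]) (intro borel_measurable_continuous_onI continuous_intros)
  show "(\<integral>\<^sup>+z. f (Complex (Re z + t * Im z) (Im z)) \<partial>lborel) = (\<integral>\<^sup>+z. f z \<partial>lborel)"
    by (subst (1 2) nn_integral_complex(1)) (simp_all add: nn_integral_shift_real[OF c] measurable_compose[OF m f])
qed

lemma shear_Im_lborel:
  "distr lborel borel (\<lambda>z. Complex (Re z) (Im z + t * Re z)) = lborel"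
proof (rule borel_eq_distrI)
  show m: "(\<lambda>z. Complex (Re z) (Im z + t * Re z)) \<in> borel_measurable borel"
    by (intro borel_measurable_continuous_onI continuous_intros)
  fix f :: "complex \<Rightarrow> ennreal" assume f [measurable]: "f \<in> borel_measurable borel"
  have c: "(\<lambda>y. f (Complex x y)) \<in> borel_measurable borel" for x
    by (rule measurable_compose[OF _ f]) (intro borel_measurable_continuous_onI continuous_intros)
  show "(\<integral>\<^sup>+z. f (Complex (Re z) (Im z + t * Re z)) \<partial>lborel) = (\<integral>\<^sup>+z. f z \<partial>lborel)"
    by (subst (1 2) nn_integral_complex(2)) (simp_all add: nn_integral_shift_real[OF c] measurable_compose[OF m f])
qed

lemma cnj_lborel: "distr lborel borel cnj = lborel"
proof (rule borel_eq_distrI)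
  show m: "cnj \<in> borel_measurable borel"
    by (intro borel_measurable_continuous_onI continuous_intros)
  fix f :: "complex \<Rightarrow> ennreal" assume f [measurable]: "f \<in> borel_measurable borel"
  have c: "(\<lambda>y. f (Complex x y)) \<in> borel_measurable borel" for x
    by (rule measurable_compose[OF _ f]) (intro borel_measurable_continuous_onI continuous_intros)
  have "(\<integral>\<^sup>+y. f (Complex x (- y)) \<partial>lborel) = (\<integral>\<^sup>+y. f (Complex x y) \<partial>lborel)" for x
    using nn_integral_real_affine[OF c[of x], of "-1" 0] by simp
  then show "(\<integral>\<^sup>+z. f (cnj z) \<partial>lborel) = (\<integral>\<^sup>+z. f z \<partial>lborel)"
    by (subst (1 2) nn_integral_complex(2)) (simp_all add: measurable_compose[OF m f] complex_cnj)
qed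

lemma distr_lborel_comp:
  fixes g h :: "complex \<Rightarrow> complex"
  assumes "distr lborel borel g = lborel" "distr lborel borel h = lborel"
    "g \<in> borel_measurable borel" "h \<in> borel_measurable borel"
  shows "distr lborel borel (\<lambda>z. g (h z)) = lborel"
  using distr_distr[of g borel borel h lborel] assms by (simp add: comp_def)

text \<open>A rotation is a product of three shears, unless it is the rotation by \<open>\<pi>\<close>.\<close>

lemma rotation_lborel:
  fixes c :: complex
  assumes "norm c = 1"
  shows "distr lborel borel (\<lambda>z. c * z) = lborel"
proof -
  have *: "distr lborel borel (\<lambda>z. c * z) = lborel" if c: "norm c = 1" "Re c \<noteq> -1" for c :: complex
  proof -
    define a where "a = Re c"
    define b where "b = Im c"
    \<comment> \<open>For c = cis \<phi> this is - tan (\<phi> / 2); the three shears have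
      parameters t, sin \<phi> and t. The half turn is excluded because 1 + a vanishes
      there.\<close>
    define t where "t = - b / (1 + a)"
    have ab: "a\<^sup>2 + b\<^sup>2 = 1" using c(1) by (simp add: a_def b_def cmod_def)
    have a1: "1 + a \<noteq> 0" using c(2) by (auto simp: a_def add_eq_0_iff)
    have t1: "1 + b * t = a"
    proof -
      have "(1 + b * t) * (1 + a) = 1 + a - b\<^sup>2" using a1 by (simp add: t_def field_simps power2_eq_square)
      also have "\<dots> = a * (1 + a)" using ab by (simp add: power2_eq_square algebra_simps)
      finally show ?thesis using a1 by simp
    qed
    have t2: "t * (1 + a) = - b" using a1 by (simp add: t_def)
    let ?S1 = "\<lambda>z. Complex (Re z + t * Im z) (Im z)" and ?S2 = "\<lambda>z. Complex (Re z) (Im z + b * Re z)"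
    have m: "?S1 \<in> borel_measurable borel" "?S2 \<in> borel_measurable borel"
      by (intro borel_measurable_continuous_onI continuous_intros)+
    have "distr lborel borel (\<lambda>z. ?S1 (?S2 (?S1 z))) = lborel"
      by (rule distr_lborel_comp[OF shear_Re_lborel distr_lborel_comp[OF shear_Im_lborel shear_Re_lborel m(2,1)]
            m(1) measurable_compose[OF m(1,2)]])
    moreover have "?S1 (?S2 (?S1 z)) = c * z" for z
    proof -
      obtain x y where z: "z = Complex x y" by (cases z)
      have "Re (?S1 (?S2 (?S1 z))) = (1 + b * t) * x + (t * (1 + (1 + b * t))) * y"
        by (simp add: z algebra_simps)
      also have "\<dots> = a * x - b * y" unfolding t1 t2 by simp
      finally have re: "Re (?S1 (?S2 (?S1 z))) = a * x - b * y" .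
      have "Im (?S1 (?S2 (?S1 z))) = b * x + (1 + b * t) * y" by (simp add: z algebra_simps)
      also have "\<dots> = b * x + a * y" unfolding t1 by simp
      finally show ?thesis using re by (auto simp: complex_eq_iff z a_def b_def)
    qed
    ultimately show ?thesis by simp
  qed
  show ?thesis
  proof (cases "Re c = -1")
    case True
    then have "Im c = 0" using assms by (simp add: cmod_def)
    \<comment> \<open>The half turn is two quarter turns, and these are covered by the product of
      shears.\<close>
    then have c: "c = \<i> * \<i>" using True by (simp add: complex_eq_iff)
    have "distr lborel borel (\<lambda>z. \<i> * (\<i> * z)) = lborel"
      using *[of \<i>] by (intro distr_lborel_comp[of "\<lambda>z. \<i> * z" "\<lambda>z. \<i> * z"]) auto
    then show ?thesis unfolding c mult.assoc .
  qed (use * assms in auto)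
qed

lemma measure_vimage_isometry:
  fixes g :: "complex \<Rightarrow> complex"
  assumes "distr lborel borel g = lborel" "g \<in> borel_measurable borel" "A \<in> sets borel"
  shows "measure lborel (g -` A) = measure lborel A"
  using measure_distr[of g lborel borel A] assms by simp

section \<open>The unit square cut by a half-plane\<close>

definition halfarea :: "real \<Rightarrow> complex \<Rightarrow> real" where
  "halfarea r c = measure lborel {w \<in> unit_square. r + Re (c * w) \<le> 0}"

lemma unit_square_closed [measurable]: "unit_square \<in> sets borel"
proof -
  have "unit_square = {z. -1/2 \<le> Re z} \<inter> {z. Re z \<le> 1/2} \<inter> {z. -1/2 \<le> Im z} \<inter> {z. Im z \<le> 1/2}"
    by (auto simp: unit_square_def)
  also have "closed \<dots>"
    by (intro closed_Int closed_Collect_le continuous_intros)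
  finally show ?thesis by (rule borel_closed)
qed

lemma unit_square_norm_sq: "w \<in> unit_square \<Longrightarrow> (norm w)\<^sup>2 \<le> 1/2"
proof -
  assume w: "w \<in> unit_square"
  have "(Re w)\<^sup>2 \<le> (1/2)\<^sup>2" "(Im w)\<^sup>2 \<le> (1/2)\<^sup>2"
    using w by (auto simp: unit_square_def abs_le_square_iff[symmetric])
  then show ?thesis by (simp add: cmod_power2 power_divide)
qed

lemma unit_square_norm: "w \<in> unit_square \<Longrightarrow> norm w \<le> 1"
proof -
  assume "w \<in> unit_square"
  then have "(norm w)\<^sup>2 \<le> 1\<^sup>2" using unit_square_norm_sq[of w] by simp
  then show "norm w \<le> 1" by (rule power2_le_imp_le) simp
qed

lemma unit_square_box: "unit_square = cbox (Complex (-1/2) (-1/2)) (Complex (1/2) (1/2))"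
  by (auto simp: unit_square_def cbox_def Basis_complex_def)

lemma emeasure_unit_square: "emeasure lborel unit_square = 1"
  unfolding unit_square_box
  by (subst emeasure_lborel_cbox) (auto simp: Basis_complex_def)

lemma fmeasurable_unit_square_subset:
  assumes "A \<subseteq> unit_square" "A \<in> sets borel"
  shows "A \<in> fmeasurable lborel" "measure lborel A \<le> 1"
proof -
  have S: "unit_square \<in> fmeasurable lborel" by (rule fmeasurableI) (auto simp: emeasure_unit_square)
  show "A \<in> fmeasurable lborel" using fmeasurableI2[OF S assms(1)] assms(2) by simp
  have "measure lborel A \<le> measure lborel unit_square"
    using assms by (intro measure_mono_fmeasurable S) auto
  then show "measure lborel A \<le> 1" by (simp add: measure_def emeasure_unit_square)
qed

lemma measure_diff_le:
  assumes "A \<subseteq> unit_square" "B \<subseteq> unit_square" "D \<subseteq> unit_square"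
    "A \<in> sets borel" "B \<in> sets borel" "D \<in> sets borel"
    "A - B \<subseteq> D" "B - A \<subseteq> D"
  shows "\<bar>measure lborel A - measure lborel B\<bar> \<le> measure lborel D"
proof -
  have *: "measure lborel A \<le> measure lborel B + measure lborel D"
    if "A - B \<subseteq> D" "A \<in> sets borel" "B \<in> sets borel" "B \<subseteq> unit_square" for A B
  proof -
    have "measure lborel A \<le> measure lborel (B \<union> D)"
      using that assms by (intro measure_mono_fmeasurable fmeasurable.Un fmeasurable_unit_square_subset) auto
    also have "\<dots> \<le> measure lborel B + measure lborel D"
      using that assms by (intro measure_Un_le) auto
    finally show ?thesis .
  qed
  show ?thesis using *[of A B] *[of B A] assms by simp
qed

lemma strip_measurable [measurable]: "{w \<in> unit_square. \<bar>a + Re (c * w)\<bar> \<le> e} \<in> sets borel"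
proof -
  have "closed {w. \<bar>a + Re (c * w)\<bar> \<le> e}" by (intro closed_Collect_le continuous_intros)
  then have "unit_square \<inter> {w. \<bar>a + Re (c * w)\<bar> \<le> e} \<in> sets borel"
    by (intro sets.Int unit_square_closed borel_closed)
  then show ?thesis by (simp add: Int_def)
qed

lemma half_measurable [measurable]: "{w \<in> unit_square. r + Re (c * w) \<le> 0} \<in> sets borel"
proof -
  have "closed {w. r + Re (c * w) \<le> 0}" by (intro closed_Collect_le continuous_intros)
  then have "unit_square \<inter> {w. r + Re (c * w) \<le> 0} \<in> sets borel"
    by (intro sets.Int unit_square_closed borel_closed)
  then show ?thesis by (simp add: Int_def)
qed

lemma unit_square_ii: "\<i> * w \<in> unit_square \<longleftrightarrow> w \<in> unit_square"
  by (auto simp: unit_square_def)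

lemma unit_square_cnj: "cnj w \<in> unit_square \<longleftrightarrow> w \<in> unit_square"
  by (auto simp: unit_square_def)

text \<open>The square has the symmetry of the lattice. This invariance later allows sums over
  \<open>Gam R\<close> to be reduced to the quarter \<open>upper R\<close>.\<close>

lemma halfarea_ii: "halfarea r (\<i> * c) = halfarea r c"
proof -
  have "(\<lambda>w. \<i> * w) -` {w \<in> unit_square. r + Re (c * w) \<le> 0} = {w \<in> unit_square. r + Re (\<i> * c * w) \<le> 0}"
    unfolding vimage_def mem_Collect_eq unit_square_ii mult.assoc[symmetric] mult.commute[of \<i> c] ..
  then show ?thesis unfolding halfarea_def
    using measure_vimage_isometry[OF rotation_lborel[of \<i>] _ half_measurable[of r c]] by simp
qed

text \<open>Turning \<open>z\<close> to the positive real axis turns the square by minus the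
  argument of \<open>z\<close>, whereas \<open>area_inf\<close> turns it by the positive angle; the
  reflection reconciles the two.\<close>

lemma halfarea_cnj: "halfarea r (cnj c) = halfarea r c"
proof -
  have "Re (c * cnj w) = Re (cnj c * w)" for w by simp
  then have "cnj -` {w \<in> unit_square. r + Re (c * w) \<le> 0} = {w \<in> unit_square. r + Re (cnj c * w) \<le> 0}"
    by (auto simp: unit_square_cnj)
  moreover have "cnj \<in> borel_measurable borel"
    by (intro borel_measurable_continuous_onI continuous_intros)
  ultimately show ?thesis unfolding halfarea_def
    using measure_vimage_isometry[OF cnj_lborel _ half_measurable[of r c]] by simp
qed

text \<open>Undoing the area-preserving motion w -> r + cis \<theta> w trades a moving square for a
  moving half-plane, whose dependence on the parameters is easier to control.\<close>

lemma area_inf_eq_halfarea: "area_inf r \<theta> = halfarea r (cis \<theta>)"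
proof -
  let ?g = "\<lambda>w. complex_of_real r + cis \<theta> * w"
  let ?A = "{z \<in> rot_square r \<theta>. Re z \<le> 0}"
  have g: "distr lborel borel ?g = lborel"
    using distr_lborel_comp[OF lborel_distr_plus[of "complex_of_real r"] rotation_lborel[of "cis \<theta>"]] by simp
  have "compact (rot_square r \<theta>)" unfolding rot_square_def unit_square_box
    by (intro compact_continuous_image continuous_intros compact_cbox)
  then have "closed (rot_square r \<theta> \<inter> {z. Re z \<le> 0})"
    by (intro closed_Int compact_imp_closed closed_Collect_le continuous_intros)
  then have A: "?A \<in> sets borel" by (simp add: Int_def borel_closed)
  have "?g -` ?A = {w \<in> unit_square. r + Re (cis \<theta> * w) \<le> 0}"
    by (auto simp: rot_square_def)
  then show ?thesis unfolding area_inf_def halfarea_def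
    using measure_vimage_isometry[OF g _ A] by simp
qed

text \<open>Every horizontal section of the strip lies in an interval of length 2 e / \<bar>Re
  c\<bar>, which is at most 4 e.\<close>

lemma measure_strip_aux:
  assumes c: "1/2 \<le> \<bar>Re c\<bar>" and e: "0 \<le> e"
  shows "measure lborel {w \<in> unit_square. \<bar>a + Re (c * w)\<bar> \<le> e} \<le> 4 * e"
proof -
  let ?A = "{w \<in> unit_square. \<bar>a + Re (c * w)\<bar> \<le> e}"
  have sec: "(\<integral>\<^sup>+x. indicator ?A (Complex x y) \<partial>lborel) \<le> ennreal (4 * e) * indicator {-1/2..1/2} y" for y
  proof (cases "y \<in> {-1/2..1/2}")
    case True
    define d where "d = (Im c * y - a) / Re c"
    have "indicator ?A (Complex x y) \<le> (indicator {d - 2 * e..d + 2 * e} x :: ennreal)" for x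
    proof (cases "Complex x y \<in> ?A")
      case True
      have rc: "Re c \<noteq> 0" using c by auto
      have "Re c * (x - d) = a + Re (c * Complex x y)"
        using rc by (simp add: d_def field_simps)
      then have "\<bar>Re c\<bar> * \<bar>x - d\<bar> = \<bar>a + Re (c * Complex x y)\<bar>" by (metis abs_mult)
      also have "\<dots> \<le> e" using True by simp
      finally have "\<bar>Re c\<bar> * \<bar>x - d\<bar> \<le> e" .
      moreover have "1/2 * \<bar>x - d\<bar> \<le> \<bar>Re c\<bar> * \<bar>x - d\<bar>" using c by (intro mult_right_mono) auto
      ultimately have "\<bar>x - d\<bar> \<le> 2 * e" by simp
      then show ?thesis by (auto simp: indicator_def abs_le_iff)
    qed auto
    then have "(\<integral>\<^sup>+x. indicator ?A (Complex x y) \<partial>lborel) \<le> (\<integral>\<^sup>+x. indicator {d - 2 * e..d + 2 * e} x \<partial>lborel)"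
      by (intro nn_integral_mono) auto
    also have "\<dots> = ennreal (4 * e)" using e by simp
    finally show ?thesis using True by simp
  qed (auto simp: unit_square_def)
  have "emeasure lborel ?A = (\<integral>\<^sup>+z. indicator ?A z \<partial>lborel)" by simp
  also have "\<dots> = (\<integral>\<^sup>+y. \<integral>\<^sup>+x. indicator ?A (Complex x y) \<partial>lborel \<partial>lborel)"
    by (rule nn_integral_complex(1)) simp
  also have "\<dots> \<le> (\<integral>\<^sup>+y. ennreal (4 * e) * indicator {-1/2..1/2} y \<partial>(lborel :: real measure))"
    by (intro nn_integral_mono sec)
  also have "\<dots> = ennreal (4 * e)" by (simp add: nn_integral_cmult)
  finally show ?thesis using e by (simp add: measure_def enn2real_leI)
qed

lemma measure_strip:
  assumes c: "norm c = 1" and e: "0 \<le> e"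
  shows "measure lborel {w \<in> unit_square. \<bar>a + Re (c * w)\<bar> \<le> e} \<le> 4 * e"
proof (cases "1/2 \<le> \<bar>Re c\<bar>")
  case True
  then show ?thesis using e by (rule measure_strip_aux)
next
  case False
  have "1/2 \<le> \<bar>Im c\<bar>"
  proof (rule ccontr)
    assume "\<not> 1/2 \<le> \<bar>Im c\<bar>"
    then have "norm c < 1" using False cmod_le[of c] by linarith
    then show False using c by simp
  qed
  \<comment> \<open>A quarter turn preserves the square and makes \<open>Im c\<close>, up to sign,
    the real part; one of the two parts of a unit vector is at least 1/2.\<close>
  then have "measure lborel {w \<in> unit_square. \<bar>a + Re ((\<i> * c) * w)\<bar> \<le> e} \<le> 4 * e"
    using e by (intro measure_strip_aux) auto
  moreover have "(\<lambda>w. \<i> * w) -` {w \<in> unit_square. \<bar>a + Re (c * w)\<bar> \<le> e} = {w \<in> unit_square. \<bar>a + Re ((\<i> * c) * w)\<bar> \<le> e}"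
    unfolding vimage_def mem_Collect_eq unit_square_ii mult.assoc[symmetric] mult.commute[of \<i> c] ..
  ultimately show ?thesis
    using measure_vimage_isometry[OF rotation_lborel[of \<i>] _ strip_measurable[of a c e]] by simp
qed

lemma halfarea_bounds: "0 \<le> halfarea r c" "halfarea r c \<le> 1"
  unfolding halfarea_def by (auto intro: fmeasurable_unit_square_subset)

text \<open>Where exactly one of the half-planes contains \<open>w\<close>, the two linear forms lie
  on different sides of 0 although they differ by at most \<open>e\<close>. So the first one is at
  most \<open>e\<close> in absolute value, and such points form a thin strip.\<close>

lemma halfarea_lipschitz:
  assumes "norm c = 1"
  shows "\<bar>halfarea r c - halfarea r' c'\<bar> \<le> 4 * (\<bar>r - r'\<bar> + norm (c - c'))"
proof -
  define e where "e = \<bar>r - r'\<bar> + norm (c - c')"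
  have key: "\<bar>(r + Re (c * w)) - (r' + Re (c' * w))\<bar> \<le> e" if "w \<in> unit_square" for w
  proof -
    have "\<bar>Re ((c - c') * w)\<bar> \<le> norm (c - c') * norm w"
      by (metis abs_Re_le_cmod norm_mult)
    also have "\<dots> \<le> norm (c - c') * 1" using unit_square_norm[OF that] by (intro mult_left_mono) auto
    finally show ?thesis by (simp add: e_def algebra_simps)
  qed
  have "\<bar>halfarea r c - halfarea r' c'\<bar> \<le> measure lborel {w \<in> unit_square. \<bar>r + Re (c * w)\<bar> \<le> e}"
    unfolding halfarea_def
  proof (rule measure_diff_le)
    have "\<bar>r + Re (c * w)\<bar> \<le> e"
      if "w \<in> unit_square" "\<not> (r + Re (c * w) \<le> 0 \<longleftrightarrow> r' + Re (c' * w) \<le> 0)" for w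
      using key[OF that(1)] that(2) by linarith
    then show "{w \<in> unit_square. r + Re (c * w) \<le> 0} - {w \<in> unit_square. r' + Re (c' * w) \<le> 0}
        \<subseteq> {w \<in> unit_square. \<bar>r + Re (c * w)\<bar> \<le> e}"
      "{w \<in> unit_square. r' + Re (c' * w) \<le> 0} - {w \<in> unit_square. r + Re (c * w) \<le> 0}
        \<subseteq> {w \<in> unit_square. \<bar>r + Re (c * w)\<bar> \<le> e}"
      by blast+
  qed auto
  also have "\<dots> \<le> 4 * e" using assms by (intro measure_strip) (auto simp: e_def)
  finally show ?thesis by (simp add: e_def)
qed

text \<open>With \<open>z\<close> turned to the positive real axis and x + i y the turned
  \<open>w\<close>, membership of z + w in the disc reads (\<rho> + x)^2 + y^2 < R^2. Dropping y^2
  \<le> 1/2 replaces the circle by its tangent line and moves the boundary by at most 1/R.\<close>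

lemma area_R_approx:
  assumes z: "R \<le> norm z + 1" and R: "5 \<le> R"
  shows "\<bar>area_R R z - halfarea (norm z - R) (sgn z)\<bar> \<le> 4 / R"
proof -
  have z0: "z \<noteq> 0" using z R by auto
  define c where "c = cnj (sgn z)"
  define \<rho> where "\<rho> = norm z"
  have nc: "norm c = 1" using z0 by (simp add: c_def norm_sgn)
  have zc: "z = of_real \<rho> * cnj c" using z0 by (simp add: c_def \<rho>_def sgn_eq)
  have *: "(norm (z + w))\<^sup>2 = (\<rho> + Re (c * w))\<^sup>2 + ((norm w)\<^sup>2 - (Re (c * w))\<^sup>2)" for w
  proof -
    have "cnj c * (of_real \<rho> + c * w) = of_real \<rho> * cnj c + (c * cnj c) * w"
      by (simp add: algebra_simps)
    also have "c * cnj c = 1" using complex_norm_square[of c] nc by simp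
    finally have "z + w = cnj c * (of_real \<rho> + c * w)" by (simp add: zc)
    then have "(norm (z + w))\<^sup>2 = (norm (of_real \<rho> + c * w))\<^sup>2" using nc by (simp add: norm_mult)
    also have "\<dots> = (\<rho> + Re (c * w))\<^sup>2 + (Im (c * w))\<^sup>2" by (simp add: cmod_power2)
    also have "(Im (c * w))\<^sup>2 = (norm (c * w))\<^sup>2 - (Re (c * w))\<^sup>2" by (simp add: cmod_power2)
    also have "norm (c * w) = norm w" using nc by (simp add: norm_mult)
    finally show ?thesis .
  qed
  have re: "\<bar>Re (c * w)\<bar> \<le> norm w" for w using abs_Re_le_cmod[of "c * w"] nc by (simp add: norm_mult)
  have re2: "0 \<le> (norm w)\<^sup>2 - (Re (c * w))\<^sup>2" for w
    using power_mono[OF re, of w 2] by simp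
  let ?A = "{w \<in> unit_square. norm (z + w) < R}"
  let ?B = "{w \<in> unit_square. \<rho> - R + Re (c * w) \<le> 0}"
  let ?D = "{w \<in> unit_square. \<bar>\<rho> - R + Re (c * w)\<bar> \<le> 1 / R}"
  have Am: "?A \<in> sets borel"
  proof -
    have "open {w. norm (z + w) < R}" by (intro open_Collect_less continuous_intros)
    then have "unit_square \<inter> {w. norm (z + w) < R} \<in> sets borel"
      by (intro sets.Int unit_square_closed borel_open)
    then show ?thesis by (simp add: Int_def)
  qed
  have area: "area_R R z = measure lborel ?A"
  proof -
    have "(\<lambda>w. z + w) ` unit_square = (\<lambda>w. w - z) -` unit_square"
      by (auto simp: image_iff intro!: bexI[of _ "_ - z"])
    then have "(\<lambda>w. z + w) ` unit_square \<in> sets borel"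
      using measurable_sets[of "\<lambda>w. w - z" borel borel unit_square] by simp
    then have m: "(\<lambda>w. z + w) ` unit_square \<inter> ball 0 R \<in> sets borel" by simp
    have "(\<lambda>w. z + w) -` ((\<lambda>w. z + w) ` unit_square \<inter> ball 0 R) = ?A" by auto
    then show ?thesis unfolding area_R_def
      using measure_vimage_isometry[OF lborel_distr_plus[of z] _ m] by simp
  qed
  have "\<bar>measure lborel ?A - measure lborel ?B\<bar> \<le> measure lborel ?D"
  proof (rule measure_diff_le)
    show "?A - ?B \<subseteq> ?D"
    proof
      fix w assume w: "w \<in> ?A - ?B"
      then have lt: "R < \<rho> + Re (c * w)" "norm (z + w) < R" by auto
      have "R\<^sup>2 \<le> (\<rho> + Re (c * w))\<^sup>2" using lt R by (intro power_mono) auto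
      also have "\<dots> \<le> (norm (z + w))\<^sup>2" unfolding * using re2[of w] by simp
      also have "\<dots> < R\<^sup>2" using lt R by (intro power_strict_mono) auto
      finally show "w \<in> ?D" by simp
    qed
    show "?B - ?A \<subseteq> ?D"
    proof
      fix w assume w: "w \<in> ?B - ?A"
      then have wS: "w \<in> unit_square" and le: "\<rho> + Re (c * w) \<le> R" "R \<le> norm (z + w)" by auto
      have "R\<^sup>2 \<le> (norm (z + w))\<^sup>2" using le R by (intro power_mono) auto
      also have "\<dots> \<le> (\<rho> + Re (c * w))\<^sup>2 + 1/2"
        unfolding * using unit_square_norm_sq[OF wS] zero_le_power2[of "Re (c * w)"] by linarith
      finally have "(R - (\<rho> + Re (c * w))) * (R + (\<rho> + Re (c * w))) \<le> 1/2"
        by (simp add: power2_eq_square algebra_simps)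
      moreover have "0 \<le> \<rho> + Re (c * w)"
        using re[of w] unit_square_norm[OF wS] z R by (simp add: \<rho>_def)
      then have "(R - (\<rho> + Re (c * w))) * R \<le> (R - (\<rho> + Re (c * w))) * (R + (\<rho> + Re (c * w)))"
        using le by (intro mult_left_mono) auto
      ultimately have "(R - (\<rho> + Re (c * w))) * R \<le> 1" by linarith
      then have "R - (\<rho> + Re (c * w)) \<le> 1 / R" using R by (simp add: field_simps)
      moreover have "0 \<le> 1 / R" using R by simp
      ultimately have "\<bar>\<rho> - R + Re (c * w)\<bar> \<le> 1 / R" using le by linarith
      then show "w \<in> ?D" using wS by simp
    qed
  qed (use Am in auto)
  also have "\<dots> \<le> 4 * (1 / R)" using nc R by (intro measure_strip) auto
  finally have "\<bar>area_R R z - halfarea (norm z - R) c\<bar> \<le> 4 / R"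
    unfolding area halfarea_def \<rho>_def by simp
  then show ?thesis by (simp add: c_def halfarea_cnj)
qed

section \<open>Lattice points in strips of good slope\<close>

lemma card_int_interval_upper:
  fixes u v :: real and X :: "int set"
  assumes "\<And>j. j \<in> X \<Longrightarrow> u \<le> of_int j \<and> of_int j \<le> v" and "0 \<le> v - u + 1"
  shows "finite X" "real (card X) \<le> v - u + 1"
proof -
  have sub: "X \<subseteq> {\<lceil>u\<rceil>..\<lfloor>v\<rfloor>}"
    using assms(1) by (auto simp: ceiling_le_iff le_floor_iff)
  then show "finite X" by (rule finite_subset) simp
  have "card X \<le> nat (\<lfloor>v\<rfloor> - \<lceil>u\<rceil> + 1)"
    using card_mono[OF _ sub] by simp
  moreover have "real_of_int (\<lfloor>v\<rfloor> - \<lceil>u\<rceil> + 1) \<le> v - u + 1" by simp linarith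
  then have "real (nat (\<lfloor>v\<rfloor> - \<lceil>u\<rceil> + 1)) \<le> v - u + 1"
    using assms(2) by (cases "\<lfloor>v\<rfloor> - \<lceil>u\<rceil> + 1 \<ge> 0") (auto simp: of_nat_nat)
  ultimately show "real (card X) \<le> v - u + 1" by linarith
qed

lemma card_int_interval_lower:
  fixes u v :: real and X :: "int set"
  assumes "\<And>j. u < of_int j \<Longrightarrow> of_int j < v \<Longrightarrow> j \<in> X" and "finite X"
  shows "v - u - 1 \<le> real (card X)"
proof -
  have sub: "{\<lfloor>u\<rfloor> + 1..\<lceil>v\<rceil> - 1} \<subseteq> X"
    using assms(1) by (auto simp: less_ceiling_iff floor_less_iff) (smt (verit) floor_less_iff less_ceiling_iff)
  have "nat (\<lceil>v\<rceil> - 1 - \<lfloor>u\<rfloor>) \<le> card X"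
    using card_mono[OF assms(2) sub] by simp
  then have "real_of_int (\<lceil>v\<rceil> - 1 - \<lfloor>u\<rfloor>) \<le> real (card X)" by linarith
  moreover have "v - u - 1 \<le> real_of_int (\<lceil>v\<rceil> - 1 - \<lfloor>u\<rfloor>)" by simp linarith
  ultimately show ?thesis by linarith
qed

text \<open>The map \<open>(i, n) \<mapsto> q * n - a * i\<close> identifies \<open>{0..<q} \<times> \<int>\<close> with \<open>\<int>\<close>, and it sends the
  strip to an interval of length \<open>q * h\<close> up to an error of at most 2 at either end.\<close>

lemma card_strip_coprime:
  fixes a q :: int and \<alpha> \<beta> h Q :: real and X :: "(int \<times> int) set"
  assumes cop: "coprime a q" and q: "0 < q" "of_int q \<le> Q"
    and approx: "\<bar>of_int q * \<alpha> - of_int a\<bar> \<le> 1 / Q"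
    and h: "0 \<le> h"
    and X: "X \<subseteq> {0..<q} \<times> UNIV"
    and lower: "\<And>i n. i \<in> {0..<q} \<Longrightarrow> \<beta> + \<alpha> * of_int i + 1 / Q < of_int n \<Longrightarrow>
      of_int n < \<beta> + \<alpha> * of_int i + h - 1 / Q \<Longrightarrow> (i, n) \<in> X"
    and upper: "\<And>i n. (i, n) \<in> X \<Longrightarrow>
      \<beta> + \<alpha> * of_int i - 1 / Q \<le> of_int n \<and> of_int n \<le> \<beta> + \<alpha> * of_int i + h + 1 / Q"
  shows "finite X \<and> \<bar>real (card X) - of_int q * h\<bar> \<le> 5"
proof -
  define \<phi> where "\<phi> = (\<lambda>(i, n). q * n - a * i)"
  have Q: "Q > 0" using q by linarith
  have qQ: "of_int q * (1 / Q) \<le> 1" using q Q by (simp add: field_simps)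
  \<comment> \<open>Along q columns the lines of slope \<alpha> and a / q separate by at most 1 / Q.
    On the scale of \<open>\<phi>\<close>, which multiplies heights by q, this is at most 1.\<close>
  have drift: "\<bar>(of_int q * \<alpha> - of_int a) * of_int i\<bar> \<le> 1" if "i \<in> {0..<q}" for i
  proof -
    have "\<bar>(of_int q * \<alpha> - of_int a) * of_int i\<bar> \<le> (1 / Q) * of_int q"
      unfolding abs_mult using that approx Q by (intro mult_mono) auto
    then show ?thesis using qQ by (simp add: mult.commute)
  qed
  have inj: "inj_on \<phi> X"
  proof (rule inj_onI, clarify)
    fix i n i' n' assume *: "(i, n) \<in> X" "(i', n') \<in> X" "\<phi> (i, n) = \<phi> (i', n')"
    then have eq: "q * (n - n') = a * (i - i')" by (simp add: \<phi>_def algebra_simps)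
    then have "q dvd a * (i - i')" by (metis dvd_triv_left)
    then have "q dvd i - i'" using cop by (simp add: coprime_commute coprime_dvd_mult_right_iff)
    moreover have "\<bar>i - i'\<bar> < q" using subsetD[OF X *(1)] subsetD[OF X *(2)] by auto
    ultimately have "i = i'" by (metis dvd_imp_le_int eq_iff_diff_eq_0 not_less abs_of_pos q(1))
    then show "i = i' \<and> n = n'" using eq q by auto
  qed
  have img: "of_int q * \<beta> - 2 \<le> of_int j \<and> of_int j \<le> of_int q * \<beta> + of_int q * h + 2" if "j \<in> \<phi> ` X" for j
  proof -
    obtain i n where j: "j = q * n - a * i" "(i, n) \<in> X" using \<open>j \<in> \<phi> ` X\<close> by (auto simp: \<phi>_def)
    have i: "i \<in> {0..<q}" using j X by auto
    note u = upper[OF j(2)]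
    have "of_int q * (\<beta> + \<alpha> * of_int i - 1 / Q) \<le> of_int q * of_int n"
         "of_int q * of_int n \<le> of_int q * (\<beta> + \<alpha> * of_int i + h + 1 / Q)"
      using u q by (auto intro!: mult_left_mono)
    then show ?thesis using drift[OF i] qQ unfolding j by (simp add: algebra_simps abs_le_iff)
  qed
  \<comment> \<open>The drift and the slack 1 / Q each cost at most 1 at either end, so the interval
    has length q h + 4 and contains at most q h + 5 integers.\<close>
  have fin: "finite (\<phi> ` X)" and up: "real (card (\<phi> ` X)) \<le> of_int q * h + 5"
    using card_int_interval_upper[of "\<phi> ` X", OF img] h q by (auto simp: algebra_simps)
  have mem: "j \<in> \<phi> ` X" if j: "of_int q * \<beta> + 2 < of_int j" "of_int j < of_int q * \<beta> + of_int q * h - 2" for j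
  proof -
    obtain u v where uv: "u * a + v * q = 1"
      using bezout_int[of a q] cop by (auto simp: coprime_iff_gcd_eq_1)
    \<comment> \<open>Since u inverts a modulo q, this is the only column for which q divides j + a
      i, that is, the column of the preimage of j.\<close>
    define i where "i = (- j * u) mod q"
    have i: "i \<in> {0..<q}" using q by (simp add: i_def)
    have "i = - j * u - q * ((- j * u) div q)"
      unfolding i_def by (simp add: minus_mult_div_eq_mod)
    then have "j + a * i = j * (u * a + v * q) + a * (- j * u - q * ((- j * u) div q))"
      using uv by simp
    also have "\<dots> = q * (j * v - a * ((- j * u) div q))" by (simp add: algebra_simps)
    finally have "q dvd j + a * i" by simp
    then obtain n where n: "j + a * i = q * n" by blast
    have jeq: "j = \<phi> (i, n)" using n by (simp add: \<phi>_def)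
    have neq: "of_int q * real_of_int n = of_int j + of_int a * of_int i"
      using n by (metis of_int_add of_int_mult)
    have "of_int q * (\<beta> + \<alpha> * of_int i + 1 / Q) < of_int q * of_int n"
         "of_int q * of_int n < of_int q * (\<beta> + \<alpha> * of_int i + h - 1 / Q)"
      unfolding neq using j drift[OF i] qQ by (simp_all add: algebra_simps abs_le_iff)
    then have "(i, n) \<in> X" using q by (intro lower[OF i]) auto
    then show ?thesis using jeq by blast
  qed
  have "of_int q * h - 5 \<le> real (card (\<phi> ` X))"
    using card_int_interval_lower[of "of_int q * \<beta> + 2"
        "of_int q * \<beta> + of_int q * h - 2" "\<phi> ` X", OF mem fin] by (simp add: algebra_simps)
  then show ?thesis using up fin inj by (simp add: card_image finite_image_iff)
qed

lemma div_less_if: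
  fixes x q V :: int
  assumes "0 < q" "x < q * V"
  shows "x div q < V"
proof (rule ccontr)
  assume "\<not> x div q < V"
  then have "q * V \<le> q * (x div q)" using assms by simp
  also have "\<dots> \<le> x" using assms(1) by (metis div_mult_mod_eq mult.commute pos_mod_sign le_add_same_cancel1)
  finally show False using assms by simp
qed

text \<open>The H columns split into H / q groups of q consecutive ones, each counted with error 5;
  the intercept moves from group to group.\<close>

lemma card_strip_multiple:
  fixes a q H :: int and \<alpha> \<beta> h Q :: real and X :: "(int \<times> int) set"
  assumes cop: "coprime a q" and q: "0 < q" "of_int q \<le> Q"
    and approx: "\<bar>of_int q * \<alpha> - of_int a\<bar> \<le> 1 / Q"
    and h: "0 \<le> h" and H: "q dvd H" "0 \<le> H"
    and X: "X \<subseteq> {0..<H} \<times> UNIV"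
    and lower: "\<And>i n. i \<in> {0..<H} \<Longrightarrow> \<beta> + \<alpha> * of_int i + 1 / Q < of_int n \<Longrightarrow>
      of_int n < \<beta> + \<alpha> * of_int i + h - 1 / Q \<Longrightarrow> (i, n) \<in> X"
    and upper: "\<And>i n. (i, n) \<in> X \<Longrightarrow>
      \<beta> + \<alpha> * of_int i - 1 / Q \<le> of_int n \<and> of_int n \<le> \<beta> + \<alpha> * of_int i + h + 1 / Q"
  shows "finite X \<and> \<bar>real (card X) - of_int H * h\<bar> \<le> 5 * of_int H / of_int q"
proof -
  obtain V where V: "H = q * V" using H by blast
  have V0: "0 \<le> V" using V H(2) q(1) by (simp add: zero_le_mult_iff)
  define Y where "Y v = {x \<in> {0..<q} \<times> UNIV. (fst x + q * v, snd x) \<in> X}" for v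
  define S where "S v = (\<lambda>x. (fst x + q * v, snd x)) ` Y v" for v
  have Y: "finite (Y v) \<and> \<bar>real (card (Y v)) - of_int q * h\<bar> \<le> 5" if v: "v \<in> {0..<V}" for v
  proof (rule card_strip_coprime[OF cop q approx h, where \<beta> = "\<beta> + \<alpha> * of_int (q * v)"])
    fix i n :: int assume i: "i \<in> {0..<q}"
    have "i + q * v < q * (v + 1)" using i by (simp add: algebra_simps)
    also have "\<dots> \<le> q * V" using v q by (intro mult_left_mono) auto
    finally have iH: "i + q * v \<in> {0..<H}" using V i v q by simp
    assume "\<beta> + \<alpha> * of_int (q * v) + \<alpha> * of_int i + 1 / Q < of_int n"
      "of_int n < \<beta> + \<alpha> * of_int (q * v) + \<alpha> * of_int i + h - 1 / Q"
    then have "(i + q * v, n) \<in> X" by (intro lower[OF iH]) (auto simp: algebra_simps)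
    then show "(i, n) \<in> Y v" using i by (simp add: Y_def)
  next
    fix i n :: int assume "(i, n) \<in> Y v"
    then have "(i + q * v, n) \<in> X" by (simp add: Y_def)
    from upper[OF this] show "\<beta> + \<alpha> * of_int (q * v) + \<alpha> * of_int i - 1 / Q \<le> of_int n \<and>
        of_int n \<le> \<beta> + \<alpha> * of_int (q * v) + \<alpha> * of_int i + h + 1 / Q"
      by (simp add: algebra_simps)
  qed (auto simp: Y_def)
  have S: "finite (S v)" "card (S v) = card (Y v)" if "v \<in> {0..<V}" for v
    using Y[OF that] unfolding S_def by (auto intro!: card_image inj_onI simp: prod_eq_iff)
  have fstS: "fst x div q = v" if "x \<in> S v" for x v
    using that q by (auto simp: S_def Y_def)
  have X_eq: "X = (\<Union>v\<in>{0..<V}. S v)"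
  proof
    show "X \<subseteq> (\<Union>v\<in>{0..<V}. S v)"
    proof
      fix x assume x: "x \<in> X"
      then have "fst x \<in> {0..<q * V}" using X V by auto
      then have "fst x div q \<in> {0..<V}"
        using q by (auto simp: pos_imp_zdiv_nonneg_iff intro: div_less_if)
      moreover have "x \<in> S (fst x div q)"
      proof -
        have "(fst x mod q, snd x) \<in> Y (fst x div q)"
          using x q by (auto simp: Y_def)
        then show ?thesis unfolding S_def
          by (intro image_eqI[where x = "(fst x mod q, snd x)"]) (auto simp: prod_eq_iff)
      qed
      ultimately show "x \<in> (\<Union>v\<in>{0..<V}. S v)" by blast
    qed
  qed (auto simp: S_def Y_def)
  have fin: "finite X" unfolding X_eq using S by auto
  have "card X = (\<Sum>v\<in>{0..<V}. card (Y v))"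
    unfolding X_eq using S fstS by (subst card_UN_disjoint) (auto, metis)
  then have "real (card X) - of_int H * h = (\<Sum>v\<in>{0..<V}. real (card (Y v)) - of_int q * h)"
    using V V0 by (simp add: sum_subtractf algebra_simps)
  also have "\<bar>\<dots>\<bar> \<le> (\<Sum>v\<in>{0..<V}. 5)"
    using Y by (intro order.trans[OF sum_abs] sum_mono) auto
  also have "\<dots> = 5 * of_int H / of_int q" using V V0 q by (simp add: field_simps)
  finally show ?thesis using fin by blast
qed

text \<open>Such a slope keeps its distance from all rationals of denominator at most
  \<open>q0\<close>, so Dirichlet's theorem with bound \<open>Q\<close> can only return a larger
  denominator.\<close>

definition good_slope :: "nat \<Rightarrow> nat \<Rightarrow> real \<Rightarrow> bool" where
  "good_slope q0 Q \<alpha> \<longleftrightarrow> (\<forall>q a :: int. 0 < q \<longrightarrow> q \<le> int q0 \<longrightarrow> 1 / real Q \<le> \<bar>of_int q * \<alpha> - of_int a\<bar>)"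

text \<open>\<open>fact Q\<close> is a multiple of every denominator that Dirichlet's theorem may
  return, so the number of columns does not depend on the slope. Each group of q > q0 columns has
  error 5, which is less than 5 / q0 per column.\<close>

lemma card_strip_good_slope:
  fixes \<alpha> \<beta> h :: real and X :: "(int \<times> int) set" and q0 Q :: nat
  assumes good: "good_slope q0 Q \<alpha>" and q0: "0 < q0" and Q: "0 < Q"
    and h: "0 \<le> h"
    and X: "X \<subseteq> {0..<fact Q} \<times> UNIV"
    and lower: "\<And>i n. i \<in> {0..<fact Q} \<Longrightarrow> \<beta> + \<alpha> * of_int i + 1 / Q < of_int n \<Longrightarrow>
      of_int n < \<beta> + \<alpha> * of_int i + h - 1 / Q \<Longrightarrow> (i, n) \<in> X"
    and upper: "\<And>i n. (i, n) \<in> X \<Longrightarrow>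
      \<beta> + \<alpha> * of_int i - 1 / Q \<le> of_int n \<and> of_int n \<le> \<beta> + \<alpha> * of_int i + h + 1 / Q"
  shows "finite X \<and> \<bar>real (card X) - fact Q * h\<bar> \<le> 5 * fact Q / q0"
proof -
  obtain a q where aq: "coprime a q" "0 < q" "q \<le> int Q" "\<bar>of_int q * \<alpha> - of_int a\<bar> < 1 / real Q"
    using Dirichlet_approx_coprime[OF Q] .
  \<comment> \<open>A denominator up to \<open>q0\<close> with so good an approximation would
    contradict \<open>good_slope\<close>.\<close>
  have "int q0 < q" using good aq unfolding good_slope_def by (metis linorder_not_less)
  have "nat q dvd fact Q" using aq by (intro dvd_fact) auto
  then have dvd: "q dvd fact Q" using aq
    by (metis int_dvd_int_iff int_nat_eq of_nat_fact order_less_imp_le)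
  have "finite X \<and> \<bar>real (card X) - of_int (fact Q) * h\<bar> \<le> 5 * of_int (fact Q) / of_int q"
    using aq dvd h X lower upper
    by (intro card_strip_multiple[where \<beta> = \<beta> and a = a and \<alpha> = \<alpha> and Q = "real Q"]) auto
  moreover have "5 * fact Q / of_int q \<le> 5 * fact Q / real q0"
    using \<open>int q0 < q\<close> q0 by (intro divide_left_mono mult_pos_pos) auto
  ultimately show ?thesis by auto
qed

section \<open>Column blocks in the annulus\<close>

lemma card_int_diam:
  fixes X :: "int set" and d :: real
  assumes "\<And>x y. x \<in> X \<Longrightarrow> y \<in> X \<Longrightarrow> real_of_int (x - y) \<le> d" and "0 \<le> d"
  shows "finite X" "real (card X) \<le> d + 1"
proof -
  show fin: "finite X"
  proof (cases "X = {}")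
    case False
    then obtain x0 where x0: "x0 \<in> X" by blast
    show ?thesis
    proof (rule card_int_interval_upper(1))
      show "of_int x0 - d \<le> of_int j \<and> of_int j \<le> of_int x0 + d" if "j \<in> X" for j
        using assms(1)[OF x0 that] assms(1)[OF that x0] by auto
    qed (use assms in auto)
  qed auto
  show "real (card X) \<le> d + 1"
  proof (cases "X = {}")
    case False
    have "real (card X) \<le> (of_int (Min X) + d) - of_int (Min X) + 1"
    proof (rule card_int_interval_upper(2))
      show "real_of_int (Min X) \<le> of_int j \<and> of_int j \<le> of_int (Min X) + d" if "j \<in> X" for j
        using assms(1)[OF that Min_in[OF fin False]] Min_le[OF fin that] by auto
    qed (use assms in auto)
    then show ?thesis by simp
  qed (use assms in auto)
qed

lemma sqrt2_bounds: "7/5 < sqrt 2" "sqrt 2 < 3/2" "2/3 < 1 / sqrt 2" "1 / sqrt 2 < 5/7"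
proof -
  show 1: "7/5 < sqrt 2" by (rule real_less_rsqrt) (simp add: power2_eq_square)
  show 2: "sqrt 2 < 3/2" by (rule real_less_lsqrt) (simp_all add: power2_eq_square)
  show "2/3 < 1 / sqrt 2" "1 / sqrt 2 < 5/7" using 1 2 by (simp_all add: field_simps)
qed

text \<open>With c = (t R - m i) / Y the linear terms of (R + t)^2 - (m + i)^2 and of (Y + c)^2
  agree, so these two numbers differ by a quantity bounded in terms of H alone. Dividing by the sum
  of their square roots, which is at least R / 4, gives an error O(1/R): over H columns the annulus
  looks like a straight strip of slope - m / Y.\<close>

lemma circle_height_approx:
  fixes R m t i H :: real
  assumes m: "\<bar>m\<bar> \<le> R / sqrt 2" and t: "\<bar>t\<bar> \<le> 1" and i: "0 \<le> i" "i \<le> H" and R: "20 * (1 + H) \<le> R"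
  defines "Y \<equiv> sqrt (R\<^sup>2 - m\<^sup>2)"
  shows "R / 2 \<le> Y" "Y \<le> R" "(m + i)\<^sup>2 \<le> (R + t)\<^sup>2"
    "\<bar>sqrt ((R + t)\<^sup>2 - (m + i)\<^sup>2) - (Y + (t * R - m * i) / Y)\<bar> \<le> 20 * (1 + H)\<^sup>2 / R"
proof -
  have H: "0 \<le> H" using i by linarith
  then have R0: "R > 0" using R by (simp add: distrib_left)
  have m2: "m\<^sup>2 \<le> R\<^sup>2 / 2"
    using power_mono[OF m, of 2] by (simp add: power_divide)
  show Y1: "R / 2 \<le> Y" unfolding Y_def
  proof (rule real_le_rsqrt)
    have "(R / 2)\<^sup>2 = R\<^sup>2 / 4" by (simp add: power_divide)
    then show "(R / 2)\<^sup>2 \<le> R\<^sup>2 - m\<^sup>2" using m2 zero_le_power2[of R] by linarith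
  qed
  show Y2: "Y \<le> R" unfolding Y_def by (rule real_le_lsqrt) (use R0 m2 in auto)
  have Y0: "Y > 0" using Y1 R0 by simp
  have YY: "Y\<^sup>2 = R\<^sup>2 - m\<^sup>2" unfolding Y_def using m2 zero_le_power2[of R]
    by (subst real_sqrt_pow2) linarith+
  define c where "c = (t * R - m * i) / Y"
  have "R / sqrt 2 \<le> R" using R0 by (simp add: divide_le_eq)
  then have mR: "\<bar>m\<bar> \<le> R" using m by linarith
  have "\<bar>t * R - m * i\<bar> \<le> \<bar>t\<bar> * R + \<bar>m\<bar> * i"
    using abs_triangle_ineq4[of "t * R" "m * i"] R0 i by (simp add: abs_mult)
  also have "\<dots> \<le> 1 * R + R * H"
    using t mR i R0 by (intro add_mono mult_mono) auto
  finally have num: "\<bar>t * R - m * i\<bar> \<le> R * (1 + H)" by (simp add: algebra_simps)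
  have "\<bar>c\<bar> \<le> (R * (1 + H)) / (R / 2)"
    unfolding c_def abs_divide using num Y1 Y0 R0 H by (intro frac_le) auto
  then have c: "\<bar>c\<bar> \<le> 2 * (1 + H)" using R0 by simp
  have B: "R / 4 \<le> Y + c" using c Y1 R H by linarith
  define A where "A = (R + t)\<^sup>2 - (m + i)\<^sup>2"
  have cY: "c * Y = t * R - m * i" using Y0 by (simp add: c_def)
  have "(Y + c)\<^sup>2 = Y\<^sup>2 + 2 * (c * Y) + c\<^sup>2" by (simp add: power2_eq_square algebra_simps)
  then have diff: "A - (Y + c)\<^sup>2 = t\<^sup>2 - i\<^sup>2 - c\<^sup>2"
    unfolding A_def cY YY by (simp add: power2_eq_square algebra_simps)
  have t2: "t\<^sup>2 \<le> 1" using t by (simp add: abs_square_le_1)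
  have i2: "i\<^sup>2 \<le> H\<^sup>2" using i by (intro power_mono) auto
  have c2: "c\<^sup>2 \<le> 4 * (1 + H)\<^sup>2" using power_mono[OF c, of 2] by (simp add: power_mult_distrib del: distrib_left_numeral)
  have "\<bar>t\<^sup>2 - i\<^sup>2 - c\<^sup>2\<bar> \<le> 1 + H\<^sup>2 + 4 * (1 + H)\<^sup>2"
    using t2 i2 c2 zero_le_power2[of t] zero_le_power2[of i] zero_le_power2[of c] by linarith
  also have "\<dots> \<le> 5 * (1 + H)\<^sup>2" using H by (simp add: power2_eq_square algebra_simps)
  finally have d5: "\<bar>A - (Y + c)\<^sup>2\<bar> \<le> 5 * (1 + H)\<^sup>2" using diff by simp
  have "5 * (1 + H)\<^sup>2 \<le> (R / 4)\<^sup>2"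
  proof -
    have "(20 * (1 + H))\<^sup>2 \<le> R\<^sup>2" using power_mono[OF R, of 2] H by simp
    then have "400 * (1 + H)\<^sup>2 \<le> R\<^sup>2" by (simp only: power_mult_distrib) simp
    then have "80 * (1 + H)\<^sup>2 \<le> R\<^sup>2" using zero_le_power2[of "1 + H"] by linarith
    then show ?thesis by (simp add: power_divide)
  qed
  also have "(R / 4)\<^sup>2 \<le> (Y + c)\<^sup>2" using B R0 by (intro power_mono) auto
  finally have A0: "0 \<le> A" using d5 by linarith
  then show "(m + i)\<^sup>2 \<le> (R + t)\<^sup>2" by (simp add: A_def)
  have "\<bar>sqrt A - (Y + c)\<bar> * (R / 4) \<le> \<bar>sqrt A - (Y + c)\<bar> * (sqrt A + (Y + c))"
    using B A0 by (intro mult_left_mono) (auto simp: add_increasing)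
  also have "\<dots> = \<bar>(sqrt A - (Y + c)) * (sqrt A + (Y + c))\<bar>"
    using B A0 R0 by (subst abs_mult) simp
  also have "(sqrt A - (Y + c)) * (sqrt A + (Y + c)) = A - (Y + c)\<^sup>2"
    using A0 by (simp add: power2_eq_square algebra_simps)
  also note d5
  finally show "\<bar>sqrt ((R + t)\<^sup>2 - (m + i)\<^sup>2) - (Y + (t * R - m * i) / Y)\<bar> \<le> 20 * (1 + H)\<^sup>2 / R"
    using R0 unfolding A_def c_def by (simp add: field_simps)
qed

definition col_block :: "real \<Rightarrow> int \<Rightarrow> int \<Rightarrow> complex set" where
  "col_block R H s =
     {z \<in> Gam R. 0 < Im z \<and> of_int (H * s) \<le> Re z \<and> Re z < of_int (H * s + H)}"

definition height :: "real \<Rightarrow> real \<Rightarrow> real" where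
  "height R x = sqrt (R\<^sup>2 - x\<^sup>2)"

text \<open>Excluding s = 0 keeps a block on one side of the imaginary axis, so that no turned copy
  of it crosses the cut of \<open>Arg2pi\<close>. The margin of two block lengths keeps the block
  inside \<open>upper R\<close>. The slope tested is, up to sign, that of the circle of radius R at
  the left edge of the block.\<close>

definition good_cols :: "real \<Rightarrow> nat \<Rightarrow> nat \<Rightarrow> int set" where
  "good_cols R q0 Q = {s. s \<noteq> 0 \<and> \<bar>real_of_int (fact Q * s)\<bar> \<le> R / sqrt 2 - 2 * fact Q \<and>
     good_slope q0 Q (of_int (fact Q * s) / height R (of_int (fact Q * s)))}"

lemma good_slope_uminus: "good_slope q0 Q \<alpha> \<Longrightarrow> good_slope q0 Q (- \<alpha>)"
  unfolding good_slope_def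
proof (intro allI impI)
  fix q a :: int
  assume *: "\<forall>q a. 0 < q \<longrightarrow> q \<le> int q0 \<longrightarrow> 1 / real Q \<le> \<bar>real_of_int q * \<alpha> - real_of_int a\<bar>" "0 < q" "q \<le> int q0"
  then have "1 / real Q \<le> \<bar>real_of_int q * \<alpha> - real_of_int (- a)\<bar>" by blast
  then show "1 / real Q \<le> \<bar>real_of_int q * - \<alpha> - real_of_int a\<bar>" by (simp add: abs_minus_commute add.commute)
qed

text \<open>By the expansion of the height, the region between the two circles is nearly a strip of
  vertical thickness (t2 - t1) R / \<open>height\<close>, to which the count for good slopes
  applies.\<close>

lemma card_col_block_slice:
  fixes R t1 t2 :: real and q0 Q :: nat
  assumes q0: "0 < q0" and Q: "0 < Q"
    and s: "s \<in> good_cols R q0 Q"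
    and t: "-1 / sqrt 2 \<le> t1" "t1 \<le> t2" "t2 \<le> 1 / sqrt 2"
    and R: "20 * (1 + fact Q)\<^sup>2 * real Q \<le> R"
  shows "\<bar>real (card {z \<in> col_block R (fact Q) s. t1 < norm z - R \<and> norm z - R \<le> t2})
      - fact Q * ((t2 - t1) * R / height R (of_int (fact Q * s)))\<bar> \<le> 5 * fact Q / q0"
proof -
  define H :: int where "H = fact Q"
  define m where "m = H * s"
  define Y where "Y = height R (of_int m)"
  define Z where "Z = {z \<in> col_block R H s. t1 < norm z - R \<and> norm z - R \<le> t2}"
  define X where "X = {(i, n). i \<in> {0..<H} \<and> Complex (of_int (m + i)) (of_int n) \<in> Z}"
  have Hf: "real_of_int H = fact Q" by (simp add: H_def)
  have H1: "1 \<le> real_of_int H" unfolding Hf by (rule fact_ge_1)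
  have sq: "1 + real_of_int H \<le> (1 + real_of_int H)\<^sup>2" using H1 by (simp add: power2_eq_square algebra_simps)
  have "(1 + real_of_int H)\<^sup>2 * 1 \<le> (1 + real_of_int H)\<^sup>2 * Q"
    using Q by (intro mult_left_mono) auto
  then have "1 + real_of_int H \<le> (1 + real_of_int H)\<^sup>2 * Q" using sq by linarith
  then have R': "20 * (1 + real_of_int H) \<le> R" using R unfolding Hf by simp
  have R0: "R > 0" using R' H1 by (simp add: distrib_left)
  have mle: "\<bar>real_of_int m\<bar> \<le> R / sqrt 2"
  proof -
    have "\<bar>real_of_int m\<bar> \<le> R / sqrt 2 - 2 * real_of_int H"
      using s by (simp add: good_cols_def m_def H_def)
    then show ?thesis using H1 by linarith
  qed
  have t': "\<bar>t1\<bar> \<le> 1" "\<bar>t2\<bar> \<le> 1" using t sqrt2_bounds by auto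
  \<comment> \<open>The lower bound on R is chosen for this: the curvature error fits into the slack
    1 / Q allowed by \<open>card_strip_good_slope\<close>.\<close>
  have E: "20 * (1 + real_of_int H)\<^sup>2 / R \<le> 1 / Q"
    using R R0 Q unfolding Hf by (simp add: field_simps)
  define c where "c t i = sqrt ((R + t)\<^sup>2 - (of_int (m + i))\<^sup>2)" for t and i :: int
  have approx: "\<bar>c \<tau> i - (Y + (\<tau> * R - of_int m * of_int i) / Y)\<bar> \<le> 1 / Q"
    and nonneg: "(of_int (m + i))\<^sup>2 \<le> (R + \<tau>)\<^sup>2"
    if "\<bar>\<tau>\<bar> \<le> 1" "i \<in> {0..<H}" for \<tau> i
    using circle_height_approx[OF mle that(1) _ _ R', of "of_int i"] that(2) E
    unfolding c_def Y_def height_def by auto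
  have Ylow: "R / 2 \<le> Y" using circle_height_approx(1)[OF mle t'(1) order.refl _ R'] H1
    unfolding Y_def height_def by simp
  have Y0: "Y > 0" using Ylow R0 by simp
  define h where "h = (t2 - t1) * R / Y"
  \<comment> \<open>Linearised, the inner circle is the line with intercept \<beta> and slope
    \<alpha>, and the outer circle lies h above it.\<close>
  define \<alpha> where "\<alpha> = - (of_int m / Y)"
  define \<beta> where "\<beta> = Y + t1 * R / Y"
  have lin1: "Y + (t1 * R - of_int m * of_int i) / Y = \<beta> + \<alpha> * of_int i" for i
    by (simp add: \<alpha>_def \<beta>_def diff_divide_distrib)
  have lin2: "Y + (t2 * R - of_int m * of_int i) / Y = \<beta> + \<alpha> * of_int i + h" for i
    by (simp add: \<alpha>_def \<beta>_def h_def diff_divide_distrib left_diff_distrib)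
  have c_less: "c \<tau> i < of_int n \<longleftrightarrow> R + \<tau> < norm (Complex (of_int (m + i)) (of_int n))"
    and less_c: "of_int n < c \<tau> i \<longleftrightarrow> norm (Complex (of_int (m + i)) (of_int n)) < R + \<tau>"
    if "\<bar>\<tau>\<bar> \<le> 1" "i \<in> {0..<H}" "0 < n" for \<tau> i n
  proof -
    have 1: "c \<tau> i < of_int n \<longleftrightarrow> (R + \<tau>)\<^sup>2 - (of_int (m + i))\<^sup>2 < (of_int n)\<^sup>2"
      unfolding c_def using that(3) by (subst real_sqrt_less_iff[symmetric]) simp
    have 2: "of_int n < c \<tau> i \<longleftrightarrow> (of_int n)\<^sup>2 < (R + \<tau>)\<^sup>2 - (of_int (m + i))\<^sup>2"
      unfolding c_def using that(3) by (subst (2) real_sqrt_less_iff[symmetric]) simp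
    have Rt: "0 \<le> R + \<tau>" using R' H1 that(1) by (simp add: distrib_left)
    have 3: "R + \<tau> < sqrt x \<longleftrightarrow> (R + \<tau>)\<^sup>2 < x" "sqrt x < R + \<tau> \<longleftrightarrow> x < (R + \<tau>)\<^sup>2" if "x \<ge> 0" for x
      using Rt that by (metis real_sqrt_abs abs_of_nonneg real_sqrt_less_iff)+
    show "c \<tau> i < of_int n \<longleftrightarrow> R + \<tau> < norm (Complex (of_int (m + i)) (of_int n))"
      "of_int n < c \<tau> i \<longleftrightarrow> norm (Complex (of_int (m + i)) (of_int n)) < R + \<tau>"
      unfolding 1 2 complex_norm by (subst 3; force)+
  qed
  have "finite X \<and> \<bar>real (card X) - fact Q * h\<bar> \<le> 5 * fact Q / q0"
  proof (rule card_strip_good_slope[OF _ q0 Q])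
    show "good_slope q0 Q \<alpha>" unfolding \<alpha>_def Y_def m_def H_def
      by (rule good_slope_uminus) (use s in \<open>simp add: good_cols_def\<close>)
    show "0 \<le> h" using t Y0 R0 by (simp add: h_def)
    show "X \<subseteq> {0..<fact Q} \<times> UNIV" by (auto simp: X_def H_def)
  next
    fix i n :: int
    assume i: "i \<in> {0..<fact Q}"
      and n: "\<beta> + \<alpha> * of_int i + 1 / Q < of_int n" "of_int n < \<beta> + \<alpha> * of_int i + h - 1 / Q"
    have i: "i \<in> {0..<H}" using i by (simp add: H_def)
    have n1: "c t1 i < of_int n" using approx[OF t'(1) i] n lin1[of i] by linarith
    have n2: "of_int n < c t2 i" using approx[OF t'(2) i] n lin2[of i] by linarith
    \<comment> \<open>The inner circle has nonnegative height here, so the points above it lie on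
      the upper arc, as \<open>col_block\<close> demands.\<close>
    have "0 \<le> c t1 i" using nonneg[OF t'(1) i] by (simp add: c_def)
    then have n0: "0 < n" using n1 by linarith
    have "R + t1 < norm (Complex (of_int (m + i)) (of_int n))"
      using c_less[OF t'(1) i n0] n1 by simp
    moreover have "norm (Complex (of_int (m + i)) (of_int n)) < R + t2"
      using less_c[OF t'(2) i n0] n2 by simp
    ultimately show "(i, n) \<in> X"
      using i n0 t unfolding X_def Z_def col_block_def Gam_def m_def by auto
  next
    fix i n :: int
    assume "(i, n) \<in> X"
    then have i: "i \<in> {0..<H}" and n0: "0 < n"
      and z: "R + t1 < norm (Complex (of_int (m + i)) (of_int n))" "norm (Complex (of_int (m + i)) (of_int n)) \<le> R + t2"
      by (auto simp: X_def Z_def col_block_def)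
    have "c t1 i < of_int n" using c_less[OF t'(1) i n0] z by simp
    moreover have "of_int n \<le> c t2 i" using c_less[OF t'(2) i n0] z by simp
    ultimately show "\<beta> + \<alpha> * of_int i - 1 / Q \<le> of_int n \<and> of_int n \<le> \<beta> + \<alpha> * of_int i + h + 1 / Q"
      using approx[OF t'(1) i] approx[OF t'(2) i] lin1[of i] lin2[of i] by linarith
  qed
  moreover have "bij_betw (\<lambda>(i, n). Complex (of_int (m + i)) (of_int n)) X Z"
  proof (rule bij_betwI')
    fix z assume z: "z \<in> Z"
    then obtain a b where ab: "z = Complex (of_int a) (of_int b)"
      unfolding Z_def col_block_def Gam_def Ints_def by (auto simp: complex_eq_iff)
    have "(a - m, b) \<in> X" using z unfolding ab X_def
      by (auto simp: Z_def col_block_def m_def simp flip: of_int_add of_int_mult)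
    then show "\<exists>x\<in>X. z = (case x of (i, n) \<Rightarrow> Complex (real_of_int (m + i)) (real_of_int n))"
      by (intro bexI[of _ "(a - m, b)"]) (auto simp: ab)
  qed (auto simp: X_def)
  then have "card X = card Z" by (rule bij_betw_same_card)
  ultimately show ?thesis
    unfolding Z_def h_def Y_def m_def H_def by simp
qed

section \<open>Most blocks of columns have a good slope\<close>

lemma slope_expanding_aux:
  fixes x x' R :: real
  assumes "0 \<le> x'" "x' \<le> x" "x < R"
  shows "x - x' \<le> R * (x / height R x - x' / height R x')"
proof -
  have pos: "0 < height R x" "0 < height R x'" and le: "height R x \<le> height R x'" "height R x' \<le> R"
    using assms unfolding height_def by (auto intro!: power_strict_mono power_mono real_le_lsqrt)
  have "(x - x') / R \<le> (x - x') / height R x'"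
    using pos le assms by (intro divide_left_mono) auto
  also have "\<dots> \<le> x / height R x - x' / height R x'"
    unfolding diff_divide_distrib using pos le assms by (intro diff_right_mono divide_left_mono) auto
  finally show ?thesis using assms by (simp add: field_simps)
qed

text \<open>The slope has derivative R^2 / (R^2 - x^2)^(3/2), which is at least 1 / R. Hence all
  columns whose slope is close to a given number are close to each other.\<close>

lemma slope_expanding:
  fixes x x' R :: real
  assumes "\<bar>x\<bar> < R" "\<bar>x'\<bar> < R"
  shows "\<bar>x - x'\<bar> \<le> R * \<bar>x / height R x - x' / height R x'\<bar>"
proof -
  have hm: "height R (- u) = height R u" for u by (simp add: height_def)
  have *: "x - x' \<le> R * (x / height R x - x' / height R x')"
    if "\<bar>x\<bar> < R" "\<bar>x'\<bar> < R" "x' \<le> x" for x x'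
  proof -
    consider "0 \<le> x'" | "x \<le> 0" | "x' \<le> 0" "0 \<le> x" by linarith
    then show ?thesis
    proof cases
      case 1 then show ?thesis using that by (intro slope_expanding_aux) auto
    next
      case 2
      then show ?thesis using slope_expanding_aux[of "- x" "- x'" R] that by (simp add: hm)
    next
      case 3
      have "x - 0 \<le> R * (x / height R x - 0 / height R 0)"
        using 3 that by (intro slope_expanding_aux) auto
      moreover have "- x' - 0 \<le> R * (- x' / height R (- x') - 0 / height R 0)"
        using 3 that by (intro slope_expanding_aux) auto
      ultimately show ?thesis by (simp add: hm algebra_simps)
    qed
  qed
  have R: "0 \<le> R" using assms by linarith
  show ?thesis
  proof (cases "x' \<le> x")
    case True
    then have "\<bar>x - x'\<bar> \<le> R * (x / height R x - x' / height R x')" using *[OF assms True] by simp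
    also have "\<dots> \<le> R * \<bar>x / height R x - x' / height R x'\<bar>" using R by (intro mult_left_mono) auto
    finally show ?thesis .
  next
    case False
    then have "\<bar>x - x'\<bar> \<le> R * (x' / height R x' - x / height R x)" using *[OF assms(2,1)] by simp
    also have "\<dots> \<le> R * \<bar>x / height R x - x' / height R x'\<bar>" using R by (intro mult_left_mono) auto
    finally show ?thesis .
  qed
qed

text \<open>Each rational a / q with q \<le> q0 spoils columns within a range of length at most 2 R
  / Q, by \<open>slope_expanding\<close>. Of the loss of 6 block lengths, one is due to s = 0, four
  to the margins and one to rounding.\<close>

lemma card_good_cols_lower:
  fixes R :: real and q0 Q :: nat
  assumes q0: "0 < q0" and Q: "0 < Q" and R: "2 * sqrt 2 * fact Q < R"
  shows "finite (good_cols R q0 Q)"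
    "sqrt 2 * R - 6 * fact Q - real (q0 * (2 * q0 + 3)) * (2 * R / Q + fact Q)
       \<le> real (card (good_cols R q0 Q)) * fact Q"
proof -
  define F :: real where "F = fact Q"
  have F: "1 \<le> F" unfolding F_def by (rule fact_ge_1)
  have s2: "0 < sqrt (2::real)" "sqrt (2::real) * sqrt 2 = 2" by simp_all
  have R0: "R > 0" using R F s2 unfolding F_def[symmetric] by (smt (verit) mult_pos_pos)
  define x where "x s = F * real_of_int s" for s
  define \<alpha> where "\<alpha> s = x s / height R (x s)" for s
  define S0 where "S0 = {s. \<bar>x s\<bar> \<le> R / sqrt 2 - 2 * F}"
  have S0: "s \<in> S0 \<longleftrightarrow> - ((R / sqrt 2 - 2 * F) / F) \<le> of_int s \<and> of_int s \<le> (R / sqrt 2 - 2 * F) / F" for s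
    using F unfolding S0_def x_def by (auto simp: field_simps abs_le_iff)
  have width: "0 \<le> R / sqrt 2 - 2 * F"
    using R s2 unfolding F_def[symmetric] by (simp add: field_simps)
  have finS0: "finite S0"
    by (rule card_int_interval_upper(1)[of S0 "- ((R / sqrt 2 - 2 * F) / F)" "(R / sqrt 2 - 2 * F) / F"])
       (use S0 width F in auto)
  have "(R / sqrt 2 - 2 * F) / F - (- ((R / sqrt 2 - 2 * F) / F)) - 1 \<le> real (card S0)"
    by (rule card_int_interval_lower) (use S0 finS0 in auto)
  then have "((R / sqrt 2 - 2 * F) / F - (- ((R / sqrt 2 - 2 * F) / F)) - 1) * F \<le> real (card S0) * F"
    using F by (intro mult_right_mono) auto
  moreover have "((R / sqrt 2 - 2 * F) / F - (- ((R / sqrt 2 - 2 * F) / F)) - 1) * F = sqrt 2 * R - 5 * F"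
    using F s2 by (simp add: field_simps)
  ultimately have cardS0: "sqrt 2 * R - 5 * F \<le> real (card S0) * F" by simp
  have xR: "\<bar>x s\<bar> < R" "\<bar>\<alpha> s\<bar> \<le> 1" if "s \<in> S0" for s
  proof -
    have le: "\<bar>x s\<bar> \<le> R / sqrt 2" using that F unfolding S0_def by auto
    have "R / sqrt 2 < R" using R0 sqrt2_bounds by (simp add: divide_less_eq)
    then show "\<bar>x s\<bar> < R" using le by linarith
    have x2: "(x s)\<^sup>2 \<le> R\<^sup>2 / 2" using power_mono[OF le, of 2] by (simp add: power_divide)
    then have "\<bar>x s\<bar> \<le> height R (x s)" unfolding height_def
      by (intro real_le_rsqrt) simp
    then show "\<bar>\<alpha> s\<bar> \<le> 1" unfolding \<alpha>_def abs_divide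
      by (cases "height R (x s) = 0") (auto simp: divide_le_eq_1)
  qed
  define B where "B q a = {s \<in> S0. \<bar>of_int q * \<alpha> s - of_int a\<bar> < 1 / real Q}" for q a :: int
  have B: "real (card (B q a)) \<le> 2 * R / (Q * F) + 1" if "0 < q" for q a
  proof (rule card_int_diam(2))
    fix s s' assume s: "s \<in> B q a" "s' \<in> B q a"
    have "\<bar>of_int q * (\<alpha> s - \<alpha> s')\<bar> = \<bar>(of_int q * \<alpha> s - of_int a) - (of_int q * \<alpha> s' - of_int a)\<bar>"
      by (simp add: algebra_simps)
    also have "\<dots> \<le> 2 / Q" using s unfolding B_def by (auto simp: field_simps)
    finally have "of_int q * \<bar>\<alpha> s - \<alpha> s'\<bar> \<le> 2 / Q" using that by (simp add: abs_mult)
    moreover have "1 * \<bar>\<alpha> s - \<alpha> s'\<bar> \<le> of_int q * \<bar>\<alpha> s - \<alpha> s'\<bar>"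
      using that by (intro mult_right_mono) auto
    ultimately have \<alpha>Q: "\<bar>\<alpha> s - \<alpha> s'\<bar> \<le> 2 / Q" by simp
    have "F * real_of_int (s - s') \<le> \<bar>x s - x s'\<bar>" by (simp add: x_def algebra_simps)
    also have "\<dots> \<le> R * \<bar>\<alpha> s - \<alpha> s'\<bar>" unfolding \<alpha>_def
      using s xR by (intro slope_expanding) (auto simp: B_def)
    also have "\<dots> \<le> R * (2 / Q)" using \<alpha>Q R0 by (intro mult_left_mono) auto
    finally show "real_of_int (s - s') \<le> 2 * R / (Q * F)" using F Q by (simp add: field_simps)
  qed (use R0 F in auto)
  \<comment> \<open>Slopes on \<open>S0\<close> are at most 1 in absolute value, so only
    \<bar>a\<bar> \<le> q + 1 can occur; this gives q0 (2 q0 + 3) pairs.\<close>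
  let ?I = "{1..int q0} \<times> {- int q0 - 1..int q0 + 1}"
  have sub: "S0 \<subseteq> good_cols R q0 Q \<union> {0} \<union> (\<Union>(q, a)\<in>?I. B q a)"
  proof
    fix s assume s: "s \<in> S0"
    have x_eq: "real_of_int (fact Q * s) = x s" by (simp add: x_def F_def)
    show "s \<in> good_cols R q0 Q \<union> {0} \<union> (\<Union>(q, a)\<in>?I. B q a)"
    proof (cases "s = 0 \<or> good_slope q0 Q (\<alpha> s)")
      case True
      then show ?thesis using s by (auto simp: good_cols_def S0_def \<alpha>_def x_def F_def)
    next
      case False
      then obtain q a where qa: "0 < q" "q \<le> int q0" "\<bar>of_int q * \<alpha> s - of_int a\<bar> < 1 / real Q"
        unfolding good_slope_def by (meson not_le)
      have "\<bar>of_int q * \<alpha> s\<bar> \<le> of_int q * 1"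
        unfolding abs_mult using qa xR(2)[OF s] by (intro mult_mono) auto
      moreover have "1 / real Q \<le> 1" using Q by simp
      ultimately have "\<bar>real_of_int a\<bar> \<le> of_int q + 1" using qa(3) by linarith
      then have "a \<in> {- int q0 - 1..int q0 + 1}" using qa(2) by auto
      then show ?thesis using qa s by (auto simp: B_def intro!: bexI[of _ "(q, a)"])
    qed
  qed
  have fin: "finite (good_cols R q0 Q)"
    by (rule finite_subset[OF _ finS0]) (auto simp: good_cols_def S0_def x_def F_def)
  then show "finite (good_cols R q0 Q)" .
  have finB: "finite (B q a)" for q a using finS0 by (auto simp: B_def)
  have "card S0 \<le> card (good_cols R q0 Q \<union> {0} \<union> (\<Union>(q, a)\<in>?I. B q a))"
    using fin finB by (intro card_mono[OF _ sub]) auto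
  also have "\<dots> \<le> card (good_cols R q0 Q) + 1 + card (\<Union>(q, a)\<in>?I. B q a)"
    using card_Un_le[of "good_cols R q0 Q \<union> {0}"] card_Un_le[of "good_cols R q0 Q" "{0}"]
    by (smt (verit) One_nat_def add_le_mono1 card.empty card.insert empty_iff finite.emptyI le_trans)
  also have "card (\<Union>(q, a)\<in>?I. B q a) \<le> (\<Sum>p\<in>?I. card (case p of (q, a) \<Rightarrow> B q a))"
    by (rule card_UN_le) simp
  finally have "real (card S0) \<le> real (card (good_cols R q0 Q)) + 1 + (\<Sum>p\<in>?I. real (card (case p of (q, a) \<Rightarrow> B q a)))"
    by (simp flip: of_nat_sum)
  also have "(\<Sum>p\<in>?I. real (card (case p of (q, a) \<Rightarrow> B q a))) \<le> (\<Sum>p\<in>?I. 2 * R / (Q * F) + 1)"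
    using B by (intro sum_mono) auto
  also have "\<dots> = real (q0 * (2 * q0 + 3)) * (2 * R / (Q * F) + 1)"
    by (simp add: card_cartesian_product nat_add_distrib nat_mult_distrib algebra_simps)
  finally have "real (card S0) * F \<le> (real (card (good_cols R q0 Q)) + 1 + real (q0 * (2 * q0 + 3)) * (2 * R / (Q * F) + 1)) * F"
    using F by (intro mult_right_mono) auto
  also have "\<dots> = real (card (good_cols R q0 Q)) * F + F + real (q0 * (2 * q0 + 3)) * (2 * R / Q + F)"
    using F by (simp add: field_simps)
  finally show "sqrt 2 * R - 6 * fact Q - real (q0 * (2 * q0 + 3)) * (2 * R / Q + fact Q)
       \<le> real (card (good_cols R q0 Q)) * fact Q"
    using cardS0 unfolding F_def[symmetric] by linarith
qed

section \<open>The quarter of the annulus between the diagonals, and its points outside the good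
  blocks\<close>

lemma finite_Gam [simp]: "finite (Gam R)"
proof -
  let ?A = "{\<lfloor>-(R + 1)\<rfloor>..\<lceil>R + 1\<rceil>}"
  have "Gam R \<subseteq> (\<lambda>(a, b). Complex (of_int a) (of_int b)) ` (?A \<times> ?A)"
  proof
    fix z assume z: "z \<in> Gam R"
    then obtain a b where ab: "Re z = of_int a" "Im z = of_int b"
      unfolding Gam_def Ints_def by auto
    have "norm z < R + 1" using z sqrt2_bounds unfolding Gam_def by auto
    then have "\<bar>real_of_int a\<bar> < R + 1" "\<bar>real_of_int b\<bar> < R + 1"
      using abs_Re_le_cmod[of z] abs_Im_le_cmod[of z] ab by auto
    then have "a \<in> ?A" "b \<in> ?A" by (auto; linarith)+
    moreover have "z = Complex (of_int a) (of_int b)" using ab by (simp add: complex_eq_iff)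
    ultimately show "z \<in> (\<lambda>(a, b). Complex (of_int a) (of_int b)) ` (?A \<times> ?A)" by force
  qed
  then show ?thesis by (rule finite_subset) simp
qed

text \<open>A fundamental domain for multiplication by \<open>\<i>\<close>.\<close>

definition upper :: "real \<Rightarrow> complex set" where
  "upper R = {z \<in> Gam R. - Im z < Re z \<and> Re z \<le> Im z}"

lemma upper_height:
  assumes "z \<in> upper R" "10 \<le> R"
  shows "2 * R / 3 - 1 \<le> Im z" "\<bar>Re z\<bar> \<le> R / sqrt 2 + 1/2" "0 < Im z"
proof -
  have z: "R - 1 / sqrt 2 < norm z" "norm z < R + 1 / sqrt 2" "\<bar>Re z\<bar> \<le> Im z"
    using assms by (auto simp: upper_def Gam_def)
  have sq: "(norm z)\<^sup>2 = (Re z)\<^sup>2 + (Im z)\<^sup>2" by (simp add: cmod_power2)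
  have Im0: "0 \<le> Im z" using z(3) by linarith
  have r2: "(Re z)\<^sup>2 \<le> (Im z)\<^sup>2" using z(3) Im0 by (metis abs_le_square_iff abs_of_nonneg)
  have n2: "norm z = sqrt 2 * (norm z / sqrt 2)" by simp
  have "(norm z / sqrt 2)\<^sup>2 \<le> (Im z)\<^sup>2" using sq r2 by (simp add: power_divide)
  then have 1: "norm z / sqrt 2 \<le> Im z" using Im0 by (rule power2_le_imp_le)
  have "(Re z)\<^sup>2 \<le> (norm z / sqrt 2)\<^sup>2" using sq r2 by (simp add: power_divide)
  then have 2: "\<bar>Re z\<bar> \<le> norm z / sqrt 2" by (auto intro: power2_le_imp_le[of "\<bar>Re z\<bar>"])
  have "(R - 1 / sqrt 2) / sqrt 2 \<le> norm z / sqrt 2" using z by (intro divide_right_mono) auto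
  then have "R / sqrt 2 - 1/2 \<le> Im z" using 1 by (simp add: diff_divide_distrib)
  moreover have "(2/3) * R \<le> (1 / sqrt 2) * R" using sqrt2_bounds assms(2) by (intro mult_right_mono) auto
  ultimately show 3: "2 * R / 3 - 1 \<le> Im z" by simp
  then show "0 < Im z" using assms(2) by simp
  have "norm z / sqrt 2 \<le> (R + 1 / sqrt 2) / sqrt 2" using z by (intro divide_right_mono) auto
  then show "\<bar>Re z\<bar> \<le> R / sqrt 2 + 1/2" using 2 by (simp add: add_divide_distrib)
qed

text \<open>In one column, squared heights differ by at most 4 R / sqrt 2, while the sum of two
  heights is at least 4 R / 3 - 2; so two points are at most 4 apart. This turns a bound on lost
  columns into one on lost points.\<close>

lemma card_column_upper:
  assumes "10 \<le> R"
  shows "card {z \<in> upper R. Re z = x} \<le> 5"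
proof -
  define X where "X = {n :: int. Complex x (of_int n) \<in> upper R}"
  have eq: "{z \<in> upper R. Re z = x} = (\<lambda>n. Complex x (of_int n)) ` X"
  proof (intro equalityI subsetI)
    fix z assume z: "z \<in> {z \<in> upper R. Re z = x}"
    then obtain b where "Im z = of_int b" by (auto simp: upper_def Gam_def Ints_def)
    then have "z = Complex x (of_int b)" using z by (auto simp: complex_eq_iff)
    then show "z \<in> (\<lambda>n. Complex x (of_int n)) ` X" using z by (auto simp: X_def)
  qed (auto simp: X_def)
  have "real (card X) \<le> 4 + 1"
  proof (rule card_int_diam(2))
    fix n n' assume n: "n \<in> X" "n' \<in> X"
    let ?z = "Complex x (of_int n)" and ?z' = "Complex x (of_int n')"
    have z: "?z \<in> upper R" "?z' \<in> upper R" using n by (auto simp: X_def)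
    have im: "2 * R / 3 - 1 \<le> of_int n" "2 * R / 3 - 1 \<le> of_int n'"
      using upper_height(1)[OF z(1) assms] upper_height(1)[OF z(2) assms] by auto
    have "norm ?z < R + 1 / sqrt 2" "R - 1 / sqrt 2 < norm ?z'"
      using z by (auto simp: upper_def Gam_def)
    then have "(norm ?z)\<^sup>2 \<le> (R + 1 / sqrt 2)\<^sup>2" "(R - 1 / sqrt 2)\<^sup>2 \<le> (norm ?z')\<^sup>2"
      using assms sqrt2_bounds by (intro power_mono; simp)+
    then have "(real_of_int n)\<^sup>2 - (of_int n')\<^sup>2 \<le> 4 * R * (1 / sqrt 2)"
      unfolding cmod_power2 by (simp add: power2_eq_square algebra_simps)
    also have "\<dots> \<le> 4 * R * (5 / 7)" using sqrt2_bounds assms by (intro mult_left_mono) auto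
    finally have d: "(real_of_int n - of_int n') * (of_int n + of_int n') \<le> 4 * R * (5 / 7)"
      by (simp add: power2_eq_square algebra_simps)
    show "real_of_int (n - n') \<le> 4"
    proof (rule ccontr)
      assume "\<not> ?thesis"
      then have "4 * (4 * R / 3 - 2) \<le> (real_of_int n - of_int n') * (of_int n + of_int n')"
        using im assms by (intro mult_mono) auto
      then show False using d assms by simp
    qed
  qed simp
  then have "card X \<le> 5" by linarith
  moreover have "card {z \<in> upper R. Re z = x} = card X"
    unfolding eq by (rule card_image) (auto intro: inj_onI)
  ultimately show ?thesis by simp
qed

lemma card_columns_upper:
  assumes "10 \<le> R" "finite C"
  shows "card {z \<in> upper R. Re z \<in> real_of_int ` C} \<le> 5 * card C"
proof -
  have "{z \<in> upper R. Re z \<in> real_of_int ` C} = (\<Union>m\<in>C. {z \<in> upper R. Re z = real_of_int m})" by auto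
  also have "card \<dots> \<le> (\<Sum>m\<in>C. card {z \<in> upper R. Re z = real_of_int m})"
    by (rule card_UN_le[OF assms(2)])
  also have "\<dots> \<le> (\<Sum>m\<in>C. 5)" by (intro sum_mono card_column_upper assms)
  finally show ?thesis by simp
qed

lemma col_block_upper:
  assumes s: "s \<in> good_cols R q0 Q" and R: "10 \<le> R"
  shows "col_block R (fact Q) s \<subseteq> upper R"
proof
  fix z assume z: "z \<in> col_block R (fact Q) s"
  define F :: real where "F = fact Q"
  have F: "1 \<le> F" unfolding F_def by (rule fact_ge_1)
  have "\<bar>F * of_int s\<bar> \<le> R / sqrt 2 - 2 * F" using s by (simp add: good_cols_def F_def)
  moreover have "F * of_int s \<le> Re z" "Re z < F * of_int s + F"
    using z by (auto simp: col_block_def F_def)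
  \<comment> \<open>The width of the block uses up one of the two block lengths of margin; what
    remains keeps \<open>z\<close> strictly above both diagonals.\<close>
  ultimately have x: "\<bar>Re z\<bar> \<le> R / sqrt 2 - 1" using F by linarith
  have z': "z \<in> Gam R" "0 < Im z" "R - 1 / sqrt 2 < norm z" using z by (auto simp: col_block_def Gam_def)
  have sq: "(norm z)\<^sup>2 = (Re z)\<^sup>2 + (Im z)\<^sup>2" by (simp add: cmod_power2)
  have "(R - 1 / sqrt 2)\<^sup>2 \<le> (norm z)\<^sup>2" using z' R sqrt2_bounds by (intro power_mono) auto
  then have 1: "R\<^sup>2 - 2 * R / sqrt 2 + 1/2 \<le> (Re z)\<^sup>2 + (Im z)\<^sup>2"
    by (simp add: power2_diff power_divide sq)
  have "(Re z)\<^sup>2 \<le> (R / sqrt 2 - 1)\<^sup>2" using power_mono[OF x, of 2] by simp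
  then have 2: "(Re z)\<^sup>2 \<le> R\<^sup>2 / 2 - 2 * R / sqrt 2 + 1" by (simp add: power2_diff power_divide)
  have "1 * R \<le> (2 * (1 / sqrt 2)) * R" using sqrt2_bounds R by (intro mult_right_mono) auto
  then have "(Re z)\<^sup>2 < (Im z)\<^sup>2" using 1 2 R by simp
  then have "\<bar>Re z\<bar> < Im z" using z' by (metis abs_of_pos abs_square_less_1 real_sqrt_abs real_sqrt_less_iff)
  then show "z \<in> upper R" using z' by (auto simp: upper_def)
qed

text \<open>At most sqrt 2 * R + 2 columns meet \<open>upper R\<close>, the good blocks fill
  disjoint intervals of \<open>fact Q\<close> of them, and each column left over carries at most 5
  points.\<close>

lemma card_upper_exceptional:
  assumes "10 \<le> R" "finite (good_cols R q0 Q)"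
  shows "real (card (upper R - (\<Union>s\<in>good_cols R q0 Q. col_block R (fact Q) s)))
     \<le> 5 * (sqrt 2 * R + 2 - real (card (good_cols R q0 Q)) * fact Q)"
proof -
  define H :: int where "H = fact Q"
  have H: "0 < H" by (simp add: H_def)
  define G where "G = (\<Union>s\<in>good_cols R q0 Q. {H * s..<H * s + H})"
  define C where "C = {m :: int. \<bar>real_of_int m\<bar> \<le> R / sqrt 2 + 1/2}"
  have finC: "finite C" and cardC: "real (card C) \<le> sqrt 2 * R + 2"
  proof -
    have C: "- (R / sqrt 2 + 1/2) \<le> real_of_int j \<and> real_of_int j \<le> R / sqrt 2 + 1/2" if "j \<in> C" for j
      using that unfolding C_def by (auto simp: abs_le_iff)
    have "0 \<le> (R / sqrt 2 + 1/2) - (- (R / sqrt 2 + 1/2)) + 1" using assms by simp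
    from card_int_interval_upper[of C, OF C this] show "finite C" "real (card C) \<le> sqrt 2 * R + 2"
      by (auto simp: field_simps)
  qed
  have GC: "G \<subseteq> C"
  proof
    fix m assume "m \<in> G"
    then obtain s where s: "s \<in> good_cols R q0 Q" "H * s \<le> m" "m < H * s + H" by (auto simp: G_def)
    have "\<bar>real_of_int (H * s)\<bar> \<le> R / sqrt 2 - 2 * of_int H" using s by (simp add: good_cols_def H_def)
    moreover have "real_of_int (H * s) \<le> of_int m" "real_of_int m < of_int (H * s) + of_int H"
      using s(2,3) by linarith+
    moreover have "0 < real_of_int H" using H by simp
    ultimately have "\<bar>real_of_int m\<bar> \<le> R / sqrt 2 + 1/2" by linarith
    then show "m \<in> C" by (simp add: C_def)
  qed
  have cardG: "card G = card (good_cols R q0 Q) * nat H"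
  proof -
    have eq: "m div H = s" if "m \<in> {H * s..<H * s + H}" for m s
      using that H by (intro int_div_pos_eq[where r = "m - H * s"]) auto
    have "card G = (\<Sum>s\<in>good_cols R q0 Q. card {H * s..<H * s + H})"
      unfolding G_def using assms(2)
    proof (intro card_UN_disjoint ballI impI)
      fix s s' :: int assume "s \<noteq> s'"
      then show "{H * s..<H * s + H} \<inter> {H * s'..<H * s' + H} = {}" using eq by blast
    qed auto
    then show ?thesis by simp
  qed
  have "upper R - (\<Union>s\<in>good_cols R q0 Q. col_block R (fact Q) s) \<subseteq> {z \<in> upper R. Re z \<in> real_of_int ` (C - G)}"
  proof
    fix z assume z: "z \<in> upper R - (\<Union>s\<in>good_cols R q0 Q. col_block R (fact Q) s)"
    then obtain m where m: "Re z = real_of_int m" by (auto simp: upper_def Gam_def Ints_def)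
    have "m \<in> C" using upper_height(2)[of z R] z assms m by (auto simp: C_def)
    moreover have "m \<notin> G"
    proof
      assume "m \<in> G"
      then obtain s where s: "s \<in> good_cols R q0 Q" "H * s \<le> m" "m < H * s + H" by (auto simp: G_def)
      then have "z \<in> col_block R H s"
        using z upper_height(3)[of z R] assms m
        by (auto simp: col_block_def upper_def simp flip: of_int_mult of_int_add)
      then show False using z s by (auto simp: H_def)
    qed
    ultimately show "z \<in> {z \<in> upper R. Re z \<in> real_of_int ` (C - G)}" using z m by auto
  qed
  then have "card (upper R - (\<Union>s\<in>good_cols R q0 Q. col_block R (fact Q) s)) \<le> card {z \<in> upper R. Re z \<in> real_of_int ` (C - G)}"
    by (intro card_mono) (auto simp: upper_def)
  also have "\<dots> \<le> 5 * card (C - G)" using assms finC by (intro card_columns_upper) auto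
  also have "card (C - G) = card C - card G" using finC GC by (intro card_Diff_subset) (auto intro: finite_subset)
  finally have "real (card (upper R - (\<Union>s\<in>good_cols R q0 Q. col_block R (fact Q) s))) \<le> real (5 * (card C - card G))"
    by (simp only: of_nat_le_iff)
  also have "\<dots> = 5 * (real (card C) - real (card G))"
    using card_mono[OF finC GC] by (simp add: of_nat_diff)
  finally have "real (card (upper R - (\<Union>s\<in>good_cols R q0 Q. col_block R (fact Q) s))) \<le> 5 * (real (card C) - real (card G))" .
  moreover have "real (card G) = real (card (good_cols R q0 Q)) * fact Q"
    unfolding cardG by (simp add: H_def)
  ultimately show ?thesis using cardC by simp
qed

section \<open>Distribution of the radii within one good block\<close>

lemma finite_col_block [simp]: "finite (col_block R H s)"
  by (rule finite_subset[OF _ finite_Gam[of R]]) (auto simp: col_block_def)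

lemma col_block_norm:
  "z \<in> col_block R H s \<Longrightarrow> norm z - R \<in> {-1 / sqrt 2<..<1 / sqrt 2}"
  by (auto simp: col_block_def Gam_def)

lemma good_cols_height:
  assumes s: "s \<in> good_cols R q0 Q" and R: "0 < R"
  shows "R / 2 \<le> height R (of_int (fact Q * s))" "height R (of_int (fact Q * s)) \<le> R"
    "\<bar>real_of_int (fact Q * s)\<bar> \<le> R / sqrt 2 - 2 * fact Q"
proof -
  show 1: "\<bar>real_of_int (fact Q * s)\<bar> \<le> R / sqrt 2 - 2 * fact Q" using s by (simp add: good_cols_def)
  then have "\<bar>real_of_int (fact Q * s)\<bar> \<le> R / sqrt 2" using fact_ge_zero[of Q, where 'a = real] by linarith
  from power_mono[OF this, of 2]
  have m2: "(real_of_int (fact Q * s))\<^sup>2 \<le> R\<^sup>2 / 2" by (simp add: power_divide)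
  show "R / 2 \<le> height R (of_int (fact Q * s))" unfolding height_def
  proof (rule real_le_rsqrt)
    have "(R / 2)\<^sup>2 = R\<^sup>2 / 4" by (simp add: power_divide)
    then show "(R / 2)\<^sup>2 \<le> R\<^sup>2 - (real_of_int (fact Q * s))\<^sup>2" using m2 zero_le_power2[of R] by linarith
  qed
  show "height R (of_int (fact Q * s)) \<le> R" unfolding height_def
    by (rule real_le_lsqrt) (use R m2 in auto)
qed

text \<open>The range of radii is cut into \<open>N\<close> slices. On each slice \<open>b\<close>
  is frozen at the lower end, once in the sum (cost \<open>e\<close> per point) and once in the
  integral (cost \<open>e\<close> per expected point), and \<open>card_col_block_slice\<close>
  connects the two. \<open>\<Lambda>\<close> is the expected number of points per unit of
  radius.\<close>

lemma sum_col_block_approx: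
  fixes R B e :: real and q0 Q N :: nat and b :: "real \<Rightarrow> real"
  assumes q0: "0 < q0" and Q: "0 < Q" and N: "0 < N"
    and s: "s \<in> good_cols R q0 Q"
    and R: "20 * (1 + fact Q)\<^sup>2 * real Q \<le> R"
    and cont: "continuous_on window b"
    and bound: "\<And>t. t \<in> window \<Longrightarrow> \<bar>b t\<bar> \<le> B"
    and osc: "\<And>t t'. t \<in> window \<Longrightarrow> t' \<in> window \<Longrightarrow>
      \<bar>t - t'\<bar> \<le> sqrt 2 / N \<Longrightarrow> \<bar>b t - b t'\<bar> \<le> e"
  defines "\<Lambda> \<equiv> fact Q * (R / height R (of_int (fact Q * s)))"
  shows "\<bar>(\<Sum>z\<in>col_block R (fact Q) s. b (norm z - R)) - integral window b * \<Lambda>\<bar>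
      \<le> e * card (col_block R (fact Q) s) + N * (B * (5 * fact Q / q0)) + e * sqrt 2 * \<Lambda>"
proof -
  define P where "P = col_block R (fact Q) s"
  define w :: real where "w = 1 / sqrt 2"
  define d where "d = sqrt 2 / N"
  define \<tau> where "\<tau> p = - w + real p * d" for p :: nat
  have mw: "- 1 / sqrt 2 = - w" and pw: "1 / sqrt 2 = w" by (auto simp: w_def)
  have w2: "w + w = sqrt 2" by (simp add: w_def field_simps)
  have d0: "d > 0" using N by (simp add: d_def)
  have \<tau>0: "\<tau> 0 = - w" by (simp add: \<tau>_def)
  have \<tau>N: "\<tau> N = w" using N w2 by (simp add: \<tau>_def d_def)
  have \<tau>Suc: "\<tau> (Suc p) = \<tau> p + d" for p by (simp add: \<tau>_def algebra_simps)
  have \<tau>mono: "\<tau> p \<le> \<tau> p'" if "p \<le> p'" for p p' using that d0 by (auto simp: \<tau>_def intro!: mult_right_mono)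
  have \<tau>mem: "\<tau> p \<in> {-w..w}" if "p \<le> N" for p using \<tau>mono[of 0 p] \<tau>mono[OF that] \<tau>0 \<tau>N by auto
  have fin: "finite P" by (simp add: P_def)
  have e0: "0 \<le> e" using osc[of w w] d0 unfolding mw pw by (auto simp: w_def)
  have F0: "0 < (fact Q :: real)" by simp
  have B0: "0 \<le> B" using bound[of w] unfolding mw pw by (force simp: w_def)
  have "0 < 20 * (1 + fact Q)\<^sup>2 * real Q" using Q F0 by (smt (verit) mult_pos_pos of_nat_0_less_iff zero_less_power)
  then have R0: "R > 0" using R by linarith
  have \<Lambda>0: "0 \<le> \<Lambda>" unfolding \<Lambda>_def using good_cols_height(1)[OF s R0] R0 by simp
  define D where "D p = {z \<in> P. norm z - R \<le> \<tau> p}" for p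
  have claim: "\<bar>(\<Sum>z\<in>D p. b (norm z - R)) - integral {-w..\<tau> p} b * \<Lambda>\<bar>
      \<le> e * card (D p) + p * (B * (5 * fact Q / q0)) + e * (p * d) * \<Lambda>" if "p \<le> N" for p
    using that
  proof (induction p)
    case 0
    have "D 0 = {}" unfolding D_def P_def \<tau>0 using col_block_norm by (fastforce simp: w_def)
    then show ?case by (simp add: \<tau>0)
  next
    case (Suc p)
    let ?C = "{z \<in> P. \<tau> p < norm z - R \<and> norm z - R \<le> \<tau> (Suc p)}"
    have D: "D (Suc p) = D p \<union> ?C" "D p \<inter> ?C = {}" using \<tau>Suc[of p] d0 by (auto simp: D_def)
    have finD: "finite (D p)" "finite ?C" using fin by (auto simp: D_def)
    have card: "card (D (Suc p)) = card (D p) + card ?C" unfolding D(1) using D(2) finD by (intro card_Un_disjoint)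
    have sum: "(\<Sum>z\<in>D (Suc p). b (norm z - R)) = (\<Sum>z\<in>D p. b (norm z - R)) + (\<Sum>z\<in>?C. b (norm z - R))"
      unfolding D(1) using D(2) finD by (intro sum.union_disjoint)
    have tp: "\<tau> p \<in> {-w..w}" "\<tau> (Suc p) \<in> {-w..w}" using \<tau>mem[of p] \<tau>mem[of "Suc p"] Suc.prems by auto
    have cnt: "\<bar>real (card ?C) - d * \<Lambda>\<bar> \<le> 5 * fact Q / q0"
    proof -
      have "\<bar>real (card ?C) - fact Q * ((\<tau> (Suc p) - \<tau> p) * R / height R (of_int (fact Q * s)))\<bar> \<le> 5 * fact Q / q0"
        unfolding P_def using tp d0 \<tau>Suc[of p]
        by (intro card_col_block_slice[OF q0 Q s _ _ _ R]) (auto simp: w_def)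
      then show ?thesis by (simp add: \<tau>Suc \<Lambda>_def mult_ac)
    qed
    have 1: "\<bar>(\<Sum>z\<in>?C. b (norm z - R)) - card ?C * b (\<tau> p)\<bar> \<le> e * card ?C"
    proof -
      have "(\<Sum>z\<in>?C. b (norm z - R)) - card ?C * b (\<tau> p) = (\<Sum>z\<in>?C. b (norm z - R) - b (\<tau> p))"
        by (simp add: sum_subtractf)
      also have "\<bar>\<dots>\<bar> \<le> (\<Sum>z\<in>?C. e)"
      proof (intro order.trans[OF sum_abs] sum_mono)
        fix z assume z: "z \<in> ?C"
        show "\<bar>b (norm z - R) - b (\<tau> p)\<bar> \<le> e"
          by (rule osc) (use z tp \<tau>Suc[of p] in \<open>auto simp: mw pw d_def[symmetric]\<close>)
      qed
      finally show ?thesis by (simp add: mult.commute)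
    qed
    have 2: "\<bar>card ?C * b (\<tau> p) - d * \<Lambda> * b (\<tau> p)\<bar> \<le> (5 * fact Q / q0) * B"
      unfolding left_diff_distrib[symmetric] abs_mult
      using cnt bound[of "\<tau> p"] tp B0 by (intro mult_mono) (auto simp: mw pw)
    have int: "b integrable_on {x..y}" if "-w \<le> x" "y \<le> w" for x y
      using that by (intro integrable_continuous_interval continuous_on_subset[OF cont]) (auto simp: w_def)
    have 3: "\<bar>integral {\<tau> p..\<tau> (Suc p)} b - d * b (\<tau> p)\<bar> \<le> e * d"
    proof -
      have "integral {\<tau> p..\<tau> (Suc p)} b - d * b (\<tau> p) = integral {\<tau> p..\<tau> (Suc p)} (\<lambda>t. b t - b (\<tau> p))"
        using tp \<tau>Suc[of p] d0 int by (subst integral_diff) auto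
      also have "norm \<dots> \<le> integral {\<tau> p..\<tau> (Suc p)} (\<lambda>t. e)"
      proof (rule integral_norm_bound_integral)
        show "(\<lambda>t. b t - b (\<tau> p)) integrable_on {\<tau> p..\<tau> (Suc p)}" using int tp by (intro integrable_diff) auto
        fix t assume "t \<in> {\<tau> p..\<tau> (Suc p)}"
        then show "norm (b t - b (\<tau> p)) \<le> e" unfolding real_norm_def
          by (intro osc) (use tp \<tau>Suc[of p] in \<open>auto simp: mw pw d_def[symmetric]\<close>)
      qed auto
      also have "\<dots> = e * d" using \<tau>Suc[of p] d0 by simp
      finally show ?thesis by simp
    qed
    have comb: "integral {-w..\<tau> (Suc p)} b = integral {-w..\<tau> p} b + integral {\<tau> p..\<tau> (Suc p)} b"
      using tp \<tau>Suc[of p] d0 int by (intro Henstock_Kurzweil_Integration.integral_combine[symmetric]) auto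
    have 4: "\<bar>d * \<Lambda> * b (\<tau> p) - integral {\<tau> p..\<tau> (Suc p)} b * \<Lambda>\<bar> \<le> e * d * \<Lambda>"
    proof -
      have "d * \<Lambda> * b (\<tau> p) - integral {\<tau> p..\<tau> (Suc p)} b * \<Lambda> = - (integral {\<tau> p..\<tau> (Suc p)} b - d * b (\<tau> p)) * \<Lambda>"
        by (simp add: algebra_simps)
      also have "\<bar>\<dots>\<bar> = \<bar>integral {\<tau> p..\<tau> (Suc p)} b - d * b (\<tau> p)\<bar> * \<Lambda>"
        using \<Lambda>0 by (simp add: abs_mult abs_minus_commute)
      also have "\<dots> \<le> e * d * \<Lambda>" using 3 \<Lambda>0 by (rule mult_right_mono)
      finally show ?thesis .
    qed
    have IH: "\<bar>(\<Sum>z\<in>D p. b (norm z - R)) - integral {-w..\<tau> p} b * \<Lambda>\<bar>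
      \<le> e * card (D p) + p * (B * (5 * fact Q / q0)) + e * (p * d) * \<Lambda>" using Suc by simp
    have exp: "e * card (D (Suc p)) + Suc p * (B * (5 * fact Q / q0)) + e * (Suc p * d) * \<Lambda>
      = (e * card (D p) + p * (B * (5 * fact Q / q0)) + e * (p * d) * \<Lambda>) + e * card ?C + (5 * fact Q / q0) * B + e * d * \<Lambda>"
      unfolding card by (simp add: algebra_simps add_divide_distrib)
    have exp2: "integral {-w..\<tau> (Suc p)} b * \<Lambda> = integral {-w..\<tau> p} b * \<Lambda> + integral {\<tau> p..\<tau> (Suc p)} b * \<Lambda>"
      unfolding comb by (simp add: distrib_right)
    show ?case unfolding sum exp exp2 using IH 1 2 4 by linarith
  qed
  have "D N = P" unfolding D_def \<tau>N P_def using col_block_norm by (fastforce simp: w_def)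
  moreover have "real N * d = sqrt 2" using N by (simp add: d_def)
  ultimately show ?thesis using claim[of N] unfolding \<tau>N mw pw P_def by (simp add: algebra_simps)
qed

text \<open>The estimate is needed in two normalisations: with \<open>\<Lambda>\<close>, which turns
  into the arc-length density of a Riemann sum, and with the size of the block, which makes
  deviations from the mean additive over the blocks of a window.\<close>

lemma col_block_equidistributed:
  fixes R B e :: real and q0 Q N :: nat and b :: "real \<Rightarrow> real"
  assumes Q: "0 < Q" and N: "0 < N" and B: "1 \<le> B" and e: "0 < e" "e \<le> 1"
    and q0: "20 * N * B \<le> e * q0"
    and s: "s \<in> good_cols R q0 Q"
    and R: "20 * (1 + fact Q)\<^sup>2 * real Q \<le> R"
  defines "P \<equiv> col_block R (fact Q) s" and "\<Lambda> \<equiv> fact Q * (R / height R (of_int (fact Q * s)))"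
  shows "fact Q \<le> card P" "card P \<le> 4 * fact Q"
    and "\<lbrakk>continuous_on window b;
     \<And>t. t \<in> window \<Longrightarrow> \<bar>b t\<bar> \<le> B;
     \<And>t t'. t \<in> window \<Longrightarrow> t' \<in> window \<Longrightarrow>
      \<bar>t - t'\<bar> \<le> sqrt 2 / N \<Longrightarrow> \<bar>b t - b t'\<bar> \<le> e\<rbrakk> \<Longrightarrow>
     \<bar>(\<Sum>z\<in>P. b (norm z - R)) - integral window b * \<Lambda>\<bar> \<le> 5 * e * card P \<and>
     \<bar>(\<Sum>z\<in>P. b (norm z - R) - integral window b / sqrt 2)\<bar> \<le> 6 * e * card P"
proof -
  have "20 * 1 * 1 \<le> 20 * N * B" using N B by (intro mult_mono) auto
  also note q0
  also have "e * q0 \<le> 1 * real q0" using e by (intro mult_right_mono) auto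
  finally have q20: "20 \<le> real q0" by simp
  then have q00: "0 < q0" by auto
  define F :: real where "F = fact Q"
  have F: "1 \<le> F" unfolding F_def by (rule fact_ge_1)
  have "20 * 1 \<le> 20 * (1 + F)\<^sup>2 * real Q" using F Q by (simp add: mult_ge1_I)
  then have R0: "R > 0" using R unfolding F_def[symmetric] by linarith
  have Y: "R / 2 \<le> height R (of_int (fact Q * s))" "height R (of_int (fact Q * s)) \<le> R"
    using good_cols_height[OF s R0] by auto
  have "1 \<le> R / height R (of_int (fact Q * s))" "R / height R (of_int (fact Q * s)) \<le> 2"
    using Y R0 by (auto simp: field_simps)
  then have "F * 1 \<le> \<Lambda>" "\<Lambda> \<le> F * 2"
    unfolding \<Lambda>_def F_def by (intro mult_left_mono; simp)+
  then have \<Lambda>: "F \<le> \<Lambda>" "\<Lambda> \<le> 2 * F" by auto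
  define \<kappa> where "\<kappa> = 5 * F / q0"
  \<comment> \<open>The hypothesis on \<open>q0\<close> serves to keep the counting errors of all
    \<open>N\<close> slices together, weighted with \<open>B\<close>, below e F / 4.\<close>
  have NB\<kappa>: "N * (B * \<kappa>) \<le> e * F / 4"
  proof -
    have "N * (B * \<kappa>) = (20 * N * B) * F / (4 * q0)" unfolding \<kappa>_def by simp
    also have "\<dots> \<le> (e * q0) * F / (4 * q0)" using q0 F q00 by (intro divide_right_mono mult_right_mono) auto
    also have "\<dots> = e * F / 4" using q00 by simp
    finally show ?thesis .
  qed
  have "\<kappa> \<le> F / 4" using q20 F q00 by (simp add: \<kappa>_def field_simps)
  have slice: "\<bar>real (card {z \<in> col_block R (fact Q) s. - 1 / sqrt 2 < norm z - R \<and> norm z - R \<le> 1 / sqrt 2})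
      - fact Q * ((1 / sqrt 2 - - 1 / sqrt 2) * R / height R (of_int (fact Q * s)))\<bar> \<le> 5 * fact Q / q0"
    by (rule card_col_block_slice[OF q00 Q s _ _ _ R]) auto
  have "{z \<in> col_block R (fact Q) s. - 1 / sqrt 2 < norm z - R \<and> norm z - R \<le> 1 / sqrt 2} = P"
    unfolding P_def using col_block_norm by fastforce
  moreover have "(1 / sqrt 2 - - 1 / sqrt 2) = sqrt 2" by (simp add: field_simps)
  ultimately have card: "\<bar>card P - sqrt 2 * \<Lambda>\<bar> \<le> \<kappa>" using slice unfolding \<Lambda>_def \<kappa>_def F_def by (simp add: mult_ac)
  have s2: "7/5 * \<Lambda> \<le> sqrt 2 * \<Lambda>" "sqrt 2 * \<Lambda> \<le> 3/2 * \<Lambda>"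
    using sqrt2_bounds \<Lambda> F by (intro mult_right_mono; simp)+
  have c1': "F \<le> card P" using card s2 \<Lambda> \<open>\<kappa> \<le> F / 4\<close> F by linarith
  then show "fact Q \<le> card P" unfolding F_def by (metis of_nat_fact of_nat_le_iff)
  have "real (card P) \<le> 4 * F" using card s2 \<Lambda> \<open>\<kappa> \<le> F / 4\<close> F by linarith
  then show "card P \<le> 4 * fact Q" unfolding F_def by (metis of_nat_fact of_nat_le_iff of_nat_mult of_nat_numeral)
  assume b: "continuous_on window b"
     "\<And>t. t \<in> window \<Longrightarrow> \<bar>b t\<bar> \<le> B"
     "\<And>t t'. t \<in> window \<Longrightarrow> t' \<in> window \<Longrightarrow>
      \<bar>t - t'\<bar> \<le> sqrt 2 / N \<Longrightarrow> \<bar>b t - b t'\<bar> \<le> e"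
  let ?I = "integral window b"
  have "\<bar>(\<Sum>z\<in>P. b (norm z - R)) - ?I * \<Lambda>\<bar> \<le> e * card P + N * (B * \<kappa>) + e * sqrt 2 * \<Lambda>"
    unfolding P_def \<Lambda>_def \<kappa>_def F_def by (rule sum_col_block_approx[OF q00 Q N s R b])
  also have "e * sqrt 2 * \<Lambda> \<le> e * (3/2) * (2 * F)"
    using sqrt2_bounds \<Lambda> e F by (intro mult_mono) auto
  also have "e * card P + N * (B * \<kappa>) + e * (3/2) * (2 * F) \<le> e * card P + e * F / 4 + 3 * (e * F)"
    using NB\<kappa> by (simp add: mult.commute)
  also have "\<dots> \<le> 5 * (e * card P) - e * card P / 2"
    using mult_left_mono[OF c1', of e] e by simp
  finally have 1: "\<bar>(\<Sum>z\<in>P. b (norm z - R)) - ?I * \<Lambda>\<bar> \<le> 5 * e * card P - e * card P / 2" by simp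
  have Ile: "\<bar>?I\<bar> \<le> B * sqrt 2"
  proof -
    have "norm ?I \<le> B * (1 / sqrt 2 - - 1 / sqrt 2)"
      using b(1,2) by (intro integral_bound) auto
    also have "1 / sqrt 2 - - 1 / sqrt 2 = sqrt 2" by (simp add: field_simps)
    finally show ?thesis by simp
  qed
  then have "\<bar>?I / sqrt 2\<bar> \<le> B" by (simp add: abs_divide divide_le_eq)
  then have "\<bar>?I / sqrt 2 * (card P - sqrt 2 * \<Lambda>)\<bar> \<le> B * \<kappa>"
    unfolding abs_mult using card B by (intro mult_mono) auto
  also have "\<dots> \<le> N * (B * \<kappa>)"
    using N B F mult_right_mono[of 1 "real N" "B * \<kappa>"] by (simp add: \<kappa>_def)
  also have "\<dots> \<le> e * card P / 4" using NB\<kappa> mult_left_mono[OF c1', of e] e by linarith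
  finally have 2: "\<bar>?I / sqrt 2 * (card P - sqrt 2 * \<Lambda>)\<bar> \<le> e * card P / 4" .
  have eq: "(\<Sum>z\<in>P. b (norm z - R) - ?I / sqrt 2) =
      ((\<Sum>z\<in>P. b (norm z - R)) - ?I * \<Lambda>) - ?I / sqrt 2 * (card P - sqrt 2 * \<Lambda>)"
    by (simp add: sum_subtractf right_diff_distrib)
  have "0 \<le> e * card P" using e by simp
  then show "\<bar>(\<Sum>z\<in>P. b (norm z - R)) - ?I * \<Lambda>\<bar> \<le> 5 * e * card P \<and>
     \<bar>(\<Sum>z\<in>P. b (norm z - R) - ?I / sqrt 2)\<bar> \<le> 6 * e * card P"
    unfolding eq using 1 2 abs_triangle_ineq4[of "(\<Sum>z\<in>P. b (norm z - R)) - ?I * \<Lambda>" "?I / sqrt 2 * (card P - sqrt 2 * \<Lambda>)"]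
    unfolding mult.assoc[of _ e] by argo
qed

section \<open>Equidistribution in the annulus\<close>

text \<open>\<open>p\<close> is the point of the circle above the left edge of the block. Its height
  is at least R / 2, so the arc is not steep there and the block stays within bounded distance of
  \<open>p\<close>; all its directions therefore agree up to O(1/R).\<close>

lemma col_block_near:
  assumes s: "s \<in> good_cols R q0 Q" and R: "10 \<le> R" and z: "z \<in> col_block R (fact Q) s"
  defines "p \<equiv> Complex (of_int (fact Q * s)) (height R (of_int (fact Q * s)))"
  shows "norm p = R" "norm (z - p) \<le> 5 * fact Q + 8" "norm (sgn z - p / R) \<le> (5 * fact Q + 9) / R"
proof -
  define F :: real where "F = fact Q"
  define m where "m = real_of_int (fact Q * s)"
  define Y where "Y = height R m"
  have F: "1 \<le> F" unfolding F_def by (rule fact_ge_1)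
  have R0: "0 < R" using R by simp
  have Y1: "R / 2 \<le> Y" and mle: "\<bar>m\<bar> \<le> R / sqrt 2 - 2 * F"
    using good_cols_height[OF s R0] by (auto simp: Y_def m_def F_def)
  have sR: "R / sqrt 2 \<le> R" using R0 by (simp add: divide_le_eq)
  have mR: "\<bar>m\<bar> \<le> R - 2 * F" using mle sR by linarith
  have "m\<^sup>2 \<le> R\<^sup>2" using power_mono[of "\<bar>m\<bar>" R 2] mR F by simp
  then have YY: "Y\<^sup>2 = R\<^sup>2 - m\<^sup>2" by (simp add: Y_def height_def)
  then show "norm p = R" using R0 unfolding p_def cmod_def m_def[symmetric] Y_def[symmetric] by simp
  have x: "m \<le> Re z" "Re z < m + F" and y: "0 < Im z" and G: "z \<in> Gam R"
    using z by (auto simp: col_block_def m_def F_def)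
  have n: "\<bar>norm z - R\<bar> \<le> 1" using G sqrt2_bounds by (auto simp: Gam_def)
  have "\<bar>(norm z)\<^sup>2 - R\<^sup>2\<bar> = \<bar>norm z - R\<bar> * (norm z + R)"
    using R0 by (simp add: power2_eq_square square_diff_square_factored abs_mult mult.commute)
  also have "\<dots> \<le> 1 * (3 * R)" using n R by (intro mult_mono) auto
  finally have a: "\<bar>(norm z)\<^sup>2 - R\<^sup>2\<bar> \<le> 3 * R" by simp
  have "\<bar>(Re z)\<^sup>2 - m\<^sup>2\<bar> = \<bar>Re z - m\<bar> * \<bar>Re z + m\<bar>"
    by (simp add: power2_eq_square square_diff_square_factored abs_mult mult.commute)
  also have "\<dots> \<le> F * (2 * R)" using x mR F by (intro mult_mono) auto
  finally have b: "\<bar>(Re z)\<^sup>2 - m\<^sup>2\<bar> \<le> 2 * (F * R)" by simp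
  have "\<bar>Im z - Y\<bar> * (R / 2) \<le> \<bar>Im z - Y\<bar> * (Im z + Y)"
    using Y1 y by (intro mult_left_mono) auto
  also have "\<dots> = \<bar>(Im z)\<^sup>2 - Y\<^sup>2\<bar>"
    using Y1 y R0 by (simp add: power2_eq_square square_diff_square_factored abs_mult mult.commute)
  also have "(Im z)\<^sup>2 - Y\<^sup>2 = ((norm z)\<^sup>2 - R\<^sup>2) - ((Re z)\<^sup>2 - m\<^sup>2)" by (simp add: YY cmod_power2)
  also have "\<bar>\<dots>\<bar> \<le> 3 * R + 2 * (F * R)" using a b by linarith
  finally have "\<bar>Im z - Y\<bar> * (R / 2) \<le> (6 + 4 * F) * (R / 2)" by (simp add: algebra_simps)
  then have "\<bar>Im z - Y\<bar> \<le> 6 + 4 * F" by (rule mult_right_le_imp_le) (use R0 in simp)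
  moreover have "norm (z - p) \<le> \<bar>Re (z - p)\<bar> + \<bar>Im (z - p)\<bar>" by (rule cmod_le)
  ultimately have zp: "norm (z - p) \<le> 5 * F + 6"
    using x unfolding p_def m_def[symmetric] Y_def[symmetric] by simp
  then show "norm (z - p) \<le> 5 * fact Q + 8" by (simp add: F_def)
  have z0: "norm z > 0" using n R by linarith
  have "sgn z - p / R = (z - p) / R + sgn z * of_real (1 - norm z / R)"
    using z0 R0 by (simp add: sgn_eq field_simps)
  also have "norm \<dots> \<le> norm ((z - p) / R) + norm (sgn z * of_real (1 - norm z / R))" by (rule norm_triangle_ineq)
  also have "norm (sgn z * of_real (1 - norm z / R)) = \<bar>1 - norm z / R\<bar>"
    using z0 by (simp add: norm_mult norm_sgn del: of_real_diff of_real_divide)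
  also have "\<dots> \<le> 1 / R" using n R0 by (simp add: field_simps abs_le_iff)
  also have "norm ((z - p) / R) \<le> (5 * F + 6) / R"
    using zp R0 by (simp add: norm_divide divide_right_mono)
  finally show "norm (sgn z - p / R) \<le> (5 * fact Q + 9) / R"
    using R0 by (simp add: F_def field_simps)
qed

section \<open>Quarter turns of the annulus\<close>

lemma Gam_ii: "\<i> * z \<in> Gam R \<longleftrightarrow> z \<in> Gam R"
  by (auto simp: Gam_def norm_mult minus_in_Ints_iff)

lemma sgn_ii: "sgn (\<i> * z) = \<i> * sgn z"
  by (simp add: sgn_eq norm_mult)

definition turn :: "nat \<Rightarrow> complex \<Rightarrow> complex" where
  "turn k z = \<i> ^ k * z"

lemma turn_Suc: "turn (Suc k) z = \<i> * turn k z"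
  by (simp add: turn_def)

lemma inj_turn: "inj_on (turn k) A"
  by (auto simp: inj_on_def turn_def)

lemma norm_turn [simp]: "norm (turn k z) = norm z"
  by (simp add: turn_def norm_mult norm_power)

lemma turn_Gam: "turn k z \<in> Gam R \<longleftrightarrow> z \<in> Gam R"
  by (induction k) (simp_all add: turn_Suc Gam_ii, simp add: turn_def)

lemma less_4_cases: "k < (4::nat) \<Longrightarrow> k = 0 \<or> k = 1 \<or> k = 2 \<or> k = 3"
  by auto

lemma turn_cases:
  "turn 0 z = z" "turn (Suc 0) z = Complex (- Im z) (Re z)" "turn 2 z = - z" "turn 3 z = Complex (Im z) (- Re z)"
  by (auto simp: turn_def complex_eq_iff power2_eq_square power3_eq_cube)

lemma turn_upper_disjoint:
  assumes "k < 4" "k' < 4" "z \<in> turn k ` upper R" "z \<in> turn k' ` upper R"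
  shows "k = k'"
  using less_4_cases[OF assms(1)] less_4_cases[OF assms(2)] assms(3,4)
  by (elim disjE) (auto simp: turn_cases upper_def complex_eq_iff image_iff)

lemma Gam_eq_turn_upper:
  assumes "1 \<le> R"
  shows "Gam R = (\<Union>k<4. turn k ` upper R)"
proof
  show "(\<Union>k<4. turn k ` upper R) \<subseteq> Gam R" by (auto simp: turn_Gam upper_def)
  show "Gam R \<subseteq> (\<Union>k<4. turn k ` upper R)"
  proof
    fix z assume z: "z \<in> Gam R"
    \<comment> \<open>The four turned sectors cover the plane except for the origin.\<close>
    have "z \<noteq> 0" using z sqrt2_bounds assms by (auto simp: Gam_def)
    then have "Re z \<noteq> 0 \<or> Im z \<noteq> 0" by (auto simp: complex_eq_iff)
    then consider "- Im z < Re z" "Re z \<le> Im z" | "Re z < Im z" "Im z \<le> - Re z"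
      | "Im z < - Re z" "Re z \<ge> Im z" | "Im z < Re z" "- Im z \<le> Re z" by linarith
    then have "\<exists>k<4. \<exists>k'. turn k (turn k' z) = z \<and> turn k' z \<in> upper R"
    proof cases
      case 1
      then show ?thesis using z by (intro exI[of _ 0] exI[of _ 0] conjI) (auto simp: turn_def upper_def)
    next
      case 2
      then have "turn 3 z \<in> upper R" using turn_Gam[of 3 z R] z by (auto simp: upper_def turn_cases)
      then show ?thesis by (intro exI[of _ 1] exI[of _ 3] conjI) (auto simp: turn_cases complex_eq_iff)
    next
      case 3
      then have "turn 2 z \<in> upper R" using turn_Gam[of 2 z R] z by (auto simp: upper_def turn_cases)
      then show ?thesis by (intro exI[of _ 2] exI[of _ 2] conjI) (auto simp: turn_cases complex_eq_iff)
    next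
      case 4
      then have "turn (Suc 0) z \<in> upper R" using turn_Gam[of "Suc 0" z R] z by (auto simp: upper_def turn_cases)
      then show ?thesis by (intro exI[of _ 3] exI[of _ 1] conjI) (auto simp: turn_cases complex_eq_iff)
    qed
    then show "z \<in> (\<Union>k<4. turn k ` upper R)" by (metis UN_I image_eqI lessThan_iff)
  qed
qed

lemma finite_upper [simp]: "finite (upper R)"
  by (rule finite_subset[OF _ finite_Gam[of R]]) (auto simp: upper_def)

lemma sum_Gam_turn:
  fixes \<phi> :: "complex \<Rightarrow> real"
  assumes "1 \<le> R" and inv: "\<And>z. \<phi> (\<i> * z) = \<phi> z"
  shows "(\<Sum>z\<in>Gam R. \<phi> z) = 4 * (\<Sum>z\<in>upper R. \<phi> z)"
proof -
  have t: "\<phi> (turn k z) = \<phi> z" for k z by (induction k) (simp_all add: turn_Suc inv, simp add: turn_def)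
  have "(\<Sum>z\<in>Gam R. \<phi> z) = (\<Sum>k<4. \<Sum>z\<in>turn k ` upper R. \<phi> z)"
    unfolding Gam_eq_turn_upper[OF assms(1)]
  proof (intro sum.UNION_disjoint ballI impI)
    fix k k' :: nat assume "k \<in> {..<4}" "k' \<in> {..<4}" "k \<noteq> k'"
    then show "turn k ` upper R \<inter> turn k' ` upper R = {}" using turn_upper_disjoint[of k k'] by auto
  qed auto
  also have "\<dots> = (\<Sum>k<4::nat. \<Sum>z\<in>upper R. \<phi> z)"
    by (simp add: sum.reindex[OF inj_turn] t)
  finally show ?thesis by simp
qed

section \<open>Riemann sums over the good blocks, and the choice of the block length\<close>

lemma has_integral_step:
  fixes a b u h c :: real
  assumes "0 \<le> h" "a \<le> u" "u + h \<le> b"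
  shows "((\<lambda>t. if t \<in> {u..<u + h} then c else 0) has_integral h * c) {a..b}"
proof -
  have "((\<lambda>t. c) has_integral h * c) {u..u + h}"
    using has_integral_const_real[of c u "u + h"] assms by simp
  then have "((\<lambda>t. if t \<in> {u..u + h} then c else 0) has_integral h * c) {a..b}"
    using assms by (subst has_integral_restrict) auto
  then show ?thesis
    by (rule has_integral_spike_finite[of "{u + h}", rotated 2]) auto
qed

text \<open>The good blocks leave gaps; there the sum has no term and the error is at most
  \<open>B\<close>, elsewhere it is at most \<open>e\<close>. Both cases are captured by integrating
  B + (e - B) n, where n is the indicator of the covered part.\<close>

lemma riemann_sum_gaps:
  fixes \<psi> :: "real \<Rightarrow> real" and u :: "'i \<Rightarrow> real"
  assumes cont: "continuous_on {a..b} \<psi>" and "a \<le> b"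
    and bound: "\<And>t. t \<in> {a..b} \<Longrightarrow> \<bar>\<psi> t\<bar> \<le> B"
    and osc: "\<And>t t'. t \<in> {a..b} \<Longrightarrow> t' \<in> {a..b} \<Longrightarrow> \<bar>t - t'\<bar> \<le> h \<Longrightarrow> \<bar>\<psi> t - \<psi> t'\<bar> \<le> e"
    and fin: "finite S" and h: "0 \<le> h"
    and sub: "\<And>s. s \<in> S \<Longrightarrow> a \<le> u s \<and> u s + h \<le> b"
    and disj: "\<And>s s' t. s \<in> S \<Longrightarrow> s' \<in> S \<Longrightarrow> t \<in> {u s..<u s + h} \<Longrightarrow> t \<in> {u s'..<u s' + h} \<Longrightarrow> s = s'"
  shows "\<bar>(\<Sum>s\<in>S. h * \<psi> (u s)) - integral {a..b} \<psi>\<bar> \<le> e * (h * card S) + B * (b - a - h * card S)"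
proof -
  define g where "g t = (\<Sum>s\<in>S. if t \<in> {u s..<u s + h} then \<psi> (u s) else 0)" for t
  define n where "n t = (\<Sum>s\<in>S. if t \<in> {u s..<u s + h} then (1::real) else 0)" for t
  have g: "(g has_integral (\<Sum>s\<in>S. h * \<psi> (u s))) {a..b}"
    unfolding g_def using fin sub h by (intro has_integral_sum has_integral_step) auto
  have "(n has_integral (\<Sum>s\<in>S. h * 1)) {a..b}"
    unfolding n_def using fin sub h by (intro has_integral_sum has_integral_step) auto
  then have n: "((\<lambda>t. B + (e - B) * n t) has_integral (b - a) * B + (e - B) * (h * card S)) {a..b}"
    using \<open>a \<le> b\<close> has_integral_const_real[of B a b]
    by (intro has_integral_add has_integral_mult_right) (auto simp: mult.commute)
  have \<psi>: "(\<psi> has_integral integral {a..b} \<psi>) {a..b}"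
    using integrable_continuous_interval[OF cont] by (rule integrable_integral)
  have diff: "((\<lambda>t. g t - \<psi> t) has_integral (\<Sum>s\<in>S. h * \<psi> (u s)) - integral {a..b} \<psi>) {a..b}"
    by (rule has_integral_diff[OF g \<psi>])
  have "norm (integral {a..b} (\<lambda>t. g t - \<psi> t)) \<le> integral {a..b} (\<lambda>t. B + (e - B) * n t)"
  proof (rule integral_norm_bound_integral)
    fix t assume t: "t \<in> {a..b}"
    show "norm (g t - \<psi> t) \<le> B + (e - B) * n t"
    proof (cases "\<exists>s\<in>S. t \<in> {u s..<u s + h}")
      case True
      then obtain s where s: "s \<in> S" "t \<in> {u s..<u s + h}" by blast
      have eq: "s' \<in> S \<Longrightarrow> t \<in> {u s'..<u s' + h} \<longleftrightarrow> s' = s" for s' using disj s by blast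
      have "g t = (\<Sum>s'\<in>S. if s' = s then \<psi> (u s') else 0)" unfolding g_def using eq by (intro sum.cong) auto
      then have gt: "g t = \<psi> (u s)" using fin s by simp
      have "n t = (\<Sum>s'\<in>S. if s' = s then 1 else 0)" unfolding n_def using eq by (intro sum.cong) auto
      then have nt: "n t = 1" using fin s by simp
      have "\<bar>\<psi> (u s) - \<psi> t\<bar> \<le> e" using s sub[OF s(1)] t h by (intro osc) auto
      then show ?thesis by (simp add: gt nt)
    next
      case False
      then have "g t = 0" "n t = 0" unfolding g_def n_def by (auto intro!: sum.neutral)
      then show ?thesis using bound[OF t] by simp
    qed
  qed (use diff n in \<open>auto simp: integrable_on_def\<close>)
  then show ?thesis using diff n by (simp add: integral_unique algebra_simps)
qed

lemma exists_good_cols: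
  fixes q0 :: nat and e :: real
  assumes "0 < q0" "0 < e"
  obtains Q R0 where "0 < Q" "10 \<le> R0"
    "\<And>R. R0 \<le> R \<Longrightarrow> finite (good_cols R q0 Q)"
    "\<And>R. R0 \<le> R \<Longrightarrow> (sqrt 2 - e) * R \<le> real (card (good_cols R q0 Q)) * fact Q"
    "\<And>R. R0 \<le> R \<Longrightarrow> real (card (good_cols R q0 Q)) * fact Q \<le> 2 * R"
    "\<And>R. R0 \<le> R \<Longrightarrow> 20 * (1 + fact Q)\<^sup>2 * real Q \<le> R"
proof -
  define c where "c = real (q0 * (2 * q0 + 3))"
  \<comment> \<open>\<open>card_good_cols_lower\<close> loses 2 c R / Q to bad slopes; this choice
    makes that at most e R / 2.\<close>
  define Q where "Q = nat \<lceil>4 * c / e\<rceil> + 1"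
  have c: "0 \<le> c" by (simp add: c_def)
  have Q: "0 < Q" "4 * c / e \<le> real Q" by (auto simp: Q_def intro: order.trans[OF real_nat_ceiling_ge])
  define F :: real where "F = fact Q"
  have F: "1 \<le> F" unfolding F_def by (rule fact_ge_1)
  \<comment> \<open>The last entry lets the other half of e R absorb the loss (6 + c) F, which does
    not grow with R; the others are thresholds for the lemmas on blocks.\<close>
  define R0 where "R0 = Max {10, 4 * F, 20 * (1 + F)\<^sup>2 * real Q, 2 * ((6 + c) * F) / e}"
  have R0: "10 \<le> R0" "4 * F \<le> R0" "20 * (1 + F)\<^sup>2 * real Q \<le> R0" "2 * ((6 + c) * F) / e \<le> R0"
    unfolding R0_def by (auto intro: Max_ge)
  have fin: "finite (good_cols R q0 Q)"
    and low: "(sqrt 2 - e) * R \<le> real (card (good_cols R q0 Q)) * fact Q" if "R0 \<le> R" for R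
  proof -
    have "2 * sqrt 2 * F < 4 * F" using sqrt2_bounds F by simp
    then have R1: "2 * sqrt 2 * fact Q < R" using that R0 unfolding F_def by linarith
    show "finite (good_cols R q0 Q)" by (rule card_good_cols_lower(1)[OF assms(1) Q(1) R1])
    have "4 * c \<le> e * real Q" using Q assms(2) by (simp add: field_simps)
    then have "c * (2 * R / Q) \<le> e / 2 * R"
      using Q(1) R0(1) that mult_right_mono[of "4 * c" "e * real Q" R] by (simp add: field_simps)
    moreover have "(6 + c) * F \<le> e / 2 * R"
    proof -
      have "2 * ((6 + c) * F) \<le> e * R0" using R0(4) assms(2) by (simp add: divide_le_eq mult.commute)
      also have "\<dots> \<le> e * R" using that assms(2) by simp
      finally show ?thesis by simp
    qed
    moreover have "sqrt 2 * R - 6 * F - c * (2 * R / Q + F) \<le> real (card (good_cols R q0 Q)) * F"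
      unfolding F_def c_def by (rule card_good_cols_lower(2)[OF assms(1) Q(1) R1])
    ultimately show "(sqrt 2 - e) * R \<le> real (card (good_cols R q0 Q)) * fact Q"
      unfolding F_def[symmetric] distrib_left distrib_right left_diff_distrib by linarith
  qed
  show thesis
  proof (rule that[OF Q(1) R0(1) fin low])
    fix R assume R: "R0 \<le> R"
    then show "20 * (1 + fact Q)\<^sup>2 * real Q \<le> R" using R0(3) unfolding F_def by linarith
    have "0 \<le> 5 * (sqrt 2 * R + 2 - real (card (good_cols R q0 Q)) * fact Q)"
      using R R0 by (intro order.trans[OF _ card_upper_exceptional[OF _ fin]]) auto
    then have "real (card (good_cols R q0 Q)) * fact Q \<le> sqrt 2 * R + 2" by simp
    moreover have "sqrt 2 * R \<le> 3/2 * R" using sqrt2_bounds R R0 by (intro mult_right_mono) auto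
    ultimately show "real (card (good_cols R q0 Q)) * fact Q \<le> 2 * R" using R R0 by linarith
  qed auto
qed

text \<open>A quarter of the unit circle in terms of the abscissa, which is x / R for a block that
  starts at column x. In this coordinate 1 / sqrt (1 - u^2) is the arc-length density;
  \<open>arc_point_good_cols\<close> identifies it with R / \<open>height\<close>.\<close>

definition arc_point :: "real \<Rightarrow> complex" where
  "arc_point u = Complex u (sqrt (1 - u\<^sup>2))"

lemma half_window_sq:
  assumes "u \<in> window"
  shows "1 / 2 \<le> 1 - u\<^sup>2"
proof -
  have "\<bar>u\<bar> \<le> 1 / sqrt 2" using assms by (auto simp: abs_le_iff)
  from power_mono[OF this, of 2] show ?thesis by (simp add: power_divide)
qed

lemma norm_arc_point: "u \<in> window \<Longrightarrow> norm (arc_point u) = 1"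
  using half_window_sq[of u] by (simp add: arc_point_def cmod_def)

lemma continuous_on_arc_point: "continuous_on A arc_point"
  unfolding arc_point_def by (intro continuous_intros)

lemma continuous_on_arc_integral:
  fixes \<Phi> :: "real \<Rightarrow> complex \<Rightarrow> real"
  assumes cont: "continuous_on (window \<times> sphere 0 1) (\<lambda>(r, c). \<Phi> r c)"
  shows "continuous_on window
    (\<lambda>u. integral window (\<lambda>r. \<Phi> r (arc_point u)) / sqrt (1 - u\<^sup>2))"
proof (intro continuous_intros)
  let ?I = "window"
  have "continuous_on (?I \<times> ?I) (\<lambda>p. (\<lambda>(r, c). \<Phi> r c) (snd p, arc_point (fst p)))"
    by (intro continuous_on_compose2[OF cont] continuous_intros
        continuous_on_compose2[OF continuous_on_arc_point[of UNIV]]) (auto simp: norm_arc_point)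
  then have "continuous_on (?I \<times> cbox (-1 / sqrt 2) (1 / sqrt 2)) (\<lambda>(u, r). \<Phi> r (arc_point u))"
    by (simp add: case_prod_unfold)
  then show "continuous_on ?I (\<lambda>u. integral ?I (\<lambda>r. \<Phi> r (arc_point u)))"
    using integral_continuous_on_param[of ?I "-1 / sqrt 2" "1 / sqrt 2" "\<lambda>u r. \<Phi> r (arc_point u)"]
    by simp
  show "\<forall>u\<in>?I. sqrt (1 - u\<^sup>2) \<noteq> 0" using half_window_sq by fastforce
qed

lemma disjoint_col_blocks:
  assumes "z \<in> col_block R H s" "z \<in> col_block R H s'" "0 < H"
  shows "s = s'"
proof -
  obtain m where m: "Re z = of_int m" using assms(1) by (auto simp: col_block_def Gam_def Ints_def)
  have *: "m div H = t" if "z \<in> col_block R H t" for t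
  proof -
    have "H * t \<le> m" "m < H * t + H" using that m by (auto simp: col_block_def simp flip: of_int_mult of_int_add)
    then show ?thesis using assms(3) by (intro int_div_pos_eq[where r = "m - H * t"]) auto
  qed
  then show ?thesis using assms by auto
qed

lemma uniform_modulus:
  fixes \<Phi> :: "real \<Rightarrow> complex \<Rightarrow> real"
  assumes cont: "continuous_on (I \<times> sphere 0 1) (\<lambda>(r, c). \<Phi> r c)" and "compact I" and e: "0 < e"
  obtains \<rho> where "0 < \<rho>" "\<And>r r' c c'. r \<in> I \<Longrightarrow> r' \<in> I \<Longrightarrow> norm c = 1 \<Longrightarrow> norm c' = 1 \<Longrightarrow>
    \<bar>r - r'\<bar> \<le> \<rho> \<Longrightarrow> norm (c - c') \<le> \<rho> \<Longrightarrow> \<bar>\<Phi> r c - \<Phi> r' c'\<bar> \<le> e"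
proof -
  have "uniformly_continuous_on (I \<times> sphere 0 1) (\<lambda>(r, c). \<Phi> r c)"
    using assms by (intro compact_uniformly_continuous compact_Times) auto
  then obtain d where d: "0 < d" "\<And>x x'. x \<in> I \<times> sphere 0 1 \<Longrightarrow> x' \<in> I \<times> sphere 0 1 \<Longrightarrow> dist x' x < d \<Longrightarrow>
    dist (case x' of (r, c) \<Rightarrow> \<Phi> r c) (case x of (r, c) \<Rightarrow> \<Phi> r c) < e"
    using e unfolding uniformly_continuous_on_def by metis
  show thesis
  proof (rule that[of "d / 3"])
    show "0 < d / 3" using d by simp
    fix r r' :: real and c c' :: complex assume *: "r \<in> I" "r' \<in> I" "norm c = 1" "norm c' = 1" "\<bar>r - r'\<bar> \<le> d / 3" "norm (c - c') \<le> d / 3"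
    have "dist (r, c) (r', c') \<le> dist r r' + dist c c'"
      unfolding dist_Pair_Pair by (rule sqrt_sum_squares_le_sum) auto
    also have "\<dots> < d" using * d(1) by (simp add: dist_norm)
    finally show "\<bar>\<Phi> r c - \<Phi> r' c'\<bar> \<le> e"
      using d(2)[of "(r', c')" "(r, c)"] * by (simp add: dist_real_def)
  qed
qed

lemma arc_point_good_cols:
  assumes s: "s \<in> good_cols R q0 Q" and R: "0 < R"
  defines "m \<equiv> real_of_int (fact Q * s)"
  shows "arc_point (m / R) = Complex m (height R m) / R" "R / height R m = 1 / sqrt (1 - (m / R)\<^sup>2)"
    "- 1 / sqrt 2 \<le> m / R" "m / R + fact Q / R \<le> 1 / sqrt 2"
proof -
  have "1 - (m / R)\<^sup>2 = (R\<^sup>2 - m\<^sup>2) / R\<^sup>2" using R by (simp add: field_simps power_divide)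
  then have h: "sqrt (1 - (m / R)\<^sup>2) = height R m / R"
    using R by (simp add: height_def real_sqrt_divide)
  show "arc_point (m / R) = Complex m (height R m) / R"
    unfolding arc_point_def h by (simp add: complex_eq_iff)
  show "R / height R m = 1 / sqrt (1 - (m / R)\<^sup>2)" unfolding h by simp
  have m: "\<bar>m\<bar> \<le> R / sqrt 2 - 2 * fact Q" using good_cols_height(3)[OF s R] by (simp add: m_def)
  have F: "0 \<le> (fact Q :: real)" by simp
  have "m + fact Q \<le> R / sqrt 2" "- (R / sqrt 2) \<le> m" using m F by linarith+
  then have "(m + fact Q) / R \<le> (R / sqrt 2) / R" "- (R / sqrt 2) / R \<le> m / R"
    using R by (intro divide_right_mono; simp)+
  then show "- 1 / sqrt 2 \<le> m / R" "m / R + fact Q / R \<le> 1 / sqrt 2"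
    using R by (auto simp: add_divide_distrib)
qed

text \<open>A block of F columns that starts at x contributes about F \<psi>(x / R), because its
  directions are nearly constant and its radii nearly uniform. After division by R the blocks form a
  Riemann sum with step F / R.\<close>

theorem upper_equidistributed:
  fixes \<Phi> :: "real \<Rightarrow> complex \<Rightarrow> real"
  assumes cont: "continuous_on (window \<times> sphere 0 1) (\<lambda>(r, c). \<Phi> r c)"
  shows "((\<lambda>R. (\<Sum>z\<in>upper R. \<Phi> (norm z - R) (sgn z)) / R) \<longlongrightarrow>
     integral window
       (\<lambda>u. integral window (\<lambda>r. \<Phi> r (arc_point u)) / sqrt (1 - u\<^sup>2))) at_top"
proof -
  define I :: "real set" where "I = window"
  define J where "J u = integral I (\<lambda>r. \<Phi> r (arc_point u))" for u
  define \<psi> where "\<psi> u = J u / sqrt (1 - u\<^sup>2)" for u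
  have \<psi>: "continuous_on I \<psi>" unfolding \<psi>_def J_def I_def by (rule continuous_on_arc_integral[OF cont])
  have cI: "compact I" by (simp add: I_def)
  have "compact ((\<lambda>(r, c). \<Phi> r c) ` (I \<times> sphere 0 1))"
    using cont unfolding I_def by (intro compact_continuous_image compact_Times) auto
  then have "bounded ((\<lambda>(r, c). \<Phi> r c) ` (I \<times> sphere 0 1))" by (rule compact_imp_bounded)
  then obtain B0 where "\<forall>x\<in>(\<lambda>(r, c). \<Phi> r c) ` (I \<times> sphere 0 1). norm x \<le> B0" unfolding bounded_iff by blast
  then have B0: "\<And>r c. r \<in> I \<Longrightarrow> norm c = 1 \<Longrightarrow> \<bar>\<Phi> r c\<bar> \<le> B0" by (auto simp: ball_simps)
  define B where "B = max 1 B0"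
  have B: "1 \<le> B" "\<And>r c. r \<in> I \<Longrightarrow> norm c = 1 \<Longrightarrow> \<bar>\<Phi> r c\<bar> \<le> B" using B0 by (force simp: B_def)+
  have "compact (\<psi> ` I)" using \<psi> cI by (rule compact_continuous_image)
  then have "bounded (\<psi> ` I)" by (rule compact_imp_bounded)
  then obtain B1 where B1: "\<And>u. u \<in> I \<Longrightarrow> \<bar>\<psi> u\<bar> \<le> B1" unfolding bounded_iff by auto
  have B1': "0 \<le> B1" using B1[of 0] by (simp add: I_def)
  \<comment> \<open>Error budget in multiples of \<open>e\<close>: 48 from the blocks, 2 +
    \<open>B1\<close> from the Riemann sum and its gaps, \<open>10 * B\<close> from the points
    outside good blocks; 60 leaves some room.\<close>
  define C where "C = 60 + B1 + 10 * B"
  have "\<forall>\<^sub>F R in at_top. \<bar>(\<Sum>z\<in>upper R. \<Phi> (norm z - R) (sgn z)) / R - integral I \<psi>\<bar> \<le> C * e" if e: "0 < e" "e \<le> 1" for e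
  proof -
    obtain \<rho> where \<rho>: "0 < \<rho>" "\<And>r r' c c'. r \<in> I \<Longrightarrow> r' \<in> I \<Longrightarrow> norm c = 1 \<Longrightarrow> norm c' = 1 \<Longrightarrow>
      \<bar>r - r'\<bar> \<le> \<rho> \<Longrightarrow> norm (c - c') \<le> \<rho> \<Longrightarrow> \<bar>\<Phi> r c - \<Phi> r' c'\<bar> \<le> e"
      using uniform_modulus[OF cont[folded I_def] cI e(1)] by blast
    obtain \<rho>' where \<rho>': "0 < \<rho>'" "\<And>u u'. u \<in> I \<Longrightarrow> u' \<in> I \<Longrightarrow> \<bar>u - u'\<bar> \<le> \<rho>' \<Longrightarrow> \<bar>\<psi> u - \<psi> u'\<bar> \<le> e"
    proof -
      \<comment> \<open>\<open>uniform_modulus\<close> speaks of functions of a radius and a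
        direction, so \<psi> is given a dummy direction.\<close>
      have "continuous_on (I \<times> sphere 0 1) (\<lambda>(r, c :: complex). \<psi> r)"
        unfolding case_prod_unfold by (intro continuous_on_compose2[OF \<psi>] continuous_intros) auto
      from uniform_modulus[OF this cI e(1)] obtain \<rho>' where "0 < \<rho>'"
        "\<And>r r' (c :: complex) c'. r \<in> I \<Longrightarrow> r' \<in> I \<Longrightarrow> norm c = 1 \<Longrightarrow> norm c' = 1 \<Longrightarrow>
          \<bar>r - r'\<bar> \<le> \<rho>' \<Longrightarrow> norm (c - c') \<le> \<rho>' \<Longrightarrow> \<bar>\<psi> r - \<psi> r'\<bar> \<le> e" by blast
      then show thesis using that[of \<rho>'] by (metis diff_self norm_one norm_zero order_less_imp_le)
    qed
    \<comment> \<open>Slices are to be thinner than \<rho>; after that \<open>q0\<close> is taken as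
      large as \<open>col_block_equidistributed\<close> demands.\<close>
    define N where "N = nat \<lceil>sqrt 2 / \<rho>\<rceil> + 1"
    have "sqrt 2 / \<rho> \<le> real N" by (auto simp: N_def intro: order.trans[OF real_nat_ceiling_ge])
    then have "sqrt 2 \<le> \<rho> * real N" using \<rho>(1) by (simp add: pos_divide_le_eq mult.commute)
    moreover have N0: "0 < N" by (simp add: N_def)
    ultimately have N: "0 < N" "sqrt 2 / N \<le> \<rho>" by (simp_all add: pos_divide_le_eq)
    define q0 where "q0 = nat \<lceil>20 * N * B / e\<rceil> + 1"
    have "20 * N * B / e \<le> real q0" by (auto simp: q0_def intro: order.trans[OF real_nat_ceiling_ge])
    then have q0: "0 < q0" "20 * N * B \<le> e * q0" using e by (simp_all add: q0_def pos_divide_le_eq mult.commute)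
    obtain Q R0 where Q: "0 < Q" "10 \<le> R0"
      "\<And>R. R0 \<le> R \<Longrightarrow> finite (good_cols R q0 Q)"
      "\<And>R. R0 \<le> R \<Longrightarrow> (sqrt 2 - e) * R \<le> real (card (good_cols R q0 Q)) * fact Q"
      "\<And>R. R0 \<le> R \<Longrightarrow> real (card (good_cols R q0 Q)) * fact Q \<le> 2 * R"
      "\<And>R. R0 \<le> R \<Longrightarrow> 20 * (1 + fact Q)\<^sup>2 * real Q \<le> R"
      using exists_good_cols[OF q0(1) e(1)] by blast
    define F :: real where "F = fact Q"
    have F: "1 \<le> F" unfolding F_def by (rule fact_ge_1)
    have "\<forall>\<^sub>F R in at_top. R0 \<le> R \<and> (5 * F + 9) / \<rho> \<le> R \<and> F / \<rho>' \<le> R \<and> 2 / e \<le> R"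
      by (intro eventually_conj eventually_ge_at_top)
    then show ?thesis
    proof eventually_elim
      case (elim R)
      have R: "R0 \<le> R" and R10: "10 \<le> R" using elim Q(2) by auto
      have R0: "0 < R" using R10 by simp
      define h where "h = F / R"
      define S where "S = good_cols R q0 Q"
      define x where "x s = real_of_int (fact Q * s)" for s
      define P where "P s = col_block R (fact Q) s" for s
      have small: "(5 * F + 9) / R \<le> \<rho>" "h \<le> \<rho>'" "2 \<le> e * R"
        using elim \<rho>(1) \<rho>'(1) e R0 by (auto simp: h_def field_simps)
      have h0: "0 \<le> h" using F R0 by (simp add: h_def)
      have xI: "x s / R \<in> I" "x s / R + h \<in> I" if "s \<in> S" for s
        using arc_point_good_cols(3,4)[OF that[unfolded S_def] R0] h0
        by (auto simp: I_def x_def h_def F_def)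
      \<comment> \<open>An error \<open>e\<close> per point for freezing the direction and 5 e for
        the radii, on at most 4 F points.\<close>
      have block: "\<bar>(\<Sum>z\<in>P s. \<Phi> (norm z - R) (sgn z)) - F * \<psi> (x s / R)\<bar> \<le> 24 * e * F" if s: "s \<in> S" for s
      proof -
        have s': "s \<in> good_cols R q0 Q" using s by (simp add: S_def)
        let ?c = "arc_point (x s / R)"
        have nc: "norm ?c = 1" using norm_arc_point xI(1)[OF s] by (simp add: I_def)
        have 1: "\<bar>(\<Sum>z\<in>P s. \<Phi> (norm z - R) (sgn z)) - (\<Sum>z\<in>P s. \<Phi> (norm z - R) ?c)\<bar> \<le> e * card (P s)"
        proof -
          have "(\<Sum>z\<in>P s. \<Phi> (norm z - R) (sgn z)) - (\<Sum>z\<in>P s. \<Phi> (norm z - R) ?c)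
            = (\<Sum>z\<in>P s. \<Phi> (norm z - R) (sgn z) - \<Phi> (norm z - R) ?c)" by (simp add: sum_subtractf)
          also have "\<bar>\<dots>\<bar> \<le> (\<Sum>z\<in>P s. e)"
          proof (intro order.trans[OF sum_abs] sum_mono \<rho>(2))
            fix z assume z: "z \<in> P s"
            then show "norm z - R \<in> I" "norm z - R \<in> I"
              using col_block_norm[of z R "fact Q" s] by (auto simp: I_def P_def)
            have "z \<noteq> 0" using z R10 sqrt2_bounds by (auto simp: P_def col_block_def Gam_def)
            then show "norm (sgn z) = 1" by (simp add: norm_sgn)
            show "norm ?c = 1" by (rule nc)
            have "norm (sgn z - ?c) \<le> (5 * F + 9) / R"
              using col_block_near(3)[OF s' R10 z[unfolded P_def]] arc_point_good_cols(1)[OF s' R0]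
              by (simp add: x_def F_def)
            then show "norm (sgn z - ?c) \<le> \<rho>" using small by linarith
          qed (use \<rho>(1) in auto)
          finally show ?thesis by (simp add: mult.commute)
        qed
        have cs: "continuous_on I (\<lambda>r. \<Phi> r ?c)"
        proof -
          have "continuous_on I (\<lambda>r. (\<lambda>(r, c). \<Phi> r c) (r, ?c))"
            by (rule continuous_on_compose2[OF cont[folded I_def]]) (use nc in \<open>auto intro!: continuous_intros\<close>)
          then show ?thesis by simp
        qed
        have 2: "\<bar>(\<Sum>z\<in>P s. \<Phi> (norm z - R) ?c) - J (x s / R) * (fact Q * (R / height R (x s)))\<bar> \<le> 5 * e * card (P s)"
          and cP: "card (P s) \<le> 4 * fact Q"
        proof -
          note * = col_block_equidistributed[OF Q(1) N(1) B(1) e q0(2) s' Q(6)[OF R], folded P_def]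
          show "card (P s) \<le> 4 * fact Q" by (rule *(2))
          show "\<bar>(\<Sum>z\<in>P s. \<Phi> (norm z - R) ?c) - J (x s / R) * (fact Q * (R / height R (x s)))\<bar> \<le> 5 * e * card (P s)"
            unfolding x_def J_def I_def
          proof (rule *(3)[where b = "\<lambda>r. \<Phi> r (arc_point (real_of_int (fact Q * s) / R))", THEN conjunct1])
            show "continuous_on window (\<lambda>r. \<Phi> r (arc_point (real_of_int (fact Q * s) / R)))"
              using cs by (simp add: I_def x_def)
          qed (use B(2) \<rho> nc N(2) in \<open>auto simp: I_def x_def\<close>)
        qed
        have \<Lambda>: "J (x s / R) * (fact Q * (R / height R (x s))) = F * \<psi> (x s / R)"
          using arc_point_good_cols(2)[OF s' R0] by (simp add: \<psi>_def F_def x_def)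
        have "real (card (P s)) \<le> 4 * F" using cP unfolding F_def
          by (metis of_nat_fact of_nat_le_iff of_nat_mult of_nat_numeral)
        then have "6 * e * card (P s) \<le> 6 * e * (4 * F)" using e by (intro mult_left_mono) auto
        then show ?thesis using 1 2 unfolding \<Lambda> by (simp add: algebra_simps)
      qed
      have finS: "finite S" using Q(3)[OF R] by (simp add: S_def)
      have hS: "h * card S = card S * F / R" by (simp add: h_def)
      have cardS: "card S * F \<le> 2 * R" "(sqrt 2 - e) * R \<le> card S * F"
        using Q(4,5)[OF R] by (auto simp: S_def F_def)
      have riem: "\<bar>(\<Sum>s\<in>S. h * \<psi> (x s / R)) - integral I \<psi>\<bar> \<le> e * (h * card S) + B1 * (1 / sqrt 2 - (- 1 / sqrt 2) - h * card S)"
        unfolding I_def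
      proof (rule riemann_sum_gaps)
        show "continuous_on window \<psi>" using \<psi> by (simp add: I_def)
        show "\<And>t. t \<in> window \<Longrightarrow> \<bar>\<psi> t\<bar> \<le> B1" using B1 by (simp add: I_def)
        show "\<And>t t'. t \<in> window \<Longrightarrow> t' \<in> window \<Longrightarrow> \<bar>t - t'\<bar> \<le> h \<Longrightarrow> \<bar>\<psi> t - \<psi> t'\<bar> \<le> e"
          using \<rho>'(2) small(2) by (simp add: I_def)
        show "\<And>s. s \<in> S \<Longrightarrow> - 1 / sqrt 2 \<le> x s / R \<and> x s / R + h \<le> 1 / sqrt 2" using xI by (simp add: I_def)
        fix s s' t assume s: "t \<in> {x s / R..<x s / R + h}" "t \<in> {x s' / R..<x s' / R + h}"
        have *: "\<lfloor>t * R / F\<rfloor> = s" if "t \<in> {x s / R..<x s / R + h}" for s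
        proof -
          have "x s \<le> t * R" "t * R < x s + F" using that R0 by (auto simp: h_def field_simps)
          then have "of_int s \<le> t * R / F" "t * R / F < of_int s + 1"
            using F unfolding x_def F_def by (auto simp: field_simps)
          then show ?thesis by (simp add: floor_eq_iff)
        qed
        show "s = s'" using *[OF s(1)] *[OF s(2)] by simp
      qed (use finS h0 in auto)
      have e1: "\<bar>(\<Sum>s\<in>S. \<Sum>z\<in>P s. \<Phi> (norm z - R) (sgn z)) / R - (\<Sum>s\<in>S. h * \<psi> (x s / R))\<bar> \<le> 48 * e"
      proof -
        have "(\<Sum>s\<in>S. \<Sum>z\<in>P s. \<Phi> (norm z - R) (sgn z)) / R - (\<Sum>s\<in>S. h * \<psi> (x s / R))
          = (\<Sum>s\<in>S. (\<Sum>z\<in>P s. \<Phi> (norm z - R) (sgn z)) - F * \<psi> (x s / R)) / R"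
          by (simp add: sum_subtractf diff_divide_distrib h_def sum_divide_distrib)
        also have "\<bar>\<dots>\<bar> \<le> (\<Sum>s\<in>S. 24 * e * F) / R"
          unfolding abs_divide using R0 block by (simp only: abs_of_pos) (intro divide_right_mono order.trans[OF sum_abs] sum_mono, auto)
        also have "\<dots> = 24 * e * (card S * F / R)" by simp
        also have "\<dots> \<le> 24 * e * 2" using cardS R0 e by (intro mult_left_mono) (auto simp: field_simps)
        finally show ?thesis by simp
      qed
      let ?U = "\<Union>s\<in>S. P s"
      have sub: "?U \<subseteq> upper R" unfolding S_def P_def by (intro UN_least col_block_upper R10)
      have sumU: "(\<Sum>z\<in>?U. \<Phi> (norm z - R) (sgn z)) = (\<Sum>s\<in>S. \<Sum>z\<in>P s. \<Phi> (norm z - R) (sgn z))"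
      proof (intro sum.UNION_disjoint ballI impI finS)
        fix s s' :: int assume "s \<noteq> s'"
        then show "P s \<inter> P s' = {}" using disjoint_col_blocks[of _ R "fact Q" s s'] by (auto simp: P_def)
      qed (auto simp: P_def)
      have split: "(\<Sum>z\<in>upper R. \<Phi> (norm z - R) (sgn z)) =
          (\<Sum>z\<in>upper R - ?U. \<Phi> (norm z - R) (sgn z)) + (\<Sum>s\<in>S. \<Sum>z\<in>P s. \<Phi> (norm z - R) (sgn z))"
        unfolding sumU[symmetric] using sub by (intro sum.subset_diff) auto
      have "\<bar>\<Sum>z\<in>upper R - ?U. \<Phi> (norm z - R) (sgn z)\<bar> \<le> (\<Sum>z\<in>upper R - ?U. B)"
      proof (intro order.trans[OF sum_abs] sum_mono B(2))
        fix z assume z: "z \<in> upper R - ?U"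
        then show "norm z - R \<in> I" by (auto simp: upper_def Gam_def I_def)
        have "z \<noteq> 0" using z R10 sqrt2_bounds by (auto simp: upper_def Gam_def)
        then show "norm (sgn z) = 1" by (simp add: norm_sgn)
      qed
      also have "\<dots> = card (upper R - ?U) * B" by simp
      also have "\<dots> \<le> (5 * (sqrt 2 * R + 2 - card S * F)) * B"
        using card_upper_exceptional[OF R10 Q(3)[OF R]] B(1) unfolding S_def P_def F_def by (intro mult_right_mono) auto
      \<comment> \<open>The good blocks miss at most e R + 2 columns, and 2 \<le> e R.\<close>
      also have "\<dots> \<le> (5 * (2 * (e * R))) * B"
        using cardS small(3) B(1) by (intro mult_right_mono) (auto simp: algebra_simps)
      finally have "\<bar>\<Sum>z\<in>upper R - ?U. \<Phi> (norm z - R) (sgn z)\<bar> / R \<le> (5 * (2 * (e * R))) * B / R"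
        using R0 by (intro divide_right_mono) auto
      then have e2: "\<bar>(\<Sum>z\<in>upper R - ?U. \<Phi> (norm z - R) (sgn z)) / R\<bar> \<le> 10 * B * e"
        using R0 by (simp add: abs_divide mult_ac)
      have "h * card S \<le> 2" "sqrt 2 - e \<le> h * card S"
        using cardS R0 unfolding hS by (auto simp: field_simps)
      moreover have "1 / sqrt 2 - (- 1 / sqrt 2) = sqrt 2" by (simp add: field_simps)
      ultimately have "e * (h * card S) + B1 * (1 / sqrt 2 - (- 1 / sqrt 2) - h * card S) \<le> e * 2 + B1 * e"
        using B1' e by (intro add_mono mult_left_mono) auto
      then have "\<bar>(\<Sum>s\<in>S. h * \<psi> (x s / R)) - integral I \<psi>\<bar> \<le> e * 2 + B1 * e" using riem by linarith
      then have "\<bar>(\<Sum>z\<in>upper R. \<Phi> (norm z - R) (sgn z)) / R - integral I \<psi>\<bar> \<le> 10 * B * e + 48 * e + (e * 2 + B1 * e)"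
        using e1 e2 unfolding split add_divide_distrib by linarith
      also have "\<dots> \<le> C * e" using e by (simp add: C_def algebra_simps)
      finally show ?case .
    qed
  qed note key = this
  have C0: "0 < C" using B(1) B1' by (simp add: C_def)
  show ?thesis unfolding J_def[symmetric, unfolded I_def] \<psi>_def[symmetric] I_def[symmetric] tendsto_iff
  proof (intro allI impI)
    fix \<epsilon> :: real assume \<epsilon>: "0 < \<epsilon>"
    define e where "e = min 1 (\<epsilon> / (2 * C))"
    have e: "0 < e" "e \<le> 1" "C * e \<le> \<epsilon> / 2" using \<epsilon> C0 by (auto simp: e_def min_def field_simps)
    from key[OF e(1,2)]
    show "\<forall>\<^sub>F R in at_top. dist ((\<Sum>z\<in>upper R. \<Phi> (norm z - R) (sgn z)) / R)
      (integral I (\<lambda>u. integral I (\<lambda>r. \<Phi> r (arc_point u)) / sqrt (1 - u\<^sup>2))) < \<epsilon>"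
    proof eventually_elim
      case (elim R)
      then have "\<bar>(\<Sum>z\<in>upper R. \<Phi> (norm z - R) (sgn z)) / R - integral I \<psi>\<bar> < \<epsilon>" using e \<epsilon> by linarith
      then show ?case by (simp add: dist_real_def \<psi>_def[abs_def] J_def)
    qed
  qed
qed

text \<open>In the angle the function has period pi / 2, so the circle integral is four times the
  integral over any interval of that length. On [- pi / 4, pi / 4] the substitution u = sin \<phi>
  cancels the density 1 / sqrt (1 - u^2).\<close>

lemma circle_integral_eq_arc_integral:
  fixes j :: "complex \<Rightarrow> real"
  assumes cont: "continuous_on (sphere 0 1) j" and inv: "\<And>c. j (\<i> * c) = j c"
  shows "integral {0..2 * pi} (\<lambda>\<theta>. j (cis \<theta>)) =
    4 * integral window (\<lambda>u. j (arc_point u) / sqrt (1 - u\<^sup>2))"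
proof -
  define k where "k \<theta> = j (cis \<theta>)" for \<theta>
  define f where "f u = j (arc_point u) / sqrt (1 - u\<^sup>2)" for u
  have ck: "continuous_on A k" for A
    unfolding k_def by (rule continuous_on_compose2[OF cont]) (auto intro!: continuous_intros)
  have int: "k integrable_on {a..b}" for a b
    by (rule integrable_continuous_interval[OF ck])
  have per: "k (\<theta> + pi / 2) = k \<theta>" for \<theta>
  proof -
    have "cis (\<theta> + pi / 2) = \<i> * cis \<theta>" by (simp add: cis_mult[symmetric] mult.commute)
    then show ?thesis by (simp add: k_def inv)
  qed
  have shift: "integral {a + pi / 2..b + pi / 2} k = integral {a..b} k" for a b
    using integral_shift_real_ivl[of "a + pi / 2" "pi / 2" "b + pi / 2" k] by (simp add: per)
  have comb: "integral {a..c} k = integral {a..b} k + integral {b..c} k" if "a \<le> b" "b \<le> c" for a b c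
    using that int by (intro Henstock_Kurzweil_Integration.integral_combine[symmetric])
  define T where "T = integral {0..pi / 2} k"
  have quarter: "integral {pi / 2..pi} k = T" "integral {pi..3 * pi / 2} k = T" "integral {3 * pi / 2..2 * pi} k = T"
    using shift[of 0 "pi / 2"] shift[of "pi / 2" pi] shift[of pi "3 * pi / 2"]
    unfolding T_def by (simp_all add: field_simps)
  have "integral {0..2 * pi} k = integral {0..pi / 2} k + (integral {pi / 2..pi} k +
      (integral {pi..3 * pi / 2} k + integral {3 * pi / 2..2 * pi} k))"
    using comb[of 0 "pi / 2" "2 * pi"] comb[of "pi / 2" pi "2 * pi"] comb[of pi "3 * pi / 2" "2 * pi"] pi_gt_zero
    by simp
  also have "\<dots> = 4 * T"
    using quarter by (simp add: T_def)
  finally have full: "integral {0..2 * pi} k = 4 * T" .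
  have sym: "integral {- (pi / 4)..pi / 4} k = T"
  proof -
    have "integral {- (pi / 4)..pi / 4} k = integral {- (pi / 4)..0} k + integral {0..pi / 4} k"
      by (rule comb) auto
    also have "integral {- (pi / 4)..0} k = integral {pi / 4..pi / 2} k"
      using shift[of "- (pi / 4)" 0] by (simp add: field_simps)
    also have "integral {pi / 4..pi / 2} k + integral {0..pi / 4} k = T"
      unfolding T_def using comb[of 0 "pi / 4" "pi / 2"] by simp
    finally show ?thesis .
  qed
  have cf: "continuous_on window f"
    unfolding f_def
  proof (intro continuous_intros)
    show "continuous_on window (\<lambda>u. j (arc_point u))"
      by (rule continuous_on_compose2[OF cont continuous_on_arc_point]) (auto simp: norm_arc_point)
    show "\<forall>u\<in>window. sqrt (1 - u\<^sup>2) \<noteq> 0" using half_window_sq by fastforce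
  qed
  have sin4: "sin (pi / 4) = 1 / sqrt 2" by (simp add: sin_45 field_simps)
  have "((\<lambda>\<phi>. cos \<phi> *\<^sub>R f (sin \<phi>)) has_integral integral {sin (- (pi / 4))..sin (pi / 4)} f) {- (pi / 4)..pi / 4}"
  proof (rule has_integral_substitution[where c = "-1 / sqrt 2" and d = "1 / sqrt 2"])
    show "sin ` {- (pi / 4)..pi / 4} \<subseteq> window"
    proof (rule image_subsetI)
      fix x :: real assume x: "x \<in> {- (pi / 4)..pi / 4}"
      have "sin (- (pi / 4)) \<le> sin x" "sin x \<le> sin (pi / 4)"
        using x pi_gt_zero by (intro sin_monotone_2pi_le; simp)+
      then show "sin x \<in> window" by (simp add: sin4)
    qed
    show "sin (- (pi / 4)) \<le> sin (pi / 4)" by (simp add: sin4)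
  qed (use cf in \<open>auto intro!: derivative_eq_intros\<close>)
  moreover have "cos \<phi> *\<^sub>R f (sin \<phi>) = k (- \<phi>)" if "\<phi> \<in> {- (pi / 4)..pi / 4}" for \<phi>
  proof -
    have "- (pi / 2) < \<phi>" "\<phi> < pi / 2" using that pi_gt_zero unfolding atLeastAtMost_iff by linarith+
    then have c: "0 < cos \<phi>" by (rule cos_gt_zero_pi)
    have sq: "sqrt (1 - (sin \<phi>)\<^sup>2) = cos \<phi>" using c by (simp add: cos_squared_eq[symmetric])
    \<comment> \<open>\<open>arc_point\<close> measures the angle clockwise from the imaginary axis.
      The factor \<i> is removed by invariance, the sign by reflecting the symmetric
      interval.\<close>
    have "arc_point (sin \<phi>) = \<i> * cis (- \<phi>)" unfolding arc_point_def sq by (simp add: complex_eq_iff)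
    then show ?thesis using c by (simp add: f_def sq inv k_def)
  qed
  ultimately have "((\<lambda>\<phi>. k (- \<phi>)) has_integral integral {sin (- (pi / 4))..sin (pi / 4)} f) {- (pi / 4)..pi / 4}"
    by (rule has_integral_eq[rotated])
  then have "integral {- (pi / 4)..pi / 4} (\<lambda>\<phi>. k (- \<phi>)) = integral window f"
    by (simp add: integral_unique sin4)
  moreover have "integral {- (pi / 4)..pi / 4} (\<lambda>\<phi>. k (- \<phi>)) = integral {- (pi / 4)..pi / 4} k"
    using Henstock_Kurzweil_Integration.integral_reflect_real[of "pi / 4" "- (pi / 4)" k] by simp
  ultimately show ?thesis using full sym unfolding k_def f_def by simp
qed

text \<open>\<open>Gam R\<close> consists of four turned copies of \<open>upper R\<close>; by the
  invariance of \<Phi> they contribute equally, and so do the four quarters of the circle.\<close>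

theorem Gam_equidistributed:
  fixes \<Phi> :: "real \<Rightarrow> complex \<Rightarrow> real"
  assumes cont: "continuous_on (window \<times> sphere 0 1) (\<lambda>(r, c). \<Phi> r c)"
    and inv: "\<And>r c. \<Phi> r (\<i> * c) = \<Phi> r c"
  shows "((\<lambda>R. (\<Sum>z\<in>Gam R. \<Phi> (norm z - R) (sgn z)) / R) \<longlongrightarrow>
     integral {0..2 * pi} (\<lambda>\<theta>. integral window (\<lambda>r. \<Phi> r (cis \<theta>)))) at_top"
proof -
  let ?I = "window"
  have "continuous_on (sphere 0 1 \<times> ?I) (\<lambda>p. (\<lambda>(r, c). \<Phi> r c) (snd p, fst p))"
    by (rule continuous_on_compose2[OF cont]) (auto intro!: continuous_intros)
  then have "continuous_on (sphere 0 1 \<times> cbox (-1 / sqrt 2) (1 / sqrt 2)) (\<lambda>(c, r). \<Phi> r c)"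
    by (simp add: case_prod_unfold)
  then have "continuous_on (sphere 0 1) (\<lambda>c. integral ?I (\<lambda>r. \<Phi> r c))"
    using integral_continuous_on_param[of "sphere 0 1" "-1 / sqrt 2" "1 / sqrt 2" "\<lambda>c r. \<Phi> r c"] by simp
  from circle_integral_eq_arc_integral[OF this]
  have eq: "integral {0..2 * pi} (\<lambda>\<theta>. integral ?I (\<lambda>r. \<Phi> r (cis \<theta>))) =
    4 * integral ?I (\<lambda>u. integral ?I (\<lambda>r. \<Phi> r (arc_point u)) / sqrt (1 - u\<^sup>2))"
    by (simp add: inv)
  have "((\<lambda>R. 4 * ((\<Sum>z\<in>upper R. \<Phi> (norm z - R) (sgn z)) / R)) \<longlongrightarrow>
     integral {0..2 * pi} (\<lambda>\<theta>. integral ?I (\<lambda>r. \<Phi> r (cis \<theta>)))) at_top"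
    unfolding eq by (intro tendsto_intros upper_equidistributed cont)
  moreover have "\<forall>\<^sub>F R in at_top. 4 * ((\<Sum>z\<in>upper R. \<Phi> (norm z - R) (sgn z)) / R) =
      (\<Sum>z\<in>Gam R. \<Phi> (norm z - R) (sgn z)) / R"
    using eventually_ge_at_top[of 1]
  proof eventually_elim
    case (elim R)
    then show ?case
      using sum_Gam_turn[of R "\<lambda>z. \<Phi> (norm z - R) (sgn z)"] by (simp add: norm_mult sgn_ii inv)
  qed
  ultimately show ?thesis by (rule Lim_transform_eventually)
qed

text \<open>Constant test function; the limit is the area of the annulus divided by R.\<close>

lemma card_Gam_asymp: "((\<lambda>R. real (card (Gam R)) / R) \<longlongrightarrow> 2 * pi * sqrt 2) at_top"
proof -
  have "1 / sqrt 2 - - (1 / sqrt 2) = sqrt (2::real)" by (simp add: field_simps)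
  then show ?thesis using Gam_equidistributed[of "\<lambda>_ _. 1"] by (simp add: mult_ac)
qed

section \<open>Windows of consecutive lattice points\<close>

lemma sin_ge_quarter:
  assumes "0 \<le> x" "x \<le> pi / 2"
  shows "x / 4 \<le> sin x"
proof (cases "x \<le> pi / 3")
  case True
  have "sin 0 - 0 / 2 \<le> sin x - x / 2"
  proof (rule DERIV_nonneg_imp_nondecreasing[of 0 x "\<lambda>x. sin x - x / 2"])
    fix t assume t: "0 \<le> t" "t \<le> x"
    have "cos (pi / 3) \<le> cos t" using t True pi_gt_zero by (intro cos_monotone_0_pi_le) auto
    then have "0 \<le> cos t - 1 / 2" by (simp add: cos_60)
    then show "\<exists>y. ((\<lambda>x. sin x - x / 2) has_real_derivative y) (at t) \<and> 0 \<le> y"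
      by (intro exI[of _ "cos t - 1 / 2"]) (auto intro!: derivative_eq_intros)
  qed (use assms in auto)
  then show ?thesis using assms by simp
next
  case False
  have "sin (pi / 3) \<le> sin x" using False assms pi_gt_zero by (intro sin_monotone_2pi_le) auto
  moreover have "1 \<le> sqrt (3::real)" by simp
  then have "1 / 2 \<le> sin (pi / 3)" by (simp add: sin_60)
  ultimately show ?thesis using assms pi_less_4 by linarith
qed

lemma sin_abs_half_le: "sin (\<bar>x\<bar> / 2) \<le> \<bar>sin (x / 2)\<bar>" for x :: real
proof (cases "0 \<le> x")
  case False
  then have "sin (\<bar>x\<bar> / 2) = - sin (x / 2)" by (simp flip: sin_minus)
  then show ?thesis by simp
qed simp

lemma norm_cis_diff: "norm (cis a - cis b) = 2 * \<bar>sin ((a - b) / 2)\<bar>"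
proof -
  have "cis a - cis b = cis b * (cis (a - b) - 1)" by (simp add: right_diff_distrib cis_mult)
  then have "norm (cis a - cis b) = norm (cis (a - b) - 1)" by (simp add: norm_mult)
  then show ?thesis unfolding cis_conv_exp by (simp only: dist_exp_i_1)
qed

lemma norm_cis_diff_le: "norm (cis a - cis b) \<le> \<bar>a - b\<bar>"
  unfolding norm_cis_diff using abs_sin_x_le_abs_x[of "(a - b) / 2"] by simp

lemma sgn_eq_cis_Arg2pi: "z \<noteq> 0 \<Longrightarrow> sgn z = cis (Arg2pi z)"
proof -
  assume "z \<noteq> 0"
  then show ?thesis using Arg2pi_eq[of z] unfolding sgn_eq cis_conv_exp
    by (metis nonzero_mult_div_cancel_left norm_eq_zero of_real_eq_0_iff)
qed

text \<open>Strictly on one side of the real axis, arguments differ by at most pi and do not wrap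
  around, so the chord controls the angle. The constant 4 comes from the crude estimate sin x \<ge>
  x / 4.\<close>

lemma Arg2pi_diff_le:
  assumes "0 < Im z \<and> 0 < Im w \<or> Im z < 0 \<and> Im w < 0"
  shows "\<bar>Arg2pi z - Arg2pi w\<bar> \<le> 4 * norm (sgn z - sgn w)"
proof -
  have nz: "z \<noteq> 0" "w \<noteq> 0" using assms by auto
  have "\<bar>Arg2pi z - Arg2pi w\<bar> \<le> pi"
  proof (cases "0 < Im z")
    case True
    then have "0 < Im w" using assms by auto
    then show ?thesis using True Arg2pi_lt_pi[of z] Arg2pi_lt_pi[of w] by auto
  next
    case False
    then have "Im z < 0" "Im w < 0" using assms by auto
    then have "pi \<le> Arg2pi z" "pi \<le> Arg2pi w" using Arg2pi_le_pi[of z] Arg2pi_le_pi[of w] by auto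
    then show ?thesis using Arg2pi_lt_2pi[of z] Arg2pi_lt_2pi[of w] by linarith
  qed
  then have "\<bar>Arg2pi z - Arg2pi w\<bar> / 2 / 4 \<le> sin (\<bar>Arg2pi z - Arg2pi w\<bar> / 2)"
    by (intro sin_ge_quarter) auto
  also have "\<dots> \<le> \<bar>sin ((Arg2pi z - Arg2pi w) / 2)\<bar>" by (rule sin_abs_half_le)
  finally show ?thesis using norm_cis_diff[of "Arg2pi z" "Arg2pi w"] nz by (simp add: sgn_eq_cis_Arg2pi)
qed

lemma sgn_turn: "sgn (turn k z) = \<i> ^ k * sgn z"
  by (induction k) (simp_all add: turn_Suc sgn_ii, simp add: turn_def)

text \<open>For s \<noteq> 0 both coordinates have constant sign on a block, and turning only
  permutes the coordinates up to sign. Thus no turned block crosses the cut of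
  \<open>Arg2pi\<close>.\<close>

lemma turn_block_Im:
  assumes s: "s \<noteq> 0" and H: "0 < H" and k: "k < 4"
    and z: "z \<in> turn k ` col_block R H s" "w \<in> turn k ` col_block R H s"
  shows "0 < Im z \<and> 0 < Im w \<or> Im z < 0 \<and> Im w < 0"
proof -
  have pos: "0 < Re z" if "z \<in> col_block R H s" "0 < s" for z
    using that H by (auto simp: col_block_def intro: less_le_trans[of 0 "real_of_int H * of_int s"])
  have neg: "Re z < 0" if z: "z \<in> col_block R H s" "s < 0" for z
  proof -
    have "H * s + H \<le> 0" using H that(2) mult_left_mono[of "s + 1" 0 H] by (simp add: algebra_simps)
    then have "real_of_int (H * s + H) \<le> 0" by (simp only: of_int_le_0_iff)
    then show ?thesis using z by (auto simp: col_block_def)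
  qed
  have im: "0 < Im z" if "z \<in> col_block R H s" for z using that by (simp add: col_block_def)
  obtain z' w' where zw: "z = turn k z'" "w = turn k w'" "z' \<in> col_block R H s" "w' \<in> col_block R H s"
    using z by blast
  have "s < 0 \<or> 0 < s" using s by auto
  then show ?thesis
    using less_4_cases[OF k] pos[OF zw(3)] pos[OF zw(4)] neg[OF zw(3)] neg[OF zw(4)] im[OF zw(3)] im[OF zw(4)]
    by (elim disjE) (auto simp: zw(1,2) turn_cases)
qed

lemma turn_block_Arg:
  assumes s: "s \<in> good_cols R q0 Q" and R: "10 \<le> R" and k: "k < 4"
    and z: "z \<in> turn k ` col_block R (fact Q) s" "w \<in> turn k ` col_block R (fact Q) s"
  shows "\<bar>Arg2pi z - Arg2pi w\<bar> \<le> 8 * (5 * fact Q + 9) / R"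
proof -
  obtain z' w' where zw: "z = turn k z'" "w = turn k w'" "z' \<in> col_block R (fact Q) s" "w' \<in> col_block R (fact Q) s"
    using z by blast
  have "norm (sgn z - sgn w) = norm (sgn z' - sgn w')"
    unfolding zw(1,2) sgn_turn right_diff_distrib[symmetric] by (simp add: norm_mult norm_power)
  also have "\<dots> \<le> (5 * fact Q + 9) / R + (5 * fact Q + 9) / R"
    using dist_triangle2[of "sgn z'" "sgn w'"] add_mono[OF col_block_near(3)[OF s R zw(3)] col_block_near(3)[OF s R zw(4)]]
    unfolding dist_norm by (rule order.trans)
  finally have "norm (sgn z - sgn w) \<le> 2 * ((5 * fact Q + 9) / R)" by linarith
  moreover have "\<bar>Arg2pi z - Arg2pi w\<bar> \<le> 4 * norm (sgn z - sgn w)"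
    using s by (intro Arg2pi_diff_le turn_block_Im[OF _ _ k z]) (auto simp: good_cols_def)
  ultimately show ?thesis unfolding times_divide_eq_right[symmetric] by linarith
qed

lemma card_Gam_near:
  assumes "0 \<le> \<rho>"
  shows "real (card {z \<in> Gam R. norm (z - z0) \<le> \<rho>}) \<le> (2 * \<rho> + 1)\<^sup>2"
proof -
  define X where "X = {a :: int. \<bar>of_int a - Re z0\<bar> \<le> \<rho>}"
  define Y where "Y = {b :: int. \<bar>of_int b - Im z0\<bar> \<le> \<rho>}"
  have X: "finite X" "real (card X) \<le> (Re z0 + \<rho>) - (Re z0 - \<rho>) + 1"
    by (rule card_int_interval_upper[of X "Re z0 - \<rho>" "Re z0 + \<rho>"]; use assms in \<open>auto simp: X_def abs_le_iff\<close>)+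
  have Y: "finite Y" "real (card Y) \<le> (Im z0 + \<rho>) - (Im z0 - \<rho>) + 1"
    by (rule card_int_interval_upper[of Y "Im z0 - \<rho>" "Im z0 + \<rho>"]; use assms in \<open>auto simp: Y_def abs_le_iff\<close>)+
  have "{z \<in> Gam R. norm (z - z0) \<le> \<rho>} \<subseteq> (\<lambda>(a, b). Complex (of_int a) (of_int b)) ` (X \<times> Y)"
  proof
    fix z assume z: "z \<in> {z \<in> Gam R. norm (z - z0) \<le> \<rho>}"
    then obtain a b where ab: "Re z = of_int a" "Im z = of_int b" by (auto simp: Gam_def Ints_def)
    have "a \<in> X" "b \<in> Y"
      using z abs_Re_le_cmod[of "z - z0"] abs_Im_le_cmod[of "z - z0"] ab by (auto simp: X_def Y_def)
    moreover have "z = Complex (of_int a) (of_int b)" using ab by (simp add: complex_eq_iff)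
    ultimately show "z \<in> (\<lambda>(a, b). Complex (of_int a) (of_int b)) ` (X \<times> Y)" by force
  qed
  then have "card {z \<in> Gam R. norm (z - z0) \<le> \<rho>} \<le> card (X \<times> Y)"
    using X Y by (meson card_image_le card_mono finite_SigmaI finite_imageI le_trans)
  then have "real (card {z \<in> Gam R. norm (z - z0) \<le> \<rho>}) \<le> real (card X) * real (card Y)"
    unfolding card_cartesian_product of_nat_mult[symmetric] of_nat_le_iff .
  also have "\<dots> \<le> (2 * \<rho> + 1) * (2 * \<rho> + 1)" using X Y assms by (intro mult_mono) auto
  finally show ?thesis by (simp add: power2_eq_square)
qed

text \<open>A sector of angle \<delta> / R meets the annulus in a set of bounded diameter. This will
  bound the points near the two ends of a window.\<close>

lemma card_Gam_Arg_near:
  assumes R: "10 \<le> R" and z0: "z0 \<in> Gam R" and \<delta>: "0 \<le> \<delta>"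
  shows "real (card {z \<in> Gam R. \<bar>Arg2pi z - Arg2pi z0\<bar> \<le> \<delta> / R}) \<le> (2 * (2 + 2 * \<delta>) + 1)\<^sup>2"
proof -
  have "{z \<in> Gam R. \<bar>Arg2pi z - Arg2pi z0\<bar> \<le> \<delta> / R} \<subseteq> {z \<in> Gam R. norm (z - z0) \<le> 2 + 2 * \<delta>}"
  proof (intro subsetI CollectI conjI; (elim CollectE conjE)?)
    fix z assume z: "z \<in> Gam R" "\<bar>Arg2pi z - Arg2pi z0\<bar> \<le> \<delta> / R"
    have nz: "z \<noteq> 0" "z0 \<noteq> 0" using z z0 R sqrt2_bounds by (auto simp: Gam_def)
    have "z - z0 = sgn z * of_real (norm z - norm z0) + of_real (norm z0) * (sgn z - sgn z0)"
      using nz by (simp add: sgn_eq field_simps)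
    also have "norm \<dots> \<le> norm (sgn z * of_real (norm z - norm z0)) + norm (of_real (norm z0) * (sgn z - sgn z0))"
      by (rule norm_triangle_ineq)
    also have "norm (sgn z * of_real (norm z - norm z0)) = \<bar>norm z - norm z0\<bar>"
      using nz by (simp add: norm_mult norm_sgn del: of_real_diff)
    also have "\<dots> \<le> 2" using z z0 sqrt2_bounds by (auto simp: Gam_def)
    also have "norm (of_real (norm z0) * (sgn z - sgn z0)) = norm z0 * norm (cis (Arg2pi z) - cis (Arg2pi z0))"
      using nz by (simp add: norm_mult sgn_eq_cis_Arg2pi)
    also have "\<dots> \<le> (2 * R) * (\<delta> / R)"
      using z0 R sqrt2_bounds z(2) norm_cis_diff_le[of "Arg2pi z" "Arg2pi z0"] by (intro mult_mono) (auto simp: Gam_def)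
    finally show "norm (z - z0) \<le> 2 + 2 * \<delta>" using R by simp
  qed auto
  then have "card {z \<in> Gam R. \<bar>Arg2pi z - Arg2pi z0\<bar> \<le> \<delta> / R} \<le> card {z \<in> Gam R. norm (z - z0) \<le> 2 + 2 * \<delta>}"
    by (intro card_mono) auto
  also have "real \<dots> \<le> (2 * (2 + 2 * \<delta>) + 1)\<^sup>2" using \<delta> by (intro card_Gam_near) auto
  finally show ?thesis by simp
qed

text \<open>A point of the window lies in a block inside the window, or in no block, or in a block
  that also has a point outside. In the last case monotonicity of \<theta> puts the argument of an
  end of the window between those of two points of the block, so the point is within
  \<open>d\<close> of that end; at most 2 D points are of this kind.\<close>

lemma window_sum_bound:
  fixes l :: "int \<Rightarrow> 'z" and \<theta> :: "'z \<Rightarrow> real" and P :: "'i \<Rightarrow> 'z set" and b :: "'z \<Rightarrow> real"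
    and d D e B :: real
  assumes bij: "bij_betw l {1..m} \<Gamma>" and mono: "mono_on {1..m} (\<lambda>j. \<theta> (l j))"
    and A: "finite A" "\<And>a. a \<in> A \<Longrightarrow> P a \<subseteq> \<Gamma>"
    and disj: "\<And>a a' z. a \<in> A \<Longrightarrow> a' \<in> A \<Longrightarrow> z \<in> P a \<Longrightarrow> z \<in> P a' \<Longrightarrow> a = a'"
    and diam: "\<And>a z z'. a \<in> A \<Longrightarrow> z \<in> P a \<Longrightarrow> z' \<in> P a \<Longrightarrow> \<bar>\<theta> z - \<theta> z'\<bar> \<le> d"
    and near: "\<And>z0. z0 \<in> \<Gamma> \<Longrightarrow> real (card {z \<in> \<Gamma>. \<bar>\<theta> z - \<theta> z0\<bar> \<le> d}) \<le> D"
    and b: "\<And>z. z \<in> \<Gamma> \<Longrightarrow> \<bar>b z\<bar> \<le> B" "\<And>a. a \<in> A \<Longrightarrow> \<bar>\<Sum>z\<in>P a. b z\<bar> \<le> e * card (P a)"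
    and e: "0 \<le> e" and B: "0 \<le> B" and D: "0 \<le> D"
    and W: "1 \<le> i" "i + int n \<le> m + 1"
  shows "\<bar>\<Sum>k\<in>{i..<i + int n}. b (l k)\<bar>
    \<le> e * n + B * (card {k \<in> {i..<i + int n}. l k \<notin> (\<Union>a\<in>A. P a)} + 2 * D)"
proof (cases "n = 0")
  case True
  then show ?thesis using B D by simp
next
  case False
  define W where "W = {i..<i + int n}"
  have Wm: "W \<subseteq> {1..m}" using assms by (auto simp: W_def)
  have inj: "inj_on l {1..m}" and im: "l ` {1..m} = \<Gamma>" using bij by (auto simp: bij_betw_def)
  have injW: "inj_on l W" using inj Wm by (rule inj_on_subset)
  have fin\<Gamma>: "finite \<Gamma>" using im by (metis finite_atLeastAtMost_int finite_imageI)
  define T where "T = l ` W"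
  have T\<Gamma>: "T \<subseteq> \<Gamma>" using Wm im by (auto simp: T_def)
  have finT: "finite T" using T\<Gamma> fin\<Gamma> by (rule finite_subset)
  have cardT: "card T = n" using injW by (simp add: T_def card_image W_def)
  define In where "In = {a \<in> A. P a \<subseteq> T}"
  define Ex where "Ex = {z \<in> T. z \<notin> (\<Union>a\<in>A. P a)}"
  define U where "U = (\<Union>a\<in>In. P a)"
  define Bd where "Bd = T - Ex - U"
  have finP: "finite (P a)" if "a \<in> A" for a using A(2)[OF that] fin\<Gamma> by (rule finite_subset)
  have UT: "U \<subseteq> T" by (auto simp: U_def In_def)
  have finIn: "finite In" using A(1) by (simp add: In_def)
  have i_in: "i \<in> {1..m}" "i + int n - 1 \<in> {1..m}" using W False by auto
  let ?N = "\<lambda>z0. {z \<in> \<Gamma>. \<bar>\<theta> z - \<theta> z0\<bar> \<le> d}"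
  have Bd_sub: "Bd \<subseteq> ?N (l i) \<union> ?N (l (i + int n - 1))"
  proof
    fix z assume z: "z \<in> Bd"
    then obtain k where k: "k \<in> W" "z = l k" by (auto simp: Bd_def T_def)
    obtain a where a: "a \<in> A" "z \<in> P a" using z by (auto simp: Bd_def Ex_def)
    then have "\<not> P a \<subseteq> T" using z by (auto simp: Bd_def U_def In_def)
    then obtain z' where z': "z' \<in> P a" "z' \<notin> T" by blast
    then have "z' \<in> \<Gamma>" using A(2)[OF a(1)] by blast
    then obtain k' where k': "k' \<in> {1..m}" "z' = l k'" using im by blast
    have km: "k \<in> {1..m}" using k Wm by blast
    have "k' \<notin> W" using z'(2) k'(2) by (auto simp: T_def)
    then consider "k' < i" | "i + int n - 1 < k'" by (auto simp: W_def)
    then show "z \<in> ?N (l i) \<union> ?N (l (i + int n - 1))"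
    proof cases
      case 1
      have "\<theta> (l k') \<le> \<theta> (l i)" "\<theta> (l i) \<le> \<theta> (l k)"
        using 1 k km k' i_in by (auto intro!: mono_onD[OF mono] simp: W_def)
      then have "\<bar>\<theta> z - \<theta> (l i)\<bar> \<le> d" using diam[OF a(1,2) z'(1)] k k' by auto
      then show ?thesis using k km im by blast
    next
      case 2
      have "\<theta> (l k) \<le> \<theta> (l (i + int n - 1))" "\<theta> (l (i + int n - 1)) \<le> \<theta> (l k')"
        using 2 k km k' i_in by (auto intro!: mono_onD[OF mono] simp: W_def)
      then have "\<bar>\<theta> z - \<theta> (l (i + int n - 1))\<bar> \<le> d" using diam[OF a(1,2) z'(1)] k k' by auto
      then show ?thesis using k km im by blast
    qed
  qed
  have "card Bd \<le> card (?N (l i) \<union> ?N (l (i + int n - 1)))"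
    using Bd_sub fin\<Gamma> by (intro card_mono) auto
  also have "\<dots> \<le> card (?N (l i)) + card (?N (l (i + int n - 1)))" by (rule card_Un_le)
  finally have "real (card Bd) \<le> real (card (?N (l i))) + real (card (?N (l (i + int n - 1))))" by linarith
  also have "\<dots> \<le> D + D" using i_in im by (intro add_mono near) auto
  finally have cardBd: "real (card Bd) \<le> 2 * D" by simp
  have cardEx: "card Ex = card {k \<in> W. l k \<notin> (\<Union>a\<in>A. P a)}"
  proof -
    have "Ex = l ` {k \<in> W. l k \<notin> (\<Union>a\<in>A. P a)}" by (auto simp: Ex_def T_def)
    then show ?thesis using injW by (simp add: card_image inj_on_subset)
  qed
  have "(\<Sum>k\<in>W. b (l k)) = (\<Sum>z\<in>T. b z)" unfolding T_def using injW by (simp add: sum.reindex)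
  also have "\<dots> = (\<Sum>z\<in>T - Ex. b z) + (\<Sum>z\<in>Ex. b z)"
    using finT by (intro sum.subset_diff) (auto simp: Ex_def)
  also have "(\<Sum>z\<in>T - Ex. b z) = (\<Sum>z\<in>Bd. b z) + (\<Sum>z\<in>U. b z)"
    unfolding Bd_def using finT UT by (intro sum.subset_diff) (auto simp: Ex_def U_def In_def)
  also have "(\<Sum>z\<in>U. b z) = (\<Sum>a\<in>In. \<Sum>z\<in>P a. b z)"
    unfolding U_def using finIn finP disj by (intro sum.UNION_disjoint) (auto simp: In_def)
  finally have "\<bar>\<Sum>k\<in>W. b (l k)\<bar> \<le> \<bar>\<Sum>z\<in>Bd. b z\<bar> + \<bar>\<Sum>a\<in>In. \<Sum>z\<in>P a. b z\<bar> + \<bar>\<Sum>z\<in>Ex. b z\<bar>" by linarith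
  also have "\<bar>\<Sum>z\<in>Bd. b z\<bar> \<le> (\<Sum>z\<in>Bd. B)"
    using T\<Gamma> b(1) by (intro order.trans[OF sum_abs] sum_mono) (auto simp: Bd_def)
  also have "\<dots> \<le> B * (2 * D)" using mult_left_mono[OF cardBd B] by (simp add: mult_ac)
  also have "\<bar>\<Sum>z\<in>Ex. b z\<bar> \<le> (\<Sum>z\<in>Ex. B)"
    using T\<Gamma> b(1) by (intro order.trans[OF sum_abs] sum_mono) (auto simp: Ex_def)
  also have "\<bar>\<Sum>a\<in>In. \<Sum>z\<in>P a. b z\<bar> \<le> (\<Sum>a\<in>In. e * card (P a))"
    by (rule order.trans[OF sum_abs], rule sum_mono) (use b(2) in \<open>auto simp: In_def\<close>)
  also have "(\<Sum>a\<in>In. e * card (P a)) = e * real (card U)"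
    unfolding U_def using finIn finP disj
    by (subst card_UN_disjoint) (auto simp: In_def sum_distrib_left)
  also have "\<dots> \<le> e * n" using card_mono[OF finT UT] cardT e by (intro mult_left_mono) auto
  finally show ?thesis unfolding W_def[symmetric] cardEx[symmetric] by (simp add: algebra_simps)
qed


text \<open>\<open>R0\<close>, \<open>D\<close> and \<open>E\<close> are obtained before the test
  function \<open>b\<close>, about which only the bound \<open>B\<close> and the oscillation
  \<open>e\<close> at scale sqrt 2 / N are prescribed. This uniformity is essential, as
  \<open>b\<close> will depend on the first point of the pair.\<close>

theorem windows_equidistributed:
  fixes e B :: real and N :: nat
  assumes e: "0 < e" "e \<le> 1" and B: "1 \<le> B" and N: "0 < N"
  obtains R0 D :: real and E where "10 \<le> R0" "0 \<le> D"
    "\<And>R. R0 \<le> R \<Longrightarrow> E R \<subseteq> Gam R" "\<And>R. R0 \<le> R \<Longrightarrow> real (card (E R)) \<le> 40 * e * R"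
    "\<And>R l i n b. \<lbrakk>R0 \<le> R; arg_enum R l; 1 \<le> i; i + int n \<le> K R + 1;
       continuous_on window b;
       \<And>t. t \<in> window \<Longrightarrow> \<bar>b t\<bar> \<le> B;
       \<And>t t'. t \<in> window \<Longrightarrow> t' \<in> window \<Longrightarrow>
         \<bar>t - t'\<bar> \<le> sqrt 2 / N \<Longrightarrow> \<bar>b t - b t'\<bar> \<le> e\<rbrakk> \<Longrightarrow>
       \<bar>\<Sum>k\<in>{i..<i + int n}. b (norm (l k) - R) - integral window b / sqrt 2\<bar>
       \<le> 6 * e * n + 2 * B * (card {k \<in> {i..<i + int n}. l k \<in> E R} + D)"
proof -
  define q0 where "q0 = nat \<lceil>20 * N * B / e\<rceil> + 1"
  have "20 * N * B / e \<le> real q0" by (auto simp: q0_def intro: order.trans[OF real_nat_ceiling_ge])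
  then have q0: "0 < q0" "20 * N * B \<le> e * q0" using e by (simp_all add: q0_def pos_divide_le_eq mult.commute)
  obtain Q R0 where Q: "0 < Q" "10 \<le> R0"
    "\<And>R. R0 \<le> R \<Longrightarrow> finite (good_cols R q0 Q)"
    "\<And>R. R0 \<le> R \<Longrightarrow> (sqrt 2 - e) * R \<le> real (card (good_cols R q0 Q)) * fact Q"
    "\<And>R. R0 \<le> R \<Longrightarrow> real (card (good_cols R q0 Q)) * fact Q \<le> 2 * R"
    "\<And>R. R0 \<le> R \<Longrightarrow> 20 * (1 + fact Q)\<^sup>2 * real Q \<le> R"
    using exists_good_cols[OF q0(1) e(1)] by blast
  \<comment> \<open>A block of the full annulus is indexed by a number of quarter turns and a column
    block of \<open>upper R\<close>.\<close>
  define A where "A R = {..<4::nat} \<times> good_cols R q0 Q" for R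
  define P where "P R a = turn (fst a) ` col_block R (fact Q) (snd a)" for R and a :: "nat \<times> int"
  define E where "E R = Gam R - (\<Union>a\<in>A R. P R a)" for R
  define \<delta> :: real where "\<delta> = 8 * (5 * fact Q + 9)"
  define D where "D = (2 * (2 + 2 * \<delta>) + 1)\<^sup>2"
  have \<delta>0: "0 \<le> \<delta>" by (simp add: \<delta>_def)
  have D0: "0 \<le> D" by (simp add: D_def)
  show thesis
  proof (rule that[of "max R0 (2 / e)" "2 * D" E])
    show "10 \<le> max R0 (2 / e)" using Q(2) by simp
    show "0 \<le> 2 * D" using D0 by simp
    show "\<And>R. E R \<subseteq> Gam R" by (auto simp: E_def)
  next
    fix R assume "max R0 (2 / e) \<le> R"
    then have R: "R0 \<le> R" "10 \<le> R" "2 / e \<le> R" using Q(2) by auto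
    have eR: "2 \<le> e * R" using R(3) e by (simp add: pos_divide_le_eq mult.commute)
    let ?X = "upper R - (\<Union>s\<in>good_cols R q0 Q. col_block R (fact Q) s)"
    have "E R \<subseteq> (\<Union>k<4. turn k ` ?X)"
    proof
      fix z assume z: "z \<in> E R"
      then obtain k u where ku: "k < 4" "u \<in> upper R" "z = turn k u"
        using Gam_eq_turn_upper[of R] R by (auto simp: E_def)
      have "u \<notin> col_block R (fact Q) s" if "s \<in> good_cols R q0 Q" for s
        using z ku that by (force simp: E_def A_def P_def)
      then show "z \<in> (\<Union>k<4. turn k ` ?X)" using ku by blast
    qed
    then have "card (E R) \<le> card (\<Union>k<4. turn k ` ?X)" by (intro card_mono) auto
    also have "\<dots> \<le> (\<Sum>k<4. card (turn k ` ?X))" by (rule card_UN_le) simp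
    also have "\<dots> = 4 * card ?X" by (simp add: card_image[OF inj_turn])
    finally have "real (card (E R)) \<le> 4 * real (card ?X)" by linarith
    also have "\<dots> \<le> 4 * (5 * (sqrt 2 * R + 2 - real (card (good_cols R q0 Q)) * fact Q))"
      using card_upper_exceptional[OF R(2) Q(3)[OF R(1)]] by simp
    \<comment> \<open>Four quarters with at most 5 (e R + 2) exceptional points each, and 2 \<le> e
      R.\<close>
    also have "\<dots> \<le> 40 * e * R" using Q(4)[OF R(1)] eR unfolding left_diff_distrib by simp
    finally show "real (card (E R)) \<le> 40 * e * R" .
  next
    fix R l i n b
    assume R: "max R0 (2 / e) \<le> R" and l: "arg_enum R l" and i: "1 \<le> i" "i + int n \<le> K R + 1"
      and b: "continuous_on window b"
       "\<And>t. t \<in> window \<Longrightarrow> \<bar>b t\<bar> \<le> B"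
       "\<And>t t'. t \<in> window \<Longrightarrow> t' \<in> window \<Longrightarrow>
         \<bar>t - t'\<bar> \<le> sqrt 2 / N \<Longrightarrow> \<bar>b t - b t'\<bar> \<le> e"
    have R: "R0 \<le> R" "10 \<le> R" using R Q(2) by auto
    have bij: "bij_betw l {1..K R} (Gam R)" and mono: "mono_on {1..K R} (\<lambda>j. Arg2pi (l j))"
      using l by (auto simp: arg_enum_def)
    define c where "c = integral window b / sqrt 2"
    have c: "\<bar>c\<bar> \<le> B"
    proof -
      have "norm (integral window b) \<le> B * (1 / sqrt 2 - - 1 / sqrt 2)"
        using b(1,2) by (intro integral_bound) auto
      also have "1 / sqrt 2 - - 1 / sqrt 2 = sqrt 2" by (simp add: field_simps)
      finally show ?thesis unfolding c_def by (simp add: abs_divide divide_le_eq)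
    qed
    have bc: "\<bar>b (norm z - R) - c\<bar> \<le> 2 * B" if "z \<in> Gam R" for z
      using b(2)[of "norm z - R"] c that by (auto simp: Gam_def)
    have up: "P R a \<subseteq> turn (fst a) ` upper R" if "a \<in> A R" for a
      using that R unfolding P_def A_def by (intro image_mono col_block_upper) auto
    have "\<bar>\<Sum>k\<in>{i..<i + int n}. b (norm (l k) - R) - c\<bar>
      \<le> (6 * e) * n + (2 * B) * (card {k \<in> {i..<i + int n}. l k \<notin> (\<Union>a\<in>A R. P R a)} + 2 * D)"
    proof (rule window_sum_bound[OF bij mono, where d = "\<delta> / R"])
      show "finite (A R)" using Q(3)[OF R(1)] by (simp add: A_def)
      show "\<And>a. a \<in> A R \<Longrightarrow> P R a \<subseteq> Gam R"
        by (auto simp: P_def turn_Gam col_block_def)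
      show "a = a'" if a: "a \<in> A R" "a' \<in> A R" and z: "z \<in> P R a" "z \<in> P R a'" for a a' z
      proof -
        have k: "fst a = fst a'"
          using a up[OF a(1)] up[OF a(2)] z by (intro turn_upper_disjoint[of _ _ z R]) (auto simp: A_def)
        obtain u where u: "z = turn (fst a) u" "u \<in> col_block R (fact Q) (snd a)"
          using z(1) by (auto simp: P_def)
        obtain u' where u': "z = turn (fst a) u'" "u' \<in> col_block R (fact Q) (snd a')"
          using z(2) k by (auto simp: P_def)
        have "u = u'" using inj_turn[of "fst a" UNIV] u(1) u'(1) by (auto dest: injD)
        then show ?thesis using disjoint_col_blocks[of u R "fact Q" "snd a" "snd a'"] u u' k by (simp add: prod_eq_iff)
      qed
      show "\<bar>Arg2pi z - Arg2pi z'\<bar> \<le> \<delta> / R" if "a \<in> A R" "z \<in> P R a" "z' \<in> P R a" for a z z'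
        using turn_block_Arg[of "snd a" R q0 Q "fst a" z z'] that R by (auto simp: A_def P_def \<delta>_def)
      show "real (card {z \<in> Gam R. \<bar>Arg2pi z - Arg2pi z0\<bar> \<le> \<delta> / R}) \<le> D" if "z0 \<in> Gam R" for z0
        unfolding D_def by (rule card_Gam_Arg_near[OF R(2) that \<delta>0])
      show "\<bar>\<Sum>z\<in>P R a. b (norm z - R) - c\<bar> \<le> 6 * e * card (P R a)" if a: "a \<in> A R" for a
      proof -
        have s: "snd a \<in> good_cols R q0 Q" using a by (auto simp: A_def)
        have "\<bar>\<Sum>z\<in>col_block R (fact Q) (snd a). b (norm z - R) - c\<bar> \<le> 6 * e * card (col_block R (fact Q) (snd a))"
          unfolding c_def
          using col_block_equidistributed(3)[OF Q(1) N B e q0(2) s Q(6)[OF R(1)], of b, THEN conjunct2] b by blast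
        then show ?thesis unfolding P_def by (simp add: sum.reindex[OF inj_turn] card_image[OF inj_turn])
      qed
    qed (use bc e B D0 i in auto)
    moreover have "{k \<in> {i..<i + int n}. l k \<notin> (\<Union>a\<in>A R. P R a)} = {k \<in> {i..<i + int n}. l k \<in> E R}"
    proof -
      have "l k \<in> Gam R" if "k \<in> {i..<i + int n}" for k using that i bij by (auto simp: bij_betw_def)
      then show ?thesis by (auto simp: E_def)
    qed
    ultimately show "\<bar>\<Sum>k\<in>{i..<i + int n}. b (norm (l k) - R) - integral window b / sqrt 2\<bar>
       \<le> 6 * e * n + 2 * B * (card {k \<in> {i..<i + int n}. l k \<in> E R} + 2 * D)"
      by (simp add: c_def)
  qed
qed

section \<open>Convergence of the pair law\<close>

lemma continuous_on_halfarea: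
  fixes g :: "'a::metric_space \<Rightarrow> real" and c :: "'a \<Rightarrow> complex"
  assumes g: "continuous_on A g" and c: "continuous_on A c" and norm: "\<And>x. x \<in> A \<Longrightarrow> norm (c x) = 1"
  shows "continuous_on A (\<lambda>x. halfarea (g x) (c x))"
  unfolding continuous_on_def
proof
  fix x assume x: "x \<in> A"
  have g': "(g \<longlongrightarrow> g x) (at x within A)" and c': "(c \<longlongrightarrow> c x) (at x within A)"
    using g c x by (auto simp: continuous_on_def)
  have "((\<lambda>y. 4 * (\<bar>g x - g y\<bar> + norm (c x - c y))) \<longlongrightarrow> 4 * (\<bar>g x - g x\<bar> + norm (c x - c x))) (at x within A)"
    by (intro tendsto_intros g' c')
  then have lim: "((\<lambda>y. 4 * (\<bar>g x - g y\<bar> + norm (c x - c y))) \<longlongrightarrow> 0) (at x within A)" by simp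
  have "((\<lambda>y. halfarea (g y) (c y) - halfarea (g x) (c x)) \<longlongrightarrow> 0) (at x within A)"
  proof (rule Lim_null_comparison[OF _ lim])
    show "\<forall>\<^sub>F y in at x within A. norm (halfarea (g y) (c y) - halfarea (g x) (c x)) \<le> 4 * (\<bar>g x - g y\<bar> + norm (c x - c y))"
    proof (intro always_eventually allI)
      fix y
      show "norm (halfarea (g y) (c y) - halfarea (g x) (c x)) \<le> 4 * (\<bar>g x - g y\<bar> + norm (c x - c y))"
        using halfarea_lipschitz[OF norm[OF x], of "g x" "g y" "c y"]
        by (simp only: real_norm_def abs_minus_commute[of "halfarea (g y) (c y)"])
    qed
  qed
  then show "((\<lambda>y. halfarea (g y) (c y)) \<longlongrightarrow> halfarea (g x) (c x)) (at x within A)"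
    by (simp add: Lim_null[symmetric])
qed

lemma emeasure_lborel_Times:
  fixes A :: "'a::euclidean_space set" and B :: "'b::euclidean_space set"
  assumes "A \<in> sets borel" "B \<in> sets borel"
  shows "emeasure lborel (A \<times> B) = emeasure lborel A * emeasure lborel B"
  using lborel.emeasure_pair_measure_Times[of A lborel B] assms by (simp add: lborel_prod)

text \<open>The angle is moved outermost to match \<open>Gam_equidistributed\<close>; 4 pi is the
  volume sqrt 2 * 2 pi * sqrt 2 of the parameter box.\<close>

lemma integral_limit_law:
  fixes f :: "real \<times> real \<Rightarrow> real"
  assumes f: "continuous_on UNIV f"
  defines "w \<equiv> 1 / sqrt (2::real)"
  shows "integral\<^sup>L limit_law f =
    integral {0..2 * pi} (\<lambda>\<theta>. integral {-w..w} (\<lambda>r. integral {-w..w}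
      (\<lambda>r'. f (halfarea r (cis \<theta>), halfarea r' (cis \<theta>))))) / (4 * pi)"
proof -
  define h where "h = (\<lambda>x :: real \<times> real \<times> real. f (halfarea (fst x) (cis (fst (snd x))), halfarea (snd (snd x)) (cis (fst (snd x)))))"
  define A where "A = {-w..w} \<times> {0..<2 * pi} \<times> {-w..w}"
  define A' where "A' = cbox (-w, 0, -w) (w, 2 * pi, w)"
  have w0: "0 < w" by (simp add: w_def)
  have w2: "w + w = sqrt 2" by (simp add: w_def field_simps)
  have ch: "continuous_on X h" for X
    unfolding h_def
    by (intro continuous_on_compose2[OF f] continuous_intros continuous_on_halfarea) auto
  have meas: "(\<lambda>(r, \<theta>, r'). (area_inf r \<theta>, area_inf r' \<theta>)) \<in> borel_measurable borel"
    unfolding area_inf_eq_halfarea case_prod_unfold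
    by (intro borel_measurable_continuous_onI continuous_intros continuous_on_halfarea) auto
  have fm: "f \<in> borel_measurable borel" using f by (rule borel_measurable_continuous_onI)
  have hm: "h \<in> borel_measurable borel" using ch by (rule borel_measurable_continuous_onI)
  have Am: "A \<in> sets borel" unfolding A_def by (intro borel_Times) auto
  have "emeasure lborel A = emeasure lborel {-w..w} * (emeasure lborel {0..<2 * pi} * emeasure lborel {-w..w})"
  proof -
    have "{0..<2 * pi} \<times> {-w..w} \<in> sets borel" by (intro borel_Times) auto
    then show ?thesis unfolding A_def by (simp only: emeasure_lborel_Times sets_lborel borel_closed closed_atLeastAtMost
        atLeastLessThan_borel)
  qed
  also have "\<dots> = ennreal (sqrt 2 * (2 * pi * sqrt 2))"
    using w0 w2 by (simp add: ennreal_mult[symmetric])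
  also have "sqrt 2 * (2 * pi * sqrt 2) = 4 * pi" by simp
  finally have emA: "emeasure lborel A = ennreal (4 * pi)" .
  have um: "uniform_measure lborel A = density lborel (\<lambda>x. ennreal (indicator A x / (4 * pi)))"
    unfolding uniform_measure_def emA
    by (intro arg_cong[where f = "density lborel"] ext) (auto simp: indicator_def divide_ennreal[symmetric] simp flip: ennreal_1)
  have meas': "(\<lambda>(r, \<theta>, r'). (area_inf r \<theta>, area_inf r' \<theta>)) \<in> measurable (uniform_measure lborel A) borel"
    using meas by (subst measurable_cong_sets[of _ borel _ borel]) auto
  have "limit_law = distr (uniform_measure lborel A) borel (\<lambda>(r, \<theta>, r'). (area_inf r \<theta>, area_inf r' \<theta>))"
    by (simp add: limit_law_def A_def w_def)
  then have "integral\<^sup>L limit_law f = (\<integral>x. f ((\<lambda>(r, \<theta>, r'). (area_inf r \<theta>, area_inf r' \<theta>)) x) \<partial>uniform_measure lborel A)"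
    using integral_distr[OF meas' fm] by simp
  also have "\<dots> = (\<integral>x. h x \<partial>uniform_measure lborel A)"
    by (simp add: h_def area_inf_eq_halfarea case_prod_unfold)
  also have "\<dots> = (\<integral>x. (indicator A x / (4 * pi)) *\<^sub>R h x \<partial>lborel)"
    unfolding um using hm Am by (subst integral_density) auto
  also have "\<dots> = (LINT x:A|lborel. h x) / (4 * pi)"
    unfolding set_lebesgue_integral_def by (simp flip: integral_divide_zero)
  also have "(LINT x:A|lborel. h x) = integral A h"
  proof (rule set_borel_integral_eq_integral(2))
    have "set_integrable lborel A' h" unfolding set_integrable_def A'_def
      by (intro borel_integrable_compact ch) simp
    then show "set_integrable lborel A h"
      by (rule set_integrable_subset) (use Am in \<open>auto simp: A_def A'_def cbox_Pair_eq\<close>)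
  qed
  \<comment> \<open>The half-open angle interval misses only part of a hyperplane of the closed
    box.\<close>
  also have "integral A h = integral A' h"
  proof (rule integral_spike_set)
    have neg: "negligible {x :: real \<times> real \<times> real. (0, 1, 0) \<bullet> x = 2 * pi}"
      by (rule negligible_hyperplane) (simp add: zero_prod_def)
    show "negligible {x \<in> A - A'. h x \<noteq> 0}"
      by (rule negligible_subset[OF neg]) (auto simp: A_def A'_def cbox_Pair_eq)
    show "negligible {x \<in> A' - A. h x \<noteq> 0}"
      by (rule negligible_subset[OF neg]) (auto simp: A_def A'_def cbox_Pair_eq)
  qed
  also have "integral A' h = integral (cbox (-w) w) (\<lambda>r. integral (cbox (0, -w) (2 * pi, w)) (\<lambda>y. h (r, y)))"
    unfolding A'_def by (rule integral_prod_continuous[OF ch])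
  also have "\<dots> = integral (cbox (-w) w) (\<lambda>r. integral (cbox 0 (2 * pi)) (\<lambda>\<theta>. integral (cbox (-w) w) (\<lambda>r'. h (r, \<theta>, r'))))"
  proof (intro integral_cong)
    fix r
    have "continuous_on (cbox (0, -w) (2 * pi, w)) (\<lambda>y. h (r, y))"
      by (intro continuous_on_compose2[OF ch[of UNIV]] continuous_intros) auto
    then show "integral (cbox (0, -w) (2 * pi, w)) (\<lambda>y. h (r, y)) = integral (cbox 0 (2 * pi)) (\<lambda>\<theta>. integral (cbox (-w) w) (\<lambda>r'. h (r, \<theta>, r')))"
      by (rule integral_prod_continuous)
  qed
  also have "\<dots> = integral (cbox 0 (2 * pi)) (\<lambda>\<theta>. integral (cbox (-w) w) (\<lambda>r. integral (cbox (-w) w) (\<lambda>r'. h (r, \<theta>, r'))))"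
  proof (rule integral_swap_continuous)
    have "continuous_on (cbox (-w, 0) (w, 2 * pi) \<times> cbox (-w) w) (\<lambda>(x, r'). h (fst x, snd x, r'))"
      unfolding case_prod_unfold by (intro continuous_on_compose2[OF ch[of UNIV]] continuous_intros) auto
    then show "continuous_on (cbox (-w, 0) (w, 2 * pi)) (\<lambda>(r, \<theta>). integral (cbox (-w) w) (\<lambda>r'. h (r, \<theta>, r')))"
      unfolding case_prod_unfold
      by (rule integral_continuous_on_param[where f = "\<lambda>x r'. h (fst x, snd x, r')", unfolded case_prod_unfold])
  qed
  finally show ?thesis by (simp add: h_def)
qed

text \<open>Markov's inequality for the increments: their sum over j telescopes to the last k
  arguments minus the first k, hence is at most 2 pi k. So a shift by k changes the direction
  noticeably for few j only.\<close>

lemma card_Arg_jumps: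
  assumes l: "arg_enum R l" and k: "0 \<le> k" "k \<le> K R" and \<eta>: "0 < \<eta>"
  shows "real (card {j \<in> {1..K R - k}. \<eta> < Arg2pi (l (j + k)) - Arg2pi (l j)}) * \<eta> \<le> 2 * pi * of_int k"
proof -
  define \<theta> where "\<theta> j = Arg2pi (l j)" for j
  have mono: "mono_on {1..K R} \<theta>" using l by (simp add: arg_enum_def \<theta>_def[abs_def])
  have nn: "0 \<le> \<theta> j" "\<theta> j \<le> 2 * pi" for j
    using Arg2pi_ge_0[of "l j"] Arg2pi_lt_2pi[of "l j"] by (auto simp: \<theta>_def)
  let ?J = "{1..K R - k}"
  let ?X = "{j \<in> ?J. \<eta> < \<theta> (j + k) - \<theta> j}"
  have "real (card ?X) * \<eta> = (\<Sum>j\<in>?X. \<eta>)" by simp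
  also have "\<dots> \<le> (\<Sum>j\<in>?X. \<theta> (j + k) - \<theta> j)" by (intro sum_mono) auto
  also have "\<dots> \<le> (\<Sum>j\<in>?J. \<theta> (j + k) - \<theta> j)"
    using k by (intro sum_mono2) (auto intro!: mono_onD[OF mono])
  also have "\<dots> = (\<Sum>j\<in>?J. \<theta> (j + k)) - (\<Sum>j\<in>?J. \<theta> j)" by (rule sum_subtractf)
  also have "(\<Sum>j\<in>?J. \<theta> (j + k)) = (\<Sum>j\<in>{1 + k..K R}. \<theta> j)"
    by (rule sum.reindex_bij_witness[of _ "\<lambda>j. j - k" "\<lambda>j. j + k"]) auto
  also have "\<dots> \<le> (\<Sum>j\<in>{1..K R}. \<theta> j)" using nn k by (intro sum_mono2) auto
  also have "(\<Sum>j\<in>{1..K R}. \<theta> j) = (\<Sum>j\<in>{K R - k + 1..K R}. \<theta> j) + (\<Sum>j\<in>?J. \<theta> j)"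
  proof -
    have "{1..K R} = {K R - k + 1..K R} \<union> ?J" using k by auto
    then show ?thesis by (simp add: sum.union_disjoint)
  qed
  also have "(\<Sum>j\<in>{K R - k + 1..K R}. \<theta> j) \<le> (\<Sum>j\<in>{K R - k + 1..K R}. 2 * pi)"
    using nn by (intro sum_mono) auto
  also have "\<dots> = 2 * pi * of_int k" using k by simp
  finally show ?thesis by (simp add: \<theta>_def)
qed

text \<open>Double counting: at each of the n positions within a window, different windows have
  different points, so every position is hit at most \<open>card X\<close> times. This is how
  exceptional points become rare on average over j.\<close>

lemma card_windows_hit:
  fixes n :: nat and m k0 :: int
  assumes inj: "inj_on l {1..m}" and fin: "finite X" and J: "\<And>j. j \<in> J \<Longrightarrow> 1 \<le> j + k0 \<and> j + k0 + int n \<le> m + 1"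
    and finJ: "finite J"
  shows "(\<Sum>j\<in>J. card {k \<in> {j + k0..<j + k0 + int n}. l k \<in> X}) \<le> n * card X"
proof -
  have "(\<Sum>j\<in>J. card {k \<in> {j + k0..<j + k0 + int n}. l k \<in> X}) =
      (\<Sum>j\<in>J. \<Sum>t<n. if l (j + k0 + int t) \<in> X then 1 else 0)"
  proof (intro sum.cong refl)
    fix j
    have "card {k \<in> {j + k0..<j + k0 + int n}. l k \<in> X} = card {t \<in> {..<n}. l (j + k0 + int t) \<in> X}"
      by (rule bij_betw_same_card[of "\<lambda>k. nat (k - j - k0)"], rule bij_betw_byWitness[where f' = "\<lambda>t. j + k0 + int t"]) auto
    then show "card {k \<in> {j + k0..<j + k0 + int n}. l k \<in> X} = (\<Sum>t<n. if l (j + k0 + int t) \<in> X then 1 else 0)"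
      by (simp add: sum.If_cases Int_def)
  qed
  also have "\<dots> = (\<Sum>t<n. \<Sum>j\<in>J. if l (j + k0 + int t) \<in> X then 1 else 0)" by (rule sum.swap)
  also have "\<dots> = (\<Sum>t<n. card {j \<in> J. l (j + k0 + int t) \<in> X})"
    using finJ by (simp add: sum.If_cases Int_def)
  also have "\<dots> \<le> (\<Sum>t<n. card X)"
  proof (intro sum_mono)
    fix t assume t: "t \<in> {..<n}"
    show "card {j \<in> J. l (j + k0 + int t) \<in> X} \<le> card X"
    proof (rule card_inj_on_le[of "\<lambda>j. l (j + k0 + int t)"])
      show "inj_on (\<lambda>j. l (j + k0 + int t)) {j \<in> J. l (j + k0 + int t) \<in> X}"
      proof (rule inj_onI)
        fix j j' assume *: "j \<in> {j \<in> J. l (j + k0 + int t) \<in> X}" "j' \<in> {j \<in> J. l (j + k0 + int t) \<in> X}"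
          "l (j + k0 + int t) = l (j' + k0 + int t)"
        then have "j + k0 + int t \<in> {1..m}" "j' + k0 + int t \<in> {1..m}" using J[of j] J[of j'] t by auto
        from inj_onD[OF inj *(3) this] show "j = j'" by simp
      qed
    qed (use fin in auto)
  qed
  finally show ?thesis by simp
qed

lemma sum_abs_le_split:
  fixes g :: "'a \<Rightarrow> real"
  assumes "finite A" "\<And>x. x \<in> A \<Longrightarrow> x \<notin> X \<Longrightarrow> \<bar>g x\<bar> \<le> e" "\<And>x. x \<in> A \<Longrightarrow> \<bar>g x\<bar> \<le> C" "0 \<le> e" "0 \<le> C" "X \<subseteq> A"
  shows "\<bar>\<Sum>x\<in>A. g x\<bar> \<le> e * card A + C * card X"
proof -
  have finX: "finite X" using assms finite_subset by blast
  have "\<bar>\<Sum>x\<in>A. g x\<bar> \<le> (\<Sum>x\<in>A. e + (if x \<in> X then C else 0))"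
  proof (intro order.trans[OF sum_abs] sum_mono)
    fix x assume "x \<in> A"
    then show "\<bar>g x\<bar> \<le> e + (if x \<in> X then C else 0)" using assms(2,3)[of x] assms(4) by auto
  qed
  also have "\<dots> = e * card A + C * card X"
    using assms(1,6) by (simp add: sum.distrib sum.If_cases Int_absorb1)
  finally show ?thesis .
qed


text \<open>Conditional mean of f (Y1, Y2) given the offset r of the first square and the common
  direction c.\<close>

definition pair_mean :: "(real \<times> real \<Rightarrow> real) \<Rightarrow> real \<Rightarrow> complex \<Rightarrow> real" where
  "pair_mean f r c = integral window (\<lambda>r'. f (halfarea r c, halfarea r' c)) / sqrt 2"

lemma continuous_on_second:
  fixes f :: "real \<times> real \<Rightarrow> real"
  assumes f: "continuous_on UNIV f" and c: "norm c = 1"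
  shows "continuous_on A (\<lambda>t. f (x, halfarea t c))"
  by (rule continuous_on_compose2[OF f]) (use c in \<open>auto intro!: continuous_intros continuous_on_halfarea\<close>)

lemma abs_pair_mean_le:
  fixes f :: "real \<times> real \<Rightarrow> real"
  assumes f: "continuous_on UNIV f" and c: "norm c = 1" and B: "\<And>x. \<bar>f x\<bar> \<le> B"
  shows "\<bar>pair_mean f r c\<bar> \<le> B"
proof -
  have "norm (integral window (\<lambda>r'. f (halfarea r c, halfarea r' c))) \<le> B * (1 / sqrt 2 - - 1 / sqrt 2)"
    by (intro integral_bound continuous_on_second[OF f c]) (auto simp: B)
  also have "1 / sqrt 2 - - 1 / sqrt 2 = sqrt 2" by (simp add: field_simps)
  finally show ?thesis unfolding pair_mean_def by (simp add: abs_divide divide_le_eq)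
qed

text \<open>Two replacements. For fixed k, the direction of the second point is replaced by that of
  the first (\<open>step_a\<close>), at a small cost except for few j. For fixed j, the sum over k
  is then a window sum of the function \<open>G j\<close> and is replaced by its mean
  (\<open>step_b\<close>); the exceptional points are controlled only after summing over j.\<close>

lemma pair_sum_estimate:
  fixes f :: "real \<times> real \<Rightarrow> real" and e B \<omega> :: real
  assumes f: "continuous_on UNIV f" and e: "0 < e" "e \<le> 1" and B: "1 \<le> B" "\<And>x. \<bar>f x\<bar> \<le> B" and \<omega>: "0 < \<omega>"
    and modulus: "\<forall>x\<in>{-1..2}. \<forall>y\<in>{-1..2}. \<forall>x'\<in>{-1..2}. \<forall>y'\<in>{-1..2}.
      \<bar>x - x'\<bar> \<le> \<omega> \<longrightarrow> \<bar>y - y'\<bar> \<le> \<omega> \<longrightarrow> \<bar>f (x, y) - f (x', y')\<bar> \<le> e"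
  shows "\<exists>R1 D. 0 \<le> D \<and> (\<forall>R l k0 n. R1 \<le> R \<longrightarrow> arg_enum R l \<longrightarrow> 1 \<le> k0 \<longrightarrow> k0 + int n \<le> K R \<longrightarrow>
      \<bar>(\<Sum>j\<in>{1..K R}. \<Sum>k\<in>{k0..<k0 + int n}. f (area_R R (l j), area_R R (l (j + k))))
        - n * (\<Sum>z\<in>Gam R. pair_mean f (norm z - R) (sgn z))\<bar>
      \<le> n * (7 * e * K R) + n * (80 * B * e * R) + 2 * B * D * K R + 2 * B * (2 + 16 * pi / \<omega>) * (k0 + int n) * n)"
proof -
  have osc: "\<bar>f (x, y) - f (x', y')\<bar> \<le> e" if "x \<in> {-1..2}" "y \<in> {-1..2}" "x' \<in> {-1..2}" "y' \<in> {-1..2}"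
    "\<bar>x - x'\<bar> \<le> \<omega>" "\<bar>y - y'\<bar> \<le> \<omega>" for x y x' y' using modulus that by blast
  \<comment> \<open>4 is the Lipschitz constant of \<open>halfarea\<close>: radii within one slice
    give areas within \<omega> of each other.\<close>
  define N where "N = nat \<lceil>4 * sqrt 2 / \<omega>\<rceil> + 1"
  have "4 * sqrt 2 / \<omega> \<le> real N" by (auto simp: N_def intro: order.trans[OF real_nat_ceiling_ge])
  then have "4 * sqrt 2 \<le> \<omega> * real N" using \<omega> by (simp add: pos_divide_le_eq mult.commute)
  moreover have N0: "0 < N" by (simp add: N_def)
  ultimately have N: "4 * (sqrt 2 / N) \<le> \<omega>" by (simp add: pos_divide_le_eq)
  obtain R0 D :: real and E where RDE: "10 \<le> R0" "0 \<le> D"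
    "\<And>R. R0 \<le> R \<Longrightarrow> E R \<subseteq> Gam R" "\<And>R. R0 \<le> R \<Longrightarrow> real (card (E R)) \<le> 40 * e * R"
    "\<And>R l i n b. \<lbrakk>R0 \<le> R; arg_enum R l; 1 \<le> i; i + int n \<le> K R + 1;
       continuous_on window b;
       \<And>t. t \<in> window \<Longrightarrow> \<bar>b t\<bar> \<le> B;
       \<And>t t'. t \<in> window \<Longrightarrow> t' \<in> window \<Longrightarrow>
         \<bar>t - t'\<bar> \<le> sqrt 2 / N \<Longrightarrow> \<bar>b t - b t'\<bar> \<le> e\<rbrakk> \<Longrightarrow>
       \<bar>\<Sum>k\<in>{i..<i + int n}. b (norm (l k) - R) - integral window b / sqrt 2\<bar>
       \<le> 6 * e * n + 2 * B * (card {k \<in> {i..<i + int n}. l k \<in> E R} + D)"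
    using windows_equidistributed[OF e B(1) N0] by blast
  show ?thesis
  proof (rule exI[of _ "max R0 (8 / \<omega>)"], rule exI[of _ D], intro conjI allI impI RDE(2))
    fix R l k0 n
    assume "max R0 (8 / \<omega>) \<le> R" and l: "arg_enum R l" and k0: "1 \<le> k0" and k0n: "k0 + int n \<le> K R"
    then have R: "R0 \<le> R" "10 \<le> R" "8 / \<omega> \<le> R" using RDE(1) by auto
    have R4: "4 / R \<le> \<omega> / 2" "4 / R \<le> 1" using R \<omega> by (auto simp: field_simps)
    define Ks where "Ks = {k0..<k0 + int n}"
    define m where "m = k0 + int n"
    define r where "r j = norm (l j) - R" for j
    define c where "c j = sgn (l j)" for j
    define \<theta> where "\<theta> j = Arg2pi (l j)" for j
    \<comment> \<open>The direction of the second square is frozen at that of the first; only its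
      offset t remains free.\<close>
    define G where "G j t = f (halfarea (r j) (c j), halfarea t (c j))" for j t
    define \<Phi> where "\<Phi> j = pair_mean f (r j) (c j)" for j
    have bij: "bij_betw l {1..K R} (Gam R)" and mono: "mono_on {1..K R} (\<lambda>j. Arg2pi (l j))"
      using l by (auto simp: arg_enum_def)
    have lG: "l j \<in> Gam R" if "j \<in> {1..K R}" for j using bij that by (auto simp: bij_betw_def)
    have nz: "l j \<noteq> 0" "norm (c j) = 1" "c j = cis (\<theta> j)" if "j \<in> {1..K R}" for j
    proof -
      show "l j \<noteq> 0" using lG[OF that] R sqrt2_bounds by (auto simp: Gam_def)
      then show "norm (c j) = 1" "c j = cis (\<theta> j)" by (simp_all add: c_def \<theta>_def norm_sgn sgn_eq_cis_Arg2pi)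
    qed
    have area: "\<bar>area_R R (l j) - halfarea (r j) (c j)\<bar> \<le> 4 / R" if "j \<in> {1..K R}" for j
      unfolding r_def c_def using lG[OF that] R sqrt2_bounds by (intro area_R_approx) (auto simp: Gam_def)
    \<comment> \<open>\<open>area_R\<close> is within 1 of a value in [0, 1], which is why the
      modulus of continuity is taken on [-1, 2].\<close>
    have area_mem: "area_R R (l j) \<in> {-1..2}" "halfarea t d \<in> {-1..2}" if "j \<in> {1..K R}" for j t d
      using area[OF that] halfarea_bounds[of "r j" "c j"] halfarea_bounds[of t d] R4 by auto
    have GB: "\<bar>G j t\<bar> \<le> B" for j t by (simp add: G_def B(2))
    have \<Phi>B: "\<bar>\<Phi> j\<bar> \<le> B" if "j \<in> {1..K R}" for j
      unfolding \<Phi>_def by (rule abs_pair_mean_le[OF f nz(2)[OF that] B(2)])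
    have K0: "0 \<le> K R" by (simp add: K_def)
    \<comment> \<open>Bad j per unit of k: 1 for the indices with j + k > K R, and 16 pi / \<omega>
      for changes of the argument above \<omega> / 8.\<close>
    define C where "C = 1 + 16 * pi / \<omega>"
    have C0: "0 \<le> C" using \<omega> by (simp add: C_def)
    have step_a: "\<bar>\<Sum>j\<in>{1..K R}. f (area_R R (l j), area_R R (l (j + k))) - G j (r (j + k))\<bar> \<le> e * K R + 2 * B * (C * m)"
      if k: "k \<in> Ks" for k
    proof -
      have k': "0 \<le> k" "k \<le> K R" "k \<le> m" using k k0 k0n by (auto simp: Ks_def m_def)
      let ?X1 = "{K R - k + 1..K R}"
      let ?X2 = "{j \<in> {1..K R - k}. \<omega> / 8 < Arg2pi (l (j + k)) - Arg2pi (l j)}"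
      have "\<bar>\<Sum>j\<in>{1..K R}. f (area_R R (l j), area_R R (l (j + k))) - G j (r (j + k))\<bar>
        \<le> e * card {1..K R} + (2 * B) * card (?X1 \<union> ?X2)"
      proof (rule sum_abs_le_split)
        fix j assume j: "j \<in> {1..K R}"
        have "\<bar>f (area_R R (l j), area_R R (l (j + k)))\<bar> \<le> B" by (rule B(2))
        then show "\<bar>f (area_R R (l j), area_R R (l (j + k))) - G j (r (j + k))\<bar> \<le> 2 * B" using GB[of j "r (j + k)"] by linarith
        assume "j \<notin> ?X1 \<union> ?X2"
        then have jk: "j + k \<in> {1..K R}" and small: "\<theta> (j + k) - \<theta> j \<le> \<omega> / 8"
          using j k' by (auto simp: \<theta>_def)
        have "\<theta> j \<le> \<theta> (j + k)" unfolding \<theta>_def using j jk k' by (intro mono_onD[OF mono]) auto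
        then have "norm (c (j + k) - c j) \<le> \<omega> / 8"
          using norm_cis_diff_le[of "\<theta> (j + k)" "\<theta> j"] small by (simp add: nz(3)[OF j] nz(3)[OF jk])
        moreover have "\<bar>halfarea (r (j + k)) (c (j + k)) - halfarea (r (j + k)) (c j)\<bar> \<le> 4 * (\<bar>r (j + k) - r (j + k)\<bar> + norm (c (j + k) - c j))"
          by (rule halfarea_lipschitz[OF nz(2)[OF jk]])
        \<comment> \<open>At most \<omega> / 2 from the curvature and 4 * \<omega> / 8 from the
          change of direction.\<close>
        ultimately have "\<bar>area_R R (l (j + k)) - halfarea (r (j + k)) (c j)\<bar> \<le> \<omega>"
          using area[OF jk] R4(1) by simp
        moreover have "\<bar>area_R R (l j) - halfarea (r j) (c j)\<bar> \<le> \<omega>" using area[OF j] R4(1) \<omega> by linarith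
        ultimately show "\<bar>f (area_R R (l j), area_R R (l (j + k))) - G j (r (j + k))\<bar> \<le> e"
          unfolding G_def using area_mem j jk by (intro osc) auto
      qed (use e B k' in auto)
      also have "real (card {1..K R}) = K R" using K0 by simp
      also have "real (card (?X1 \<union> ?X2)) \<le> C * m"
      proof -
        have "real (card ?X2) * (\<omega> / 8) \<le> 2 * pi * of_int k" using \<omega> k' by (intro card_Arg_jumps[OF l]) auto
        then have "real (card ?X2) \<le> 16 * pi / \<omega> * of_int k" using \<omega> by (simp add: field_simps)
        moreover have "real (card ?X1) = of_int k" using k' by simp
        moreover have "real (card (?X1 \<union> ?X2)) \<le> real (card ?X1) + real (card ?X2)"
          using card_Un_le[of ?X1 ?X2] by linarith
        ultimately have "real (card (?X1 \<union> ?X2)) \<le> C * of_int k" by (simp add: C_def distrib_right)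
        also have "\<dots> \<le> C * of_int m" using C0 k' by (intro mult_left_mono) auto
        finally show ?thesis .
      qed
      finally show ?thesis using B by (simp add: mult_left_mono)
    qed
    \<comment> \<open>The starts j for which the last index j + m - 1 of the window is at most K R.
      The other m - 1 starts wrap around and only get the trivial bound
      \<open>step_b2\<close>.\<close>
    define J1 where "J1 = {1..K R - m + 1}"
    have card_E: "real (card (E R)) \<le> 40 * e * R" by (rule RDE(4)[OF R(1)])
    have step_b1: "\<bar>\<Sum>k\<in>Ks. G j (r (j + k)) - \<Phi> j\<bar>
        \<le> 6 * e * n + 2 * B * (card {k \<in> {j + k0..<j + k0 + int n}. l k \<in> E R} + D)" if j: "j \<in> J1" for j
    proof -
      have j': "j \<in> {1..K R}" using j k0 by (auto simp: J1_def m_def)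
      have \<Phi>j: "\<Phi> j = integral window (G j) / sqrt 2"
        by (simp add: \<Phi>_def pair_mean_def G_def[abs_def])
      have eq: "(\<Sum>k\<in>Ks. G j (r (j + k)) - \<Phi> j) =
        (\<Sum>k\<in>{j + k0..<j + k0 + int n}. G j (norm (l k) - R) - integral window (G j) / sqrt 2)"
        unfolding \<Phi>j Ks_def r_def by (rule sum.reindex_bij_witness[of _ "\<lambda>k. k - j" "\<lambda>k. j + k"]) auto
      show ?thesis unfolding eq
      proof (rule RDE(5)[OF R(1) l])
        show "1 \<le> j + k0" "j + k0 + int n \<le> K R + 1" using j k0 by (auto simp: J1_def m_def)
        show "continuous_on window (G j)" unfolding G_def by (rule continuous_on_second[OF f nz(2)[OF j']])
        show "\<And>t. \<bar>G j t\<bar> \<le> B" by (rule GB)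
        fix t t' :: real assume t: "\<bar>t - t'\<bar> \<le> sqrt 2 / real N"
        have "\<bar>halfarea t (c j) - halfarea t' (c j)\<bar> \<le> 4 * (\<bar>t - t'\<bar> + norm (c j - c j))"
          by (rule halfarea_lipschitz[OF nz(2)[OF j']])
        also have "\<dots> \<le> \<omega>" using t N by simp
        finally show "\<bar>G j t - G j t'\<bar> \<le> e" unfolding G_def using area_mem(2)[OF j'] \<omega> by (intro osc) auto
      qed
    qed
    have step_b2: "\<bar>\<Sum>k\<in>Ks. G j (r (j + k)) - \<Phi> j\<bar> \<le> 2 * B * n" if j: "j \<in> {1..K R}" for j
    proof -
      have "\<bar>\<Sum>k\<in>Ks. G j (r (j + k)) - \<Phi> j\<bar> \<le> (\<Sum>k\<in>Ks. 2 * B)"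
      proof (intro order.trans[OF sum_abs] sum_mono)
        fix k show "\<bar>G j (r (j + k)) - \<Phi> j\<bar> \<le> 2 * B" using GB[of j "r (j + k)"] \<Phi>B[OF j] by linarith
      qed
      then show ?thesis by (simp add: Ks_def mult.commute)
    qed
    have mK: "0 \<le> m" "m \<le> K R" using k0 k0n by (auto simp: m_def)
    have step_b: "\<bar>\<Sum>j\<in>{1..K R}. \<Sum>k\<in>Ks. G j (r (j + k)) - \<Phi> j\<bar>
      \<le> K R * (6 * e * n) + 2 * B * (n * (40 * e * R) + K R * D) + m * (2 * B * n)"
    proof -
      have "\<bar>\<Sum>j\<in>{1..K R}. \<Sum>k\<in>Ks. G j (r (j + k)) - \<Phi> j\<bar> \<le> (\<Sum>j\<in>{1..K R}. \<bar>\<Sum>k\<in>Ks. G j (r (j + k)) - \<Phi> j\<bar>)"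
        by (rule sum_abs)
      also have "\<dots> = (\<Sum>j\<in>J1. \<bar>\<Sum>k\<in>Ks. G j (r (j + k)) - \<Phi> j\<bar>) + (\<Sum>j\<in>{K R - m + 2..K R}. \<bar>\<Sum>k\<in>Ks. G j (r (j + k)) - \<Phi> j\<bar>)"
      proof -
        have "{1..K R} = J1 \<union> {K R - m + 2..K R}" using k0 k0n by (auto simp: J1_def m_def)
        then show ?thesis by (simp add: sum.union_disjoint J1_def)
      qed
      also have "(\<Sum>j\<in>{K R - m + 2..K R}. \<bar>\<Sum>k\<in>Ks. G j (r (j + k)) - \<Phi> j\<bar>) \<le> (\<Sum>j\<in>{K R - m + 2..K R}. 2 * B * n)"
        using mK by (intro sum_mono step_b2) auto
      also have "\<dots> = real (nat (m - 1)) * (2 * B * n)" by simp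
      also have "\<dots> \<le> m * (2 * B * n)" using B mK by (intro mult_right_mono) auto
      also have "(\<Sum>j\<in>J1. \<bar>\<Sum>k\<in>Ks. G j (r (j + k)) - \<Phi> j\<bar>)
        \<le> (\<Sum>j\<in>J1. 6 * e * n + 2 * B * (card {k \<in> {j + k0..<j + k0 + int n}. l k \<in> E R} + D))"
        by (rule sum_mono) (rule step_b1)
      also have "\<dots> = card J1 * (6 * e * n) + 2 * B * (real (\<Sum>j\<in>J1. card {k \<in> {j + k0..<j + k0 + int n}. l k \<in> E R}) + card J1 * D)"
        by (simp add: sum.distrib sum_distrib_left[symmetric])
      also have "\<dots> \<le> K R * (6 * e * n) + 2 * B * (n * (40 * e * R) + K R * D)"
      proof -
        have cJ: "real (card J1) \<le> K R" using k0 k0n by (auto simp: J1_def m_def)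
        have "(\<Sum>j\<in>J1. card {k \<in> {j + k0..<j + k0 + int n}. l k \<in> E R}) \<le> n * card (E R)"
          using bij k0 RDE(3)[OF R(1)]
          by (intro card_windows_hit[where m = "K R"]) (auto simp: J1_def m_def bij_betw_def intro: finite_subset)
        then have "real (\<Sum>j\<in>J1. card {k \<in> {j + k0..<j + k0 + int n}. l k \<in> E R}) \<le> real n * real (card (E R))"
          unfolding of_nat_mult[symmetric] of_nat_le_iff .
        also have "\<dots> \<le> n * (40 * e * R)" using card_E by (intro mult_left_mono) auto
        finally show ?thesis using cJ e B RDE(2) by (intro add_mono mult_right_mono mult_left_mono) auto
      qed
      finally show ?thesis by simp
    qed
    have sum\<Phi>: "(\<Sum>z\<in>Gam R. pair_mean f (norm z - R) (sgn z)) = (\<Sum>j\<in>{1..K R}. \<Phi> j)"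
      unfolding \<Phi>_def r_def c_def
      using sum.reindex_bij_betw[OF bij, of "\<lambda>z. pair_mean f (norm z - R) (sgn z)"] by (rule sym)
    have sum_a: "\<bar>\<Sum>k\<in>Ks. \<Sum>j\<in>{1..K R}. f (area_R R (l j), area_R R (l (j + k))) - G j (r (j + k))\<bar>
        \<le> n * (e * K R + 2 * B * (C * m))"
    proof -
      have "\<bar>\<Sum>k\<in>Ks. \<Sum>j\<in>{1..K R}. f (area_R R (l j), area_R R (l (j + k))) - G j (r (j + k))\<bar>
          \<le> (\<Sum>k\<in>Ks. e * K R + 2 * B * (C * m))"
        by (rule order.trans[OF sum_abs], rule sum_mono) (rule step_a)
      then show ?thesis by (simp add: Ks_def)
    qed
    have "(\<Sum>j\<in>{1..K R}. \<Sum>k\<in>Ks. f (area_R R (l j), area_R R (l (j + k)))) - n * (\<Sum>j\<in>{1..K R}. \<Phi> j)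
      = (\<Sum>k\<in>Ks. \<Sum>j\<in>{1..K R}. f (area_R R (l j), area_R R (l (j + k))) - G j (r (j + k)))
        + (\<Sum>j\<in>{1..K R}. \<Sum>k\<in>Ks. G j (r (j + k)) - \<Phi> j)"
    proof -
      have "(\<Sum>k\<in>Ks. \<Sum>j\<in>{1..K R}. f (area_R R (l j), area_R R (l (j + k))) - G j (r (j + k)))
        = (\<Sum>j\<in>{1..K R}. \<Sum>k\<in>Ks. f (area_R R (l j), area_R R (l (j + k))) - G j (r (j + k)))" by (rule sum.swap)
      then show ?thesis by (simp add: sum_subtractf sum_distrib_left Ks_def)
    qed
    then have "\<bar>(\<Sum>j\<in>{1..K R}. \<Sum>k\<in>Ks. f (area_R R (l j), area_R R (l (j + k)))) - n * (\<Sum>j\<in>{1..K R}. \<Phi> j)\<bar>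
      \<le> n * (e * K R + 2 * B * (C * m)) + (K R * (6 * e * n) + 2 * B * (n * (40 * e * R) + K R * D) + m * (2 * B * n))"
      using sum_a step_b by linarith
    also have "\<dots> = n * (7 * e * K R) + n * (80 * B * e * R) + 2 * B * D * K R + 2 * B * (2 + 16 * pi / \<omega>) * (k0 + int n) * n"
      unfolding C_def m_def by (simp add: algebra_simps)
    finally show "\<bar>(\<Sum>j\<in>{1..K R}. \<Sum>k\<in>{k0..<k0 + int n}. f (area_R R (l j), area_R R (l (j + k))))
        - n * (\<Sum>z\<in>Gam R. pair_mean f (norm z - R) (sgn z))\<bar>
      \<le> n * (7 * e * K R) + n * (80 * B * e * R) + 2 * B * D * K R + 2 * B * (2 + 16 * pi / \<omega>) * (k0 + int n) * n"
      unfolding sum\<Phi> Ks_def .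
  qed
qed

lemma int_window_eq:
  fixes M L :: real
  assumes "1 \<le> M" "1 \<le> L"
  defines "n \<equiv> nat (\<lfloor>M + L\<rfloor> - \<lceil>M\<rceil> + 1)"
  shows "{k :: int. M \<le> of_int k \<and> of_int k \<le> M + L} = {\<lceil>M\<rceil>..<\<lceil>M\<rceil> + int n}"
    "L - 1 \<le> real n" "0 < n" "1 \<le> \<lceil>M\<rceil>" "of_int (\<lceil>M\<rceil> + int n) \<le> M + L + 1"
proof -
  have "real_of_int \<lceil>M\<rceil> < M + 1" by linarith
  moreover have "M + L - 1 < real_of_int \<lfloor>M + L\<rfloor>" by linarith
  ultimately have gt: "L - 1 < of_int (\<lfloor>M + L\<rfloor> - \<lceil>M\<rceil> + 1)"
    unfolding of_int_diff of_int_add of_int_1 by linarith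
  then have "0 < \<lfloor>M + L\<rfloor> - \<lceil>M\<rceil> + 1" using assms by linarith
  then have n: "int n = \<lfloor>M + L\<rfloor> - \<lceil>M\<rceil> + 1" "0 < n" by (auto simp: n_def)
  show "0 < n" by (rule n(2))
  show "L - 1 \<le> real n" using gt n(1) by (metis of_int_of_nat_eq order_less_imp_le)
  show "1 \<le> \<lceil>M\<rceil>" using assms(1) by linarith
  show "of_int (\<lceil>M\<rceil> + int n) \<le> M + L + 1" using n(1) by simp
  show "{k :: int. M \<le> of_int k \<and> of_int k \<le> M + L} = {\<lceil>M\<rceil>..<\<lceil>M\<rceil> + int n}"
    unfolding n(1) by (auto simp: ceiling_le_iff le_floor_iff zle_add1_eq_le)
qed

lemma integral_pair_law:
  fixes f :: "real \<times> real \<Rightarrow> real"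
  assumes f: "continuous_on UNIV f" and K: "0 < K R"
    and W: "{k :: int. M \<le> of_int k \<and> of_int k \<le> M + L} = {k0..<k0 + int n}" and n: "0 < n"
  shows "integral\<^sup>L (pair_law R l M L) f =
    (\<Sum>j\<in>{1..K R}. \<Sum>k\<in>{k0..<k0 + int n}. f (area_R R (l j), area_R R (l (j + k)))) / (K R * n)"
proof -
  let ?A = "{1..K R} \<times> {k0..<k0 + int n}"
  have A: "?A \<noteq> {}" "finite ?A" using K n by auto
  have "integral\<^sup>L (pair_law R l M L) f =
    (\<integral>x. f ((\<lambda>(j, k). (area_R R (l j), area_R R (l (j + k)))) x) \<partial>measure_pmf (pmf_of_set ?A))"
    unfolding pair_law_def W using borel_measurable_continuous_onI[OF f]
    by (intro integral_distr) auto
  also have "\<dots> = (\<Sum>x\<in>?A. f ((\<lambda>(j, k). (area_R R (l j), area_R R (l (j + k)))) x)) / card ?A"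
    by (rule integral_pmf_of_set[OF A])
  also have "(\<Sum>x\<in>?A. f ((\<lambda>(j, k). (area_R R (l j), area_R R (l (j + k)))) x)) =
    (\<Sum>j\<in>{1..K R}. \<Sum>k\<in>{k0..<k0 + int n}. f (area_R R (l j), area_R R (l (j + k))))"
    by (simp add: sum.cartesian_product case_prod_unfold)
  also have "real (card ?A) = K R * n" using K by (simp add: card_cartesian_product)
  finally show ?thesis .
qed

lemma continuous_on_pair_mean:
  fixes f :: "real \<times> real \<Rightarrow> real"
  assumes f: "continuous_on UNIV f"
  shows "continuous_on (window \<times> sphere 0 1) (\<lambda>(r, c). pair_mean f r c)"
proof -
  let ?U = "window \<times> sphere (0 :: complex) 1"
  have "continuous_on (?U \<times> cbox (-1 / sqrt 2) (1 / sqrt 2))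
      (\<lambda>(x, r'). f (halfarea (fst x) (snd x), halfarea r' (snd x)))"
    unfolding case_prod_unfold
    by (intro continuous_on_compose2[OF f] continuous_intros continuous_on_halfarea) auto
  then have "continuous_on ?U (\<lambda>x. integral (cbox (-1 / sqrt 2) (1 / sqrt 2)) (\<lambda>r'. f (halfarea (fst x) (snd x), halfarea r' (snd x))))"
    by (rule integral_continuous_on_param)
  then show ?thesis unfolding pair_mean_def case_prod_unfold
    by (intro continuous_intros) auto
qed

lemma unif_modulus_square:
  fixes f :: "real \<times> real \<Rightarrow> real"
  assumes f: "continuous_on UNIV f" and e: "0 < e"
  shows "\<exists>\<omega>>0. \<forall>x\<in>{-1..2}. \<forall>y\<in>{-1..2}. \<forall>x'\<in>{-1..2}. \<forall>y'\<in>{-1..2}.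
      \<bar>x - x'\<bar> \<le> \<omega> \<longrightarrow> \<bar>y - y'\<bar> \<le> \<omega> \<longrightarrow> \<bar>f (x, y) - f (x', y')\<bar> \<le> e"
proof -
  let ?S = "{-1..2} \<times> {-1..2} :: (real \<times> real) set"
  have "uniformly_continuous_on ?S f"
    using f by (intro compact_uniformly_continuous compact_Times) (auto intro: continuous_on_subset)
  then obtain d where d: "0 < d" "\<And>x x'. x \<in> ?S \<Longrightarrow> x' \<in> ?S \<Longrightarrow> dist x' x < d \<Longrightarrow> dist (f x') (f x) < e"
    using e unfolding uniformly_continuous_on_def by metis
  show ?thesis
  proof (intro exI[of _ "d / 3"] conjI ballI impI)
    show "0 < d / 3" using d by simp
    fix x y x' y' :: real
    assume *: "x \<in> {-1..2}" "y \<in> {-1..2}" "x' \<in> {-1..2}" "y' \<in> {-1..2}" "\<bar>x - x'\<bar> \<le> d / 3" "\<bar>y - y'\<bar> \<le> d / 3"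
    have "dist (x, y) (x', y') \<le> dist x x' + dist y y'"
      unfolding dist_Pair_Pair by (rule sqrt_sum_squares_le_sum) auto
    also have "\<dots> < d" using * d(1) by (simp add: dist_real_def)
    finally show "\<bar>f (x, y) - f (x', y')\<bar> \<le> e"
      using d(2)[of "(x', y')" "(x, y)"] * by (simp add: dist_real_def)
  qed
qed

text \<open>Divided by K R * n, the bound of \<open>pair_sum_estimate\<close> has two terms
  proportional to \<open>e\<close>, a boundary term O(1/n) that vanishes since L -> \<infinity>, and
  a term O((k0 + n) / K R) that vanishes since M / R -> 0. The remaining quotient T R / K R
  converges by \<open>Gam_equidistributed\<close>, applied to \<open>pair_mean\<close> and to the
  constant 1.\<close>

theorem pair_law_weak_conv:
  fixes lam :: "real \<Rightarrow> int \<Rightarrow> complex" and M L :: "real \<Rightarrow> real"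
  assumes enum: "\<And>R. R > 0 \<Longrightarrow> arg_enum R (lam R)"
    and M_inf: "filterlim M at_top at_top" and L_inf: "filterlim L at_top at_top"
    and M_small: "((\<lambda>R. M R / R) \<longlongrightarrow> 0) at_top" and L_le: "\<forall>\<^sub>F R in at_top. L R \<le> M R"
  shows "weak_conv_along (\<lambda>R. pair_law R (lam R) (M R) (L R)) limit_law at_top"
  unfolding weak_conv_along_def
proof (intro allI impI)
  fix f :: "real \<times> real \<Rightarrow> real"
  assume f: "continuous_on UNIV f" and bf: "bounded (range f)"
  obtain B0 where B0: "\<And>x. \<bar>f x\<bar> \<le> B0" using bf unfolding bounded_iff by auto
  define B where "B = max 1 B0"
  have B: "1 \<le> B" "\<And>x. \<bar>f x\<bar> \<le> B" using B0 by (auto simp: B_def le_max_iff_disj)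
  let ?I = "window"
  define T where "T R = (\<Sum>z\<in>Gam R. pair_mean f (norm z - R) (sgn z))" for R
  have limT: "((\<lambda>R. T R / R) \<longlongrightarrow> integral {0..2 * pi} (\<lambda>\<theta>. integral ?I (\<lambda>r. pair_mean f r (cis \<theta>)))) at_top"
    unfolding T_def
    by (rule Gam_equidistributed[OF continuous_on_pair_mean[OF f]]) (simp add: pair_mean_def halfarea_ii)
  have limK: "((\<lambda>R. K R / R) \<longlongrightarrow> 2 * pi * sqrt 2) at_top"
    using card_Gam_asymp by (simp add: K_def)
  have "((\<lambda>R. (T R / R) / (K R / R)) \<longlongrightarrow> integral {0..2 * pi} (\<lambda>\<theta>. integral ?I (\<lambda>r. pair_mean f r (cis \<theta>))) / (2 * pi * sqrt 2)) at_top"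
    by (intro tendsto_divide limT limK) simp
  moreover have "integral {0..2 * pi} (\<lambda>\<theta>. integral ?I (\<lambda>r. pair_mean f r (cis \<theta>))) / (2 * pi * sqrt 2) = integral\<^sup>L limit_law f"
  proof -
    \<comment> \<open>One factor sqrt 2 is the normalisation in \<open>pair_mean\<close>, the other
      belongs to the limit of K R / R.\<close>
    have "sqrt 2 * (2 * pi * sqrt 2) = 4 * pi" by simp
    then show ?thesis unfolding integral_limit_law[OF f] pair_mean_def by simp
  qed
  moreover have "\<forall>\<^sub>F R in at_top. (T R / R) / (K R / R) = T R / K R"
    using eventually_gt_at_top[of 0] by eventually_elim simp
  ultimately have limTK: "((\<lambda>R. T R / K R) \<longlongrightarrow> integral\<^sup>L limit_law f) at_top"
    using Lim_transform_eventually by fastforce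
  have K_ge: "\<forall>\<^sub>F R in at_top. R \<le> K R"
  proof -
    have "1 * 1 < 2 * pi * sqrt 2" using pi_gt3 sqrt2_bounds by (intro mult_strict_mono) auto
    then have "\<forall>\<^sub>F R in at_top. 1 < K R / R" using order_tendstoD(1)[OF limK, of 1] by simp
    then show ?thesis using eventually_gt_at_top[of 0] by eventually_elim (simp add: field_simps)
  qed
  have "((\<lambda>R. integral\<^sup>L (pair_law R (lam R) (M R) (L R)) f - T R / K R) \<longlongrightarrow> 0) at_top"
    unfolding tendsto_iff
  proof (intro allI impI)
    fix \<epsilon> :: real assume \<epsilon>: "0 < \<epsilon>"
    \<comment> \<open>The terms 7 e and 80 B e do not shrink as R grows, so they are made small
      beforehand.\<close>
    define e where "e = min 1 (\<epsilon> / (4 * (7 + 80 * B)))"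
    have "0 < 7 + 80 * B" using B by simp
    then have "(7 + 80 * B) * e \<le> (7 + 80 * B) * (\<epsilon> / (4 * (7 + 80 * B)))"
      by (intro mult_left_mono) (auto simp: e_def)
    also have "\<dots> = \<epsilon> / 4" using \<open>0 < 7 + 80 * B\<close> by (simp add: divide_simps)
    finally have e: "0 < e" "e \<le> 1" "(7 + 80 * B) * e \<le> \<epsilon> / 4"
      using \<epsilon> \<open>0 < 7 + 80 * B\<close> by (auto simp: e_def)
    obtain \<omega> where \<omega>: "0 < \<omega>" "\<forall>x\<in>{-1..2}. \<forall>y\<in>{-1..2}. \<forall>x'\<in>{-1..2}. \<forall>y'\<in>{-1..2}.
      \<bar>x - x'\<bar> \<le> \<omega> \<longrightarrow> \<bar>y - y'\<bar> \<le> \<omega> \<longrightarrow> \<bar>f (x, y) - f (x', y')\<bar> \<le> e"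
      using unif_modulus_square[OF f e(1)] by blast
    obtain R1 D where D: "0 \<le> D" and est: "\<forall>R l k0 n. R1 \<le> R \<longrightarrow> arg_enum R l \<longrightarrow> 1 \<le> k0 \<longrightarrow> k0 + int n \<le> K R \<longrightarrow>
      \<bar>(\<Sum>j\<in>{1..K R}. \<Sum>k\<in>{k0..<k0 + int n}. f (area_R R (l j), area_R R (l (j + k)))) - n * T R\<bar>
      \<le> n * (7 * e * K R) + n * (80 * B * e * R) + 2 * B * D * K R + 2 * B * (2 + 16 * pi / \<omega>) * (k0 + int n) * n"
      using pair_sum_estimate[OF f e(1,2) B \<omega>, folded T_def] by blast
    define C where "C = 2 * B * (2 + 16 * pi / \<omega>)"
    have C: "0 \<le> C" using B \<omega> by (simp add: C_def)
    \<comment> \<open>As n \<ge> L R - 1, this makes the boundary term 2 B D / n at most \<epsilon>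
      / 4.\<close>
    have evL: "\<forall>\<^sub>F R in at_top. max 1 (1 + 8 * B * D / \<epsilon>) \<le> L R" using L_inf unfolding filterlim_at_top by blast
    have evM: "\<forall>\<^sub>F R in at_top. 1 \<le> M R" using M_inf by (simp add: filterlim_at_top)
    \<comment> \<open>The bound 1/3 ensures k0 + n \<le> M + L + 1 \<le> 3 M \<le> R \<le> K R, as
      \<open>pair_sum_estimate\<close> requires; the other bound makes its last term at most
      \<epsilon> / 4.\<close>
    have evS: "\<forall>\<^sub>F R in at_top. M R / R < min (1/3) (\<epsilon> / (12 * (C + 1)))"
      by (rule order_tendstoD(2)[OF M_small]) (use \<epsilon> C in auto)
    show "\<forall>\<^sub>F R in at_top. dist (integral\<^sup>L (pair_law R (lam R) (M R) (L R)) f - T R / K R) 0 < \<epsilon>"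
      using evL evM evS L_le K_ge eventually_ge_at_top[of R1] eventually_gt_at_top[of 0]
    proof eventually_elim
      case (elim R)
      define k0 where "k0 = \<lceil>M R\<rceil>"
      define n where "n = nat (\<lfloor>M R + L R\<rfloor> - \<lceil>M R\<rceil> + 1)"
      have L1: "1 \<le> L R" using elim by simp
      note win = int_window_eq[OF elim(2) L1, folded n_def k0_def]
      have R0: "0 < R" using elim by simp
      have K0: "0 < K R" using elim by linarith
      have k0n: "real_of_int (k0 + int n) \<le> 3 * M R" using win(5) elim by linarith
      have "3 * M R \<le> R" using elim(3) R0 by (simp add: field_simps)
      then have k0nK: "k0 + int n \<le> K R" using k0n elim by linarith
      have n0: "0 < real n" using win(3) by simp
      have int: "integral\<^sup>L (pair_law R (lam R) (M R) (L R)) f =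
        (\<Sum>j\<in>{1..K R}. \<Sum>k\<in>{k0..<k0 + int n}. f (area_R R (lam R j), area_R R (lam R (j + k)))) / (K R * n)"
        by (rule integral_pair_law[OF f K0 win(1,3)])
      let ?S = "\<Sum>j\<in>{1..K R}. \<Sum>k\<in>{k0..<k0 + int n}. f (area_R R (lam R j), area_R R (lam R (j + k)))"
      have "?S / (K R * n) - T R / K R = (?S - n * T R) / (K R * n)" using K0 n0 by (simp add: diff_divide_distrib)
      then have "\<bar>?S / (K R * n) - T R / K R\<bar> = \<bar>?S - n * T R\<bar> / (K R * n)" using K0 n0 by (simp add: abs_divide abs_mult)
      also have "\<dots> \<le> (n * (7 * e * K R) + n * (80 * B * e * R) + 2 * B * D * K R + C * (k0 + int n) * n) / (K R * n)"
        unfolding C_def using est[rule_format, OF elim(6) enum[OF R0] win(4) k0nK] K0 n0 by (intro divide_right_mono) auto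
      also have "\<dots> = 7 * e + 80 * B * e * (R / K R) + 2 * B * D / n + C * ((k0 + int n) / K R)"
        using K0 n0 by (simp add: field_simps)
      also have "\<dots> \<le> 7 * e + 80 * B * e * 1 + \<epsilon> / 4 + \<epsilon> / 4"
      proof (intro add_mono)
        show "80 * B * e * (R / K R) \<le> 80 * B * e * 1"
          using elim(5) K0 B e by (intro mult_left_mono) (auto simp: field_simps)
        have "8 * B * D / \<epsilon> \<le> n" using win(2) elim(1) by simp
        then show "2 * B * D / n \<le> \<epsilon> / 4" using n0 \<epsilon> by (simp add: field_simps)
        have "(k0 + int n) / K R \<le> 3 * M R / R"
          using k0n elim(5) R0 K0 elim(2) by (intro frac_le) auto
        also have "\<dots> \<le> \<epsilon> / (4 * (C + 1))" using elim(3) C by (simp add: field_simps)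
        finally have "C * ((k0 + int n) / K R) \<le> C * (\<epsilon> / (4 * (C + 1)))" using C by (rule mult_left_mono)
        also have "\<dots> \<le> \<epsilon> / 4" using C \<epsilon> by (simp add: field_simps)
        finally show "C * ((k0 + int n) / K R) \<le> \<epsilon> / 4" .
      qed simp
      also have "\<dots> < \<epsilon>" using e(3) \<epsilon> by (simp add: algebra_simps)
      finally show ?case unfolding int by simp
    qed
  qed
  from tendsto_add[OF this limTK]
  show "((\<lambda>R. integral\<^sup>L (pair_law R (lam R) (M R) (L R)) f) \<longlongrightarrow> integral\<^sup>L limit_law f) at_top" by simp
qed

theorem theorem2p4:
  fixes lam :: "real \<Rightarrow> int \<Rightarrow> complex"
    and M L \<epsilon> \<delta> :: "real \<Rightarrow> real"
  assumes enum: "\<And>R. R > 0 \<Longrightarrow> arg_enum R (lam R)"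
    and eps: "(\<epsilon> \<longlongrightarrow> 0) at_top"
    and del: "(\<delta> \<longlongrightarrow> 0) at_top"
    and M_inf: "filterlim M at_top at_top"
    and M_le: "\<forall>\<^sub>F R in at_top. M R \<le> R powr (1/10 - \<epsilon> R)"
    and L_pos: "\<forall>\<^sub>F R in at_top. L R > 0"
    and L_ge: "\<forall>\<^sub>F R in at_top. M R powr (1/2 + \<delta> R) \<le> L R"
    and L_le: "\<forall>\<^sub>F R in at_top. L R \<le> M R"
  shows "weak_conv_along (\<lambda>R. pair_law R (lam R) (M R) (L R)) limit_law at_top"
proof (rule pair_law_weak_conv[OF enum M_inf])
  have M1: "\<forall>\<^sub>F R in at_top. 1 \<le> M R" using M_inf by (simp add: filterlim_at_top)
  \<comment> \<open>Eventually the exponent in the lower bound for L exceeds 1/4 and the exponent in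
    the upper bound for M is below 1/5; this yields L -> \<infinity> and M / R \<le> R powr (-
    4/5).\<close>
  have \<delta>: "\<forall>\<^sub>F R in at_top. - (1/4) < \<delta> R" using order_tendstoD(1)[OF del, of "- (1/4)"] by simp
  have \<epsilon>: "\<forall>\<^sub>F R in at_top. - (1/10) < \<epsilon> R" using order_tendstoD(1)[OF eps, of "- (1/10)"] by simp
  show "filterlim L at_top at_top"
    unfolding filterlim_at_top
  proof
    fix Z :: real
    define Z' where "Z' = max 1 Z"
    have Z': "1 \<le> Z'" "Z \<le> Z'" by (auto simp: Z'_def)
    \<comment> \<open>The fourth power matches the exponent 1/4 with which M bounds L from
      below.\<close>
    have "\<forall>\<^sub>F R in at_top. Z' ^ 4 \<le> M R" using M_inf by (simp add: filterlim_at_top)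
    with M1 \<delta> L_ge show "\<forall>\<^sub>F R in at_top. Z \<le> L R"
    proof eventually_elim
      case (elim R)
      have "Z' = (Z' ^ 4) powr (1/4)" using Z' by (simp add: powr_powr flip: powr_numeral)
      also have "\<dots> \<le> M R powr (1/4)" using elim Z' by (intro powr_mono2) auto
      also have "\<dots> \<le> M R powr (1/2 + \<delta> R)" using elim by (intro powr_mono) auto
      finally show ?case using elim Z' by linarith
    qed
  qed
  have lim: "((\<lambda>R :: real. R powr (- (4/5))) \<longlongrightarrow> 0) at_top"
    by (rule tendsto_neg_powr[OF _ filterlim_ident]) simp
  show "((\<lambda>R. M R / R) \<longlongrightarrow> 0) at_top"
  proof (rule Lim_null_comparison[OF _ lim])
    show "\<forall>\<^sub>F R in at_top. norm (M R / R) \<le> R powr (- (4/5))"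
      using M1 \<epsilon> M_le eventually_ge_at_top[of 1]
    proof eventually_elim
      case (elim R)
      have "R powr (1/10 - \<epsilon> R) \<le> R powr (1/5)" using elim by (intro powr_mono) auto
      then have "M R / R \<le> R powr (1/5) / R powr 1" using elim by (intro frac_le) auto
      also have "\<dots> = R powr (- (4/5))" unfolding powr_diff[symmetric] by simp
      finally show ?case using elim by simp
    qed
  qed
qed (use L_le in auto)

end
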